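(* Let $j:\mathbb{R}^3\to[0,+\infty]$ be a Borel-measurable kernel such that (i) $j(-z)=j(z)$ for all $z\in\mathbb{R}^3$; (ii) $\int_{\mathbb{R}^3}\min\{1,|z|^2\}\,j(z)\,dz<+\infty$; (iii) there exist $R_0>0$, $C>0$ and $s\in(0,1)$ such that $j(z)\ge \dfrac{C}{|z|^{3+2s}}$ for every $z\in B_{R_0}$ (the right-hand side being $+\infty$ at $z=0$). Then there exists a critical radius $R^*=R^*(j)\in(0,R_0/2)$ such that, for every $0<R\le R^*$, every minimizer $m_*\in\mathcal X^j(B_R;\mathbb{S}^2)$ of the energy $$\mathcal E_{B_R}(m):=\iint_{B_R\times B_R}j(x-y)|m(x)-m(y)|^2\,dx\,dy-\int_{B_R}h_d[m](x)\cdot m(x)\,dx$$ is constant (almost everywhere in $B_R$).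
   Context: $B_R\subseteq\mathbb{R}^3$ is the ball of radius $R$ centered at the origin. $\mathbb{S}^2$ is the unit sphere of $\mathbb{R}^3$, $L^2(B_R;\mathbb{S}^2):=\{m\in L^2(B_R;\mathbb{R}^3):|m|=1\text{ a.e. in }B_R\}$, and $$\mathcal X^j(B_R;\mathbb{S}^2):=\Big\{m\in L^2(B_R;\mathbb{S}^2):\iint_{B_R\times B_R}j(x-y)|m(x)-m(y)|^2\,dx\,dy<+\infty\Big\}.$$ "Minimizer" means minimizer of $\mathcal E_{B_R}$ over $\mathcal X^j(B_R;\mathbb{S}^2)$. For $m\in L^2(B_R;\mathbb{R}^3)$, the demagnetizing field $h_d[m]\in L^2(\mathbb{R}^3;\mathbb{R}^3)$ is the unique $L^2(\mathbb{R}^3;\mathbb{R}^3)$ solution (in the sense of distributions) of $$\operatorname{div}(m\chi_{B_R}+h_d[m])=0,\qquad \operatorname{curl}h_d[m]=0\qquad\text{in }\mathbb{R}^3,$$ where $m\chi_{B_R}$ is the extension of $m$ by zero outside $B_R$. *)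

theory Defs
  imports "HOL-Analysis.Analysis"
begin

definition L2 :: "(real^3) set \<Rightarrow> (real^3 \<Rightarrow> real^3) set" where
  "L2 \<Omega> = {m. m \<in> borel_measurable (lebesgue_on \<Omega>) \<and>
                integrable (lebesgue_on \<Omega>) (\<lambda>x. (norm (m x))\<^sup>2)}"

definition L2_sphere :: "(real^3) set \<Rightarrow> (real^3 \<Rightarrow> real^3) set" where
  "L2_sphere \<Omega> = {m \<in> L2 \<Omega>. AE x in lebesgue_on \<Omega>. norm (m x) = 1}"

definition nonlocal_energy ::
    "(real^3 \<Rightarrow> ennreal) \<Rightarrow> (real^3) set \<Rightarrow> (real^3 \<Rightarrow> real^3) \<Rightarrow> ennreal" where
  "nonlocal_energy j \<Omega> m =
     (\<integral>\<^sup>+ (x, y). j (x - y) * ennreal ((norm (m x - m y))\<^sup>2) \<partial>(lebesgue_on \<Omega> \<Otimes>\<^sub>M lebesgue_on \<Omega>))"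

definition X_space :: "(real^3 \<Rightarrow> ennreal) \<Rightarrow> (real^3) set \<Rightarrow> (real^3 \<Rightarrow> real^3) set" where
  "X_space j \<Omega> = {m \<in> L2_sphere \<Omega>. nonlocal_energy j \<Omega> m < \<infinity>}"

definition partial_deriv :: "3 \<Rightarrow> (real^3 \<Rightarrow> real) \<Rightarrow> real^3 \<Rightarrow> real" where
  "partial_deriv i \<phi> x = frechet_derivative \<phi> (at x) (axis i 1)"

definition grad :: "(real^3 \<Rightarrow> real) \<Rightarrow> real^3 \<Rightarrow> real^3" where
  "grad \<phi> x = (\<chi> i. partial_deriv i \<phi> x)"

text \<open>
  A \<open>k\<close> times continuously differentiable function. Total differentiability is required at each
  step, so that the Frechet derivative used in the partial derivatives is meaningful.
\<close>

fun Ck :: "nat \<Rightarrow> (real^3 \<Rightarrow> real) \<Rightarrow> bool" where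
  "Ck 0 \<phi> \<longleftrightarrow> continuous_on UNIV \<phi>"
| "Ck (Suc k) \<phi> \<longleftrightarrow> (\<forall>x. \<phi> differentiable (at x)) \<and> (\<forall>i. Ck k (partial_deriv i \<phi>))"

definition test_function :: "(real^3 \<Rightarrow> real) \<Rightarrow> bool" where
  "test_function \<phi> \<longleftrightarrow> (\<forall>k. Ck k \<phi>) \<and> compact (closure {x. \<phi> x \<noteq> 0})"

text \<open>
  Distributional divergence and curl of a locally integrable field \<open>V\<close>: integration by parts gives
  \<open>\<langle>div V, \<phi>\<rangle> = - \<integral> V \<bullet> grad \<phi>\<close> and, since \<open>curl (\<phi> V) = grad \<phi> \<times> V + \<phi> curl V\<close>,
  \<open>\<langle>curl V, \<phi>\<rangle> = - \<integral> grad \<phi> \<times> V\<close>.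
\<close>

definition div_zero :: "(real^3 \<Rightarrow> real^3) \<Rightarrow> bool" where
  "div_zero V \<longleftrightarrow> (\<forall>\<phi>. test_function \<phi> \<longrightarrow> (\<integral>x. V x \<bullet> grad \<phi> x \<partial>lebesgue) = 0)"

context includes cross3_syntax
begin

definition curl_zero :: "(real^3 \<Rightarrow> real^3) \<Rightarrow> bool" where
  "curl_zero V \<longleftrightarrow> (\<forall>\<phi>. test_function \<phi> \<longrightarrow> (\<integral>x. grad \<phi> x \<times> V x \<partial>lebesgue) = 0)"

end

definition is_demag_field ::
    "(real^3) set \<Rightarrow> (real^3 \<Rightarrow> real^3) \<Rightarrow> (real^3 \<Rightarrow> real^3) \<Rightarrow> bool" where
  "is_demag_field \<Omega> m h \<longleftrightarrow>
     h \<in> L2 UNIV \<and> div_zero (\<lambda>x. indicator \<Omega> x *\<^sub>R m x + h x) \<and> curl_zero h"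

text \<open>
  The solution is unique only as an element of \<open>L\<^sup>2\<close>, that is up to null sets, so a representative is
  chosen; the energy below does not depend on the choice.
\<close>

definition demag_field :: "(real^3) set \<Rightarrow> (real^3 \<Rightarrow> real^3) \<Rightarrow> real^3 \<Rightarrow> real^3" where
  "demag_field \<Omega> m = (SOME h. is_demag_field \<Omega> m h)"

text \<open>The value is meant for \<open>m \<in> X_space j \<Omega>\<close>, where the nonlocal term is finite.\<close>

definition energy :: "(real^3 \<Rightarrow> ennreal) \<Rightarrow> (real^3) set \<Rightarrow> (real^3 \<Rightarrow> real^3) \<Rightarrow> real" where
  "energy j \<Omega> m =
     enn2real (nonlocal_energy j \<Omega> m) - (\<integral>x. demag_field \<Omega> m x \<bullet> m x \<partial>lebesgue_on \<Omega>)"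

definition is_minimizer :: "(real^3 \<Rightarrow> ennreal) \<Rightarrow> (real^3) set \<Rightarrow> (real^3 \<Rightarrow> real^3) \<Rightarrow> bool" where
  "is_minimizer j \<Omega> m \<longleftrightarrow>
     m \<in> X_space j \<Omega> \<and> (\<forall>m'\<in>X_space j \<Omega>. energy j \<Omega> m \<le> energy j \<Omega> m')"

text \<open>
  The division is that of \<open>ennreal\<close>: for \<open>C > 0\<close> and \<open>s > 0\<close> the denominator vanishes at \<open>z = 0\<close>
  and the value there is \<open>\<infinity>\<close>.
\<close>

definition kernel_lower_bound :: "real \<Rightarrow> real \<Rightarrow> real^3 \<Rightarrow> ennreal" where
  "kernel_lower_bound C s z = ennreal C / ennreal (norm z powr (3 + 2 * s))"

end

theory Submission
  imports Defs "HOL-Computational_Algebra.Polynomial"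
begin

text \<open>
  Let \<open>V\<close> be the volume of \<open>B\<^sub>R\<close> and \<open>M = \<integral> m\<close>. The magnetostatic energy of \<open>m\<close> is \<open>\<parallel>h\<^sub>d[m]\<parallel>\<^sup>2\<close>. A constant
  field \<open>c\<close> magnetises the ball uniformly, \<open>h\<^sub>d[c] = - c / 3\<close> inside, so \<open>m\<close> and its mean have the
  same interaction energy as the mean with itself; hence \<open>\<parallel>h\<^sub>d[m]\<parallel>\<^sup>2 \<ge> |M|\<^sup>2 / (3 V)\<close>, with value \<open>V / 3\<close> for a
  constant unit field. On the other hand \<open>j \<ge> C / (2 R) powr (3 + 2 s)\<close> on differences of points of the
  ball, so the nonlocal energy is at least \<open>C / (2 R) powr (3 + 2 s)\<close> times \<open>2 (V\<^sup>2 - |M|\<^sup>2)\<close>. Comparing a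
  minimizer with a constant forces \<open>|M| = V\<close> once \<open>(2 R) powr (2 s) \<le> C\<close>, that is, \<open>m\<close> is constant.

  Both the existence of \<open>h\<^sub>d\<close> and these energy identities rest on the Helmholtz decomposition: \<open>- h\<^sub>d[m]\<close>
  is the projection of \<open>m\<close> onto the closure of the gradients of test functions, and square integrable
  fields that are divergence and curl free vanish. The latter is Liouville's theorem for weakly
  harmonic functions, obtained from a scaling family of radial mollifiers.
\<close>

section \<open>Square integrable fields\<close>

text \<open>The comparison needs neither compactness nor regularity, because both competing terms
  are multiples of the same deficit \<open>V^2 - |M|^2\<close>: giving up the constant state saves
  at most the deficit divided by \<open>3 V\<close>. With \<open>\<kappa>\<close> for the lower
  bound of the kernel, everything depends on \<open>6 \<kappa> V > 1\<close>. Since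
  \<open>\<kappa>\<close> grows like \<open>R powr -(3 + 2 s)\<close> while \<open>V\<close> shrinks
  only like \<open>R^3\<close>, the product is of order \<open>R powr -(2 s)\<close>, and small
  balls win. The obstacle is that the field is known only through weak equations and an arbitrary
  choice. The divergence equation may be tested with gradients of compactly supported functions,
  whereas the energy identities test it with square integrable curl free fields such as
  \<open>h\<^sub>d[m]\<close> itself or the dipole field, which decays like \<open>|x|^-3\<close>
  and is not compactly supported. Liouville's theorem closes this gap: it shows that every such
  field is a limit of gradients of test functions.\<close>

definition sq_integrable :: "'a measure \<Rightarrow> ('a \<Rightarrow> 'b::euclidean_space) \<Rightarrow> bool" where
  "sq_integrable M f \<longleftrightarrow> f \<in> borel_measurable M \<and> integrable M (\<lambda>x. (norm (f x))\<^sup>2)"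

lemma sq_integrable_measurable [measurable_dest]:
  "sq_integrable M f \<Longrightarrow> f \<in> borel_measurable M"
  by (simp add: sq_integrable_def)

lemma sq_integrable_norm: "sq_integrable M f \<Longrightarrow> integrable M (\<lambda>x. (norm (f x))\<^sup>2)"
  by (simp add: sq_integrable_def)

lemma sq_integrable_bound:
  assumes f: "f \<in> borel_measurable M" and g: "integrable M g"
    and le: "AE x in M. (norm (f x))\<^sup>2 \<le> g x"
  shows "sq_integrable M f"
  unfolding sq_integrable_def
proof
  show "integrable M (\<lambda>x. (norm (f x))\<^sup>2)"
    using f le by (intro Bochner_Integration.integrable_bound[OF g]) auto
qed (rule f)

lemma sq_integrable_inner:
  assumes "sq_integrable M f" "sq_integrable M g"
  shows "integrable M (\<lambda>x. f x \<bullet> g x)"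
proof (rule Bochner_Integration.integrable_bound)
  show "integrable M (\<lambda>x. (norm (f x))\<^sup>2 + (norm (g x))\<^sup>2)"
    using assms by (intro Bochner_Integration.integrable_add sq_integrable_norm)
  show "(\<lambda>x. f x \<bullet> g x) \<in> borel_measurable M"
    using assms by (intro borel_measurable_inner sq_integrable_measurable)
  have "\<bar>f x \<bullet> g x\<bar> \<le> (norm (f x))\<^sup>2 + (norm (g x))\<^sup>2" for x
  proof -
    have "\<bar>f x \<bullet> g x\<bar> \<le> norm (f x) * norm (g x)" by (rule Cauchy_Schwarz_ineq2)
    also have "\<dots> \<le> (norm (f x))\<^sup>2 + (norm (g x))\<^sup>2"
      using sum_squares_bound[of "norm (f x)" "norm (g x)"]
        mult_nonneg_nonneg[OF norm_ge_zero[of "f x"] norm_ge_zero[of "g x"]] by linarith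
    finally show ?thesis .
  qed
  then show "AE x in M. norm (f x \<bullet> g x) \<le> norm ((norm (f x))\<^sup>2 + (norm (g x))\<^sup>2)"
    by auto
qed

lemma sq_integrable_scaleR: "sq_integrable M f \<Longrightarrow> sq_integrable M (\<lambda>x. c *\<^sub>R f x)"
  by (auto simp: sq_integrable_def power_mult_distrib)

lemma sq_integrable_add:
  assumes "sq_integrable M f" "sq_integrable M g"
  shows "sq_integrable M (\<lambda>x. f x + g x)"
proof -
  have "(norm (f x + g x))\<^sup>2 = (norm (f x))\<^sup>2 + 2 * (f x \<bullet> g x) + (norm (g x))\<^sup>2" for x
    by (simp add: power2_norm_eq_inner inner_add inner_commute)
  then have "integrable M (\<lambda>x. (norm (f x + g x))\<^sup>2)"
    using sq_integrable_norm[OF assms(1)] sq_integrable_norm[OF assms(2)] sq_integrable_inner[OF assms]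
    by (simp only:) (intro Bochner_Integration.integrable_add integrable_mult_right)
  then show ?thesis
    using assms by (auto simp: sq_integrable_def)
qed

lemma sq_integrable_uminus: "sq_integrable M f \<Longrightarrow> sq_integrable M (\<lambda>x. - f x)"
  by (auto simp: sq_integrable_def)

lemma sq_integrable_diff:
  assumes "sq_integrable M f" "sq_integrable M g"
  shows "sq_integrable M (\<lambda>x. f x - g x)"
  using sq_integrable_add[OF assms(1) sq_integrable_uminus[OF assms(2)]] by simp

lemma integral_norm_add_sq:
  assumes "sq_integrable M f" "sq_integrable M g"
  shows "(\<integral>x. (norm (f x + t *\<^sub>R g x))\<^sup>2 \<partial>M)
    = (\<integral>x. (norm (f x))\<^sup>2 \<partial>M) + 2 * t * (\<integral>x. f x \<bullet> g x \<partial>M) + t\<^sup>2 * (\<integral>x. (norm (g x))\<^sup>2 \<partial>M)"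
proof -
  have "(norm (f x + t *\<^sub>R g x))\<^sup>2 = (norm (f x))\<^sup>2 + 2 * t * (f x \<bullet> g x) + t\<^sup>2 * (norm (g x))\<^sup>2" for x
    unfolding power2_norm_eq_inner by (simp add: inner_add inner_commute power2_eq_square)
  then show ?thesis
    using sq_integrable_norm[OF assms(1)] sq_integrable_norm[OF assms(2)] sq_integrable_inner[OF assms]
    by (simp only: Bochner_Integration.integral_add Bochner_Integration.integrable_add
        integrable_mult_right integral_mult_right_zero)
qed

lemma integral_inner_Cauchy_Schwarz:
  assumes f: "sq_integrable M f" and g: "sq_integrable M g"
  shows "(\<integral>x. f x \<bullet> g x \<partial>M)\<^sup>2 \<le> (\<integral>x. (norm (f x))\<^sup>2 \<partial>M) * (\<integral>x. (norm (g x))\<^sup>2 \<partial>M)"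
proof -
  let ?a = "\<integral>x. (norm (f x))\<^sup>2 \<partial>M" and ?b = "\<integral>x. f x \<bullet> g x \<partial>M" and ?c = "\<integral>x. (norm (g x))\<^sup>2 \<partial>M"
  have q: "0 \<le> ?a + 2 * t * ?b + t\<^sup>2 * ?c" for t
    unfolding integral_norm_add_sq[OF f g, symmetric] by simp
  have c0: "?c \<ge> 0" by simp
  show ?thesis
  proof (cases "?c = 0")
    case True
    have "?b = 0"
    proof (rule ccontr)
      assume "?b \<noteq> 0"
      \<comment> \<open>With vanishing quadratic coefficient the form is affine in \<open>t\<close>;
        this \<open>t\<close> makes its value \<open>-1\<close>.\<close>
      then show False using q[of "- (?a + 1) / (2 * ?b)"] True by (simp add: field_simps)
    qed
    then show ?thesis using True by simp
  next
    case False
    then have "?c > 0" using c0 by linarith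
    then show ?thesis using q[of "- ?b / ?c"] by (simp add: field_simps power2_eq_square)
  qed
qed

section \<open>Strong convergence, completeness and orthogonal projection\<close>

lemma tendsto_integral_inner:
  assumes s: "\<And>n. sq_integrable M (s n)" and p: "sq_integrable M p" and g: "sq_integrable M g"
    and lim: "(\<lambda>n. \<integral>x. (norm (s n x - p x))\<^sup>2 \<partial>M) \<longlonglongrightarrow> 0"
  shows "(\<lambda>n. \<integral>x. s n x \<bullet> g x \<partial>M) \<longlonglongrightarrow> (\<integral>x. p x \<bullet> g x \<partial>M)"
proof -
  let ?c = "\<integral>x. (norm (g x))\<^sup>2 \<partial>M"
  have le: "\<bar>(\<integral>x. s n x \<bullet> g x \<partial>M) - (\<integral>x. p x \<bullet> g x \<partial>M)\<bar>
      \<le> sqrt ((\<integral>x. (norm (s n x - p x))\<^sup>2 \<partial>M) * ?c)" for n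
  proof -
    have "(\<integral>x. s n x \<bullet> g x \<partial>M) - (\<integral>x. p x \<bullet> g x \<partial>M) = (\<integral>x. (s n x - p x) \<bullet> g x \<partial>M)"
      using sq_integrable_inner[OF s g, of n] sq_integrable_inner[OF p g]
      by (simp add: inner_diff_left)
    then show ?thesis
      using integral_inner_Cauchy_Schwarz[OF sq_integrable_diff[OF s p] g, of n]
      by (simp add: real_le_rsqrt)
  qed
  have "(\<lambda>n. sqrt ((\<integral>x. (norm (s n x - p x))\<^sup>2 \<partial>M) * ?c)) \<longlonglongrightarrow> sqrt (0 * ?c)"
    by (intro tendsto_intros lim)
  then have 0: "(\<lambda>n. sqrt ((\<integral>x. (norm (s n x - p x))\<^sup>2 \<partial>M) * ?c)) \<longlonglongrightarrow> 0"
    by simp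
  have "(\<lambda>n. (\<integral>x. s n x \<bullet> g x \<partial>M) - (\<integral>x. p x \<bullet> g x \<partial>M)) \<longlonglongrightarrow> 0"
    by (rule Lim_null_comparison[OF _ 0]) (simp only: real_norm_def le eventually_True)
  then show ?thesis
    by (rule LIM_zero_cancel)
qed

text \<open>On an infinite measure space the increments need not be integrable, so they cannot
  simply be summed in \<open>L1\<close>. Their squares can: weighted by \<open>2^n\<close> they
  still have summable integrals, hence a finite sum almost everywhere.\<close>

lemma AE_convergent_fast_Cauchy:
  fixes f :: "nat \<Rightarrow> 'a \<Rightarrow> 'b::euclidean_space"
  assumes f: "\<And>n. sq_integrable M (f n)"
    and small: "\<And>n. (\<integral>x. (norm (f (Suc n) x - f n x))\<^sup>2 \<partial>M) \<le> (1/4)^n"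
  shows "AE x in M. convergent (\<lambda>n. f n x)"
proof -
  define g where "g n x = (norm (f (Suc n) x - f n x))\<^sup>2" for n x
  have [measurable]: "f n \<in> borel_measurable M" for n
    using f by (simp add: sq_integrable_def)
  have gm [measurable]: "g n \<in> borel_measurable M" for n
    unfolding g_def by measurable
  have "(\<integral>\<^sup>+x. (\<Sum>n. ennreal (2^n * g n x)) \<partial>M) = (\<Sum>n. \<integral>\<^sup>+x. ennreal (2^n * g n x) \<partial>M)"
    by (rule nn_integral_suminf) measurable
  also have "\<dots> \<le> (\<Sum>n. ennreal ((1/2)^n))"
  proof (rule suminf_le)
    fix n
    have "integrable M (g n)"
      unfolding g_def using sq_integrable_diff[OF f[of "Suc n"] f[of n]]
      by (simp add: sq_integrable_def)
    moreover have "0 \<le> g n x" for x by (simp add: g_def)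
    ultimately have "(\<integral>\<^sup>+x. ennreal (2^n * g n x) \<partial>M) = ennreal (2^n * (\<integral>x. g n x \<partial>M))"
      by (subst nn_integral_eq_integral) auto
    also have "\<dots> \<le> ennreal (2^n * (1/4)^n)"
      using small[of n] unfolding g_def by (intro ennreal_leI mult_left_mono) auto
    also have "2^n * (1/4)^n = (1/2::real)^n"
      by (simp flip: power_mult_distrib)
    finally show "(\<integral>\<^sup>+x. ennreal (2^n * g n x) \<partial>M) \<le> ennreal ((1/2)^n)" .
  qed auto
  also have "\<dots> < \<infinity>"
    by (subst suminf_ennreal2) (auto intro!: summable_geometric)
  finally have "AE x in M. (\<Sum>n. ennreal (2^n * g n x)) \<noteq> \<infinity>"
    by (intro nn_integral_PInf_AE) auto
  then show ?thesis
  proof eventually_elim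
    case (elim x)
    have "summable (\<lambda>n. 2^n * g n x)"
      using elim by (intro summable_suminf_not_top) (auto simp: g_def)
    then have sm: "summable (\<lambda>n. 2^n * g n x + (1/2)^n)"
      by (intro summable_add summable_geometric) auto
    \<comment> \<open>The weighted squares control the increments themselves: a number
      \<open>a \<ge> 1 / 2^n\<close> satisfies \<open>a \<le> 2^n * a^2\<close>, and a smaller one
      is below the geometric term.\<close>
    have "norm (f (Suc n) x - f n x) \<le> 2^n * g n x + (1/2)^n" for n
    proof -
      let ?a = "norm (f (Suc n) x - f n x)"
      show ?thesis
      proof (cases "2^n * ?a \<ge> 1")
        case True
        then have "?a * 1 \<le> ?a * (2^n * ?a)" by (intro mult_left_mono) auto
        then have "?a \<le> 2^n * g n x" by (simp add: g_def power2_eq_square mult_ac)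
        moreover have "0 \<le> (1/2::real)^n" by simp
        ultimately show ?thesis by linarith
      next
        case False
        then have "?a \<le> (1/2)^n" by (simp add: power_one_over field_simps)
        moreover have "2^n * g n x \<ge> 0" by (simp add: g_def)
        ultimately show ?thesis by linarith
      qed
    qed
    then have "summable (\<lambda>n. f (Suc n) x - f n x)"
      by (intro summable_comparison_test'[OF sm, of 0])
    then have "convergent (\<lambda>n. \<Sum>i<n. f (Suc i) x - f i x)"
      by (simp add: summable_iff_convergent)
    then have "convergent (\<lambda>n. f n x - f 0 x)"
      by (simp only: sum_lessThan_telescope[of "\<lambda>n. f n x"])
    then have "convergent (\<lambda>n. (f n x - f 0 x) + f 0 x)"
      by (rule convergent_add) (rule convergent_const)
    then show ?case by simp
  qed
qed

theorem sq_integrable_complete: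
  fixes f :: "nat \<Rightarrow> 'a \<Rightarrow> 'b::euclidean_space"
  assumes f: "\<And>n. sq_integrable M (f n)"
    and Cauchy: "\<And>e. e > 0 \<Longrightarrow> \<exists>N. \<forall>m\<ge>N. \<forall>n\<ge>N. (\<integral>x. (norm (f m x - f n x))\<^sup>2 \<partial>M) \<le> e"
  obtains p where "sq_integrable M p" "(\<lambda>n. \<integral>x. (norm (f n x - p x))\<^sup>2 \<partial>M) \<longlonglongrightarrow> 0"
proof -
  have "\<forall>k. \<exists>N. \<forall>m\<ge>N. \<forall>n\<ge>N. (\<integral>x. (norm (f m x - f n x))\<^sup>2 \<partial>M) \<le> (1/4)^k"
    using Cauchy by auto
  then obtain N where N: "\<And>k m n. m \<ge> N k \<Longrightarrow> n \<ge> N k \<Longrightarrow> (\<integral>x. (norm (f m x - f n x))\<^sup>2 \<partial>M) \<le> (1/4)^k"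
    by metis
  \<comment> \<open>Summing all thresholds up to \<open>k\<close> makes \<open>r (Suc k)\<close>
    reach \<open>N k\<close> as well, so both members of a consecutive pair lie where the bound
    \<open>(1/4)^k\<close> holds; the summand \<open>k\<close> makes the indices unbounded.\<close>
  define r where "r k = (\<Sum>i\<le>k. N i) + k" for k
  have rN: "r k \<ge> N k" for k unfolding r_def by (simp add: member_le_sum trans_le_add1)
  have rS: "r (Suc k) \<ge> N k" for k
    using rN[of k] unfolding r_def by simp
  have rk: "r k \<ge> k" for k unfolding r_def by simp
  have "AE x in M. convergent (\<lambda>k. f (r k) x)"
    by (rule AE_convergent_fast_Cauchy) (auto intro!: f N rN rS)
  then have conv: "AE x in M. (\<lambda>k. f (r k) x) \<longlonglongrightarrow> lim (\<lambda>k. f (r k) x)"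
    by eventually_elim (simp add: convergent_LIMSEQ_iff)
  define p where "p x = lim (\<lambda>k. f (r k) x)" for x
  have fm [measurable]: "f n \<in> borel_measurable M" for n
    using f by (simp add: sq_integrable_def)
  have pm [measurable]: "p \<in> borel_measurable M"
    unfolding p_def by (rule borel_measurable_lim_metric) measurable
  \<comment> \<open>Fatou's lemma along the subsequence, with \<open>n\<close> fixed. The
    nonnegative integral is used because integrability of the squared norm of \<open>f n - p\<close>
    is not known yet; it is read off from this bound.\<close>
  have le: "\<exists>N. \<forall>n\<ge>N. (\<integral>\<^sup>+x. ennreal ((norm (f n x - p x))\<^sup>2) \<partial>M) \<le> ennreal e" if "e > 0" for e
  proof -
    from Cauchy[OF that]
    obtain K where K: "\<And>m n. m \<ge> K \<Longrightarrow> n \<ge> K \<Longrightarrow> (\<integral>x. (norm (f m x - f n x))\<^sup>2 \<partial>M) \<le> e"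
      by blast
    have "(\<integral>\<^sup>+x. ennreal ((norm (f n x - p x))\<^sup>2) \<partial>M) \<le> ennreal e" if n: "n \<ge> K" for n
    proof -
      have "AE x in M. ennreal ((norm (f n x - p x))\<^sup>2)
          = liminf (\<lambda>k. ennreal ((norm (f n x - f (r k) x))\<^sup>2))"
        using conv
      proof eventually_elim
        case (elim x)
        have "(\<lambda>k. ennreal ((norm (f n x - f (r k) x))\<^sup>2)) \<longlonglongrightarrow> ennreal ((norm (f n x - p x))\<^sup>2)"
          unfolding p_def by (intro tendsto_intros elim tendsto_ennrealI)
        then show ?case
          by (metis lim_imp_Liminf sequentially_bot)
      qed
      then have "(\<integral>\<^sup>+x. ennreal ((norm (f n x - p x))\<^sup>2) \<partial>M)
          = (\<integral>\<^sup>+x. liminf (\<lambda>k. ennreal ((norm (f n x - f (r k) x))\<^sup>2)) \<partial>M)"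
        by (rule nn_integral_cong_AE)
      also have "\<dots> \<le> liminf (\<lambda>k. \<integral>\<^sup>+x. ennreal ((norm (f n x - f (r k) x))\<^sup>2) \<partial>M)"
        by (rule nn_integral_liminf) measurable
      also have "\<dots> \<le> ennreal e"
      proof (rule Liminf_le)
        have "(\<integral>\<^sup>+x. ennreal ((norm (f n x - f (r k) x))\<^sup>2) \<partial>M) \<le> ennreal e" if "k \<ge> K" for k
        proof -
          have "(\<integral>\<^sup>+x. ennreal ((norm (f n x - f (r k) x))\<^sup>2) \<partial>M)
              = ennreal (\<integral>x. (norm (f n x - f (r k) x))\<^sup>2 \<partial>M)"
            using sq_integrable_diff[OF f[of n] f[of "r k"]]
            by (intro nn_integral_eq_integral) (auto simp: sq_integrable_def)
          also have "\<dots> \<le> ennreal e"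
            using K[OF n, of "r k"] rk[of k] that by (intro ennreal_leI) auto
          finally show ?thesis .
        qed
        then show "\<forall>\<^sub>F k in sequentially. (\<integral>\<^sup>+x. ennreal ((norm (f n x - f (r k) x))\<^sup>2) \<partial>M) \<le> ennreal e"
          by (auto simp: eventually_sequentially)
      qed auto
      finally show ?thesis .
    qed
    then show ?thesis by blast
  qed
  have diff: "\<exists>N. \<forall>n\<ge>N. sq_integrable M (\<lambda>x. f n x - p x) \<and> (\<integral>x. (norm (f n x - p x))\<^sup>2 \<partial>M) \<le> e"
    if "e > 0" for e
  proof -
    from le[OF that]
    obtain K where K: "\<And>n. n \<ge> K \<Longrightarrow> (\<integral>\<^sup>+x. ennreal ((norm (f n x - p x))\<^sup>2) \<partial>M) \<le> ennreal e"
      by blast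
    have "sq_integrable M (\<lambda>x. f n x - p x) \<and> (\<integral>x. (norm (f n x - p x))\<^sup>2 \<partial>M) \<le> e" if "n \<ge> K" for n
    proof
      have "(\<integral>\<^sup>+x. ennreal ((norm (f n x - p x))\<^sup>2) \<partial>M) < \<infinity>"
        using K[OF that] by (rule le_less_trans) simp
      then show "sq_integrable M (\<lambda>x. f n x - p x)"
        unfolding sq_integrable_def by (auto simp: integrable_iff_bounded)
      then have "ennreal (\<integral>x. (norm (f n x - p x))\<^sup>2 \<partial>M) \<le> ennreal e"
        using K[OF that] by (subst (asm) nn_integral_eq_integral) (auto simp: sq_integrable_def)
      then show "(\<integral>x. (norm (f n x - p x))\<^sup>2 \<partial>M) \<le> e"
        using \<open>e > 0\<close> by simp
    qed
    then show ?thesis by blast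
  qed
  show ?thesis
  proof
    obtain n where "sq_integrable M (\<lambda>x. f n x - p x)"
      using diff[of 1] by auto
    from sq_integrable_diff[OF f[of n] this] show "sq_integrable M p" by simp
    show "(\<lambda>n. \<integral>x. (norm (f n x - p x))\<^sup>2 \<partial>M) \<longlonglongrightarrow> 0"
    proof (rule LIMSEQ_I)
      fix e :: real assume "e > 0"
      then obtain K where "\<And>n. n \<ge> K \<Longrightarrow> (\<integral>x. (norm (f n x - p x))\<^sup>2 \<partial>M) \<le> e / 2"
        using diff[of "e/2"] by auto
      then show "\<exists>no. \<forall>n\<ge>no. norm ((\<integral>x. (norm (f n x - p x))\<^sup>2 \<partial>M) - 0) < e"
        using \<open>e > 0\<close> by (intro exI[of _ K]) (fastforce intro: le_less_trans)
    qed
  qed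
qed

text \<open>\<open>S\<close> is only a linear subspace, so the nearest point \<open>p\<close> to
  \<open>u\<close> lies in its closure. The sequence \<open>s\<close> is returned together with
  \<open>p\<close>, because properties of the members of \<open>S\<close> reach \<open>p\<close>
  through it.\<close>

theorem sq_integrable_projection:
  fixes S :: "('a \<Rightarrow> 'b::euclidean_space) set"
  assumes S: "\<And>s. s \<in> S \<Longrightarrow> sq_integrable M s" and zero: "(\<lambda>_. 0) \<in> S"
    and add: "\<And>s t. s \<in> S \<Longrightarrow> t \<in> S \<Longrightarrow> (\<lambda>x. s x + t x) \<in> S"
    and scale: "\<And>s c. s \<in> S \<Longrightarrow> (\<lambda>x. c *\<^sub>R s x) \<in> S"
    and u: "sq_integrable M u"
  obtains p s where "sq_integrable M p" "\<And>n. s n \<in> S"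
    "(\<lambda>n. \<integral>x. (norm (s n x - p x))\<^sup>2 \<partial>M) \<longlonglongrightarrow> 0"
    "\<And>g. g \<in> S \<Longrightarrow> (\<integral>x. (u x - p x) \<bullet> g x \<partial>M) = 0"
proof -
  define D where "D s = (\<integral>x. (norm (u x - s x))\<^sup>2 \<partial>M)" for s
  define d where "d = Inf (D ` S)"
  have bdd: "bdd_below (D ` S)"
    by (rule bdd_belowI[of _ 0]) (auto simp: D_def)
  have d_le: "d \<le> D s" if "s \<in> S" for s
    unfolding d_def using that by (intro cInf_lower bdd) auto
  have "\<exists>s\<in>S. D s < d + 1 / Suc n" for n
  proof -
    have "Inf (D ` S) < d + 1 / Suc n" unfolding d_def by simp
    then show ?thesis using zero bdd by (subst (asm) cInf_less_iff) auto
  qed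
  then obtain s where sS: "\<And>n. s n \<in> S" and sd: "\<And>n. D (s n) < d + 1 / Suc n"
    by metis
  \<comment> \<open>Parallelogram identity: the midpoint again lies in \<open>S\<close>, so its
    squared distance from \<open>u\<close> is at least the infimum, and the minimizing sequence is
    Cauchy.\<close>
  have par: "(\<integral>x. (norm (s m x - s n x))\<^sup>2 \<partial>M) \<le> 2 / Suc m + 2 / Suc n" for m n
  proof -
    let ?a = "\<lambda>x. u x - s m x" and ?b = "\<lambda>x. u x - s n x"
    let ?h = "\<lambda>x. (1/2) *\<^sub>R (s m x + s n x)"
    have a: "sq_integrable M ?a" and b: "sq_integrable M ?b"
      using u S[OF sS] by (auto intro: sq_integrable_diff)
    have h: "?h \<in> S" using add scale sS by blast
    have "(norm (s m x - s n x))\<^sup>2 = 2 * (norm (?a x))\<^sup>2 + 2 * (norm (?b x))\<^sup>2 - 4 * (norm (u x - ?h x))\<^sup>2" for x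
      unfolding power2_norm_eq_inner
      by (simp add: inner_add inner_diff inner_commute algebra_simps)
    moreover have "integrable M (\<lambda>x. (norm (u x - ?h x))\<^sup>2)"
      using sq_integrable_diff[OF u S[OF h]] by (simp add: sq_integrable_def)
    ultimately have "(\<integral>x. (norm (s m x - s n x))\<^sup>2 \<partial>M) = 2 * D (s m) + 2 * D (s n) - 4 * D ?h"
      using a b by (simp add: D_def sq_integrable_def)
    then show ?thesis using sd[of m] sd[of n] d_le[OF h] by simp
  qed
  have "\<exists>N. \<forall>m\<ge>N. \<forall>n\<ge>N. (\<integral>x. (norm (s m x - s n x))\<^sup>2 \<partial>M) \<le> e" if e: "e > 0" for e
  proof -
    obtain N where N: "inverse (real (Suc N)) < e / 4"
      using reals_Archimedean[of "e/4"] e by auto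
    have "1 / real (Suc m) \<le> e / 4" if "m \<ge> N" for m
    proof -
      have "1 / real (Suc m) \<le> 1 / real (Suc N)" using that by (intro divide_left_mono) auto
      then show ?thesis using N by (simp add: inverse_eq_divide)
    qed
    note small = this
    have "(\<integral>x. (norm (s m x - s n x))\<^sup>2 \<partial>M) \<le> e" if "m \<ge> N" "n \<ge> N" for m n
      using par[of m n] small[OF that(1)] small[OF that(2)] by linarith
    then show ?thesis by blast
  qed
  from sq_integrable_complete[OF S[OF sS] this]
  obtain p where p: "sq_integrable M p" and lim: "(\<lambda>n. \<integral>x. (norm (s n x - p x))\<^sup>2 \<partial>M) \<longlonglongrightarrow> 0" .
  show ?thesis
  proof (rule that[OF p sS lim])
    fix g assume g: "g \<in> S"
    let ?c = "\<integral>x. (norm (g x))\<^sup>2 \<partial>M" and ?b = "\<integral>x. (u x - p x) \<bullet> g x \<partial>M"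
    have split: "(\<integral>x. (u x - q x) \<bullet> g x \<partial>M) = (\<integral>x. u x \<bullet> g x \<partial>M) - (\<integral>x. q x \<bullet> g x \<partial>M)"
      if "sq_integrable M q" for q
      using sq_integrable_inner[OF u S[OF g]] sq_integrable_inner[OF that S[OF g]]
      by (simp add: inner_diff_left)
    have "(\<lambda>n. \<integral>x. (u x - s n x) \<bullet> g x \<partial>M) \<longlonglongrightarrow> ?b"
      unfolding split[OF S[OF sS]] split[OF p]
      by (intro tendsto_intros tendsto_integral_inner S sS g p lim)
    \<comment> \<open>The first variation is taken at \<open>s n\<close>, because
      \<open>p + t g\<close> need not belong to \<open>S\<close>; the defect
      \<open>1 / (n + 1)\<close> of the minimizing sequence disappears in the limit.\<close>
    have key: "2 * t * ?b \<le> t\<^sup>2 * ?c" for t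
    proof -
      have "(\<lambda>n. 2 * t * (\<integral>x. (u x - s n x) \<bullet> g x \<partial>M)) \<longlonglongrightarrow> 2 * t * ?b"
        by (intro tendsto_intros) fact
      moreover have "(\<lambda>n. 1 / real (Suc n) + t\<^sup>2 * ?c) \<longlonglongrightarrow> 0 + t\<^sup>2 * ?c"
        by (intro tendsto_intros LIMSEQ_Suc[OF lim_1_over_n])
      moreover have "2 * t * (\<integral>x. (u x - s n x) \<bullet> g x \<partial>M) \<le> 1 / real (Suc n) + t\<^sup>2 * ?c" for n
      proof -
        have "(\<lambda>x. s n x + t *\<^sub>R g x) \<in> S" using add scale sS g by blast
        then have "d \<le> (\<integral>x. (norm (u x - (s n x + t *\<^sub>R g x)))\<^sup>2 \<partial>M)"
          using d_le D_def by force
        also have "\<dots> = (\<integral>x. (norm ((u x - s n x) + (- t) *\<^sub>R g x))\<^sup>2 \<partial>M)"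
          by (simp add: algebra_simps)
        also have "\<dots> = D (s n) - 2 * t * (\<integral>x. (u x - s n x) \<bullet> g x \<partial>M) + t\<^sup>2 * ?c"
          unfolding D_def
          by (subst integral_norm_add_sq) (auto intro: sq_integrable_diff u S sS g)
        finally show ?thesis using sd[of n] by linarith
      qed
      ultimately show ?thesis
        by (intro LIMSEQ_le) auto
    qed
    show "?b = 0"
    proof (rule ccontr)
      assume b: "?b \<noteq> 0"
      \<comment> \<open>For \<open>b \<noteq> 0\<close> a suitable multiple of \<open>b\<close>
        violates the inequality \<open>key\<close>; dividing by \<open>c + 1\<close> instead of
        \<open>c\<close> covers \<open>c = 0\<close>.\<close>
      have *: False if "b \<noteq> 0" "0 \<le> c" "2 * (b / (c + 1)) * b \<le> (b / (c + 1))\<^sup>2 * c" for b c :: real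
      proof -
        define t where "t = b / (c + 1)"
        have bt: "b = t * (c + 1)" and "t \<noteq> 0" using that by (auto simp: t_def)
        have "t\<^sup>2 * (2 * (c + 1)) = 2 * t * b"
          unfolding bt by (simp add: power2_eq_square algebra_simps)
        also have "\<dots> \<le> t\<^sup>2 * c"
          using that(3) by (simp add: t_def)
        finally have "t\<^sup>2 * (2 * (c + 1)) \<le> t\<^sup>2 * c" .
        then have "2 * (c + 1) \<le> c"
          using \<open>t \<noteq> 0\<close> by (subst (asm) mult_le_cancel_left_pos) auto
        then show False using that(2) by (simp add: algebra_simps)
      qed
      show False
        by (rule *[OF b _ key]) simp
    qed
  qed
qed

section \<open>Smooth functions and test functions\<close>

lemma Ck_continuous: "Ck k f \<Longrightarrow> continuous_on UNIV f"
  by (cases k) (auto intro!: continuous_at_imp_continuous_on differentiable_imp_continuous_within)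

lemma Ck_Suc_D: "Ck (Suc k) f \<Longrightarrow> Ck k f"
proof (induction k arbitrary: f)
  case 0
  then show ?case using Ck_continuous by fastforce
qed auto

lemma partial_deriv_eqI:
  "(f has_derivative f') (at x) \<Longrightarrow> partial_deriv i f x = f' (axis i 1)"
  by (metis frechet_derivative_at partial_deriv_def)

text \<open>Reduces partial derivatives to one real variable, so that the mean value theorem and the
  fundamental theorem of calculus apply along coordinate lines.\<close>

lemma partial_deriv_line:
  assumes "f differentiable (at x)"
  shows "((\<lambda>t. f (x + t *\<^sub>R axis i 1)) has_real_derivative partial_deriv i f x) (at 0)"
proof -
  from assms obtain f' where f': "(f has_derivative f') (at x)"
    by (auto simp: differentiable_def)
  then interpret bounded_linear f' by (rule has_derivative_bounded_linear)
  have "((\<lambda>t. x + t *\<^sub>R axis i 1) has_derivative (\<lambda>t. t *\<^sub>R axis i 1)) (at (0::real))"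
    by (auto intro!: derivative_eq_intros)
  moreover have "(f has_derivative f') (at (x + 0 *\<^sub>R axis i 1))"
    using f' by simp
  ultimately have "((\<lambda>t. f (x + t *\<^sub>R axis i 1)) has_derivative (\<lambda>t. f' (t *\<^sub>R axis i 1))) (at 0)"
    by (rule has_derivative_compose)
  then show ?thesis
    unfolding has_field_derivative_def partial_deriv_eqI[OF f'] by (simp add: scaleR mult_commute_abs)
qed

lemma partial_deriv_line_at:
  assumes "f differentiable (at (x + t *\<^sub>R axis i 1))"
  shows "((\<lambda>t. f (x + t *\<^sub>R axis i 1)) has_real_derivative partial_deriv i f (x + t *\<^sub>R axis i 1)) (at t)"
  using partial_deriv_line[OF assms]
    DERIV_shift[of "\<lambda>t. f (x + t *\<^sub>R axis i 1)" _ 0 t]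
  by (simp add: algebra_simps)

lemma partial_deriv_const [simp]: "partial_deriv i (\<lambda>_. c) = (\<lambda>_. 0)"
  by (rule ext) (auto intro: partial_deriv_eqI)

lemma partial_deriv_component [simp]:
  "partial_deriv i (\<lambda>x. x $ j) = (\<lambda>_. if i = j then 1 else 0)"
proof
  fix x :: "real^3"
  have "((\<lambda>x. x $ j) has_derivative (\<lambda>x. x $ j)) (at x)"
    by (intro bounded_linear.has_derivative[OF bounded_linear_vec_nth] has_derivative_ident)
  then show "partial_deriv i (\<lambda>x. x $ j) x = (if i = j then 1 else 0)"
    by (simp add: partial_deriv_eqI axis_def)
qed

lemma partial_deriv_add:
  assumes "f differentiable (at x)" "g differentiable (at x)"
  shows "partial_deriv i (\<lambda>x. f x + g x) x = partial_deriv i f x + partial_deriv i g x"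
proof -
  from assms obtain f' g' where "(f has_derivative f') (at x)" "(g has_derivative g') (at x)"
    by (auto simp: differentiable_def)
  then show ?thesis
    using partial_deriv_eqI[OF has_derivative_add[of f f' "at x" g g']]
    by (simp add: partial_deriv_eqI)
qed

lemma partial_deriv_mult:
  assumes "f differentiable (at x)" "g differentiable (at x)"
  shows "partial_deriv i (\<lambda>x. f x * g x) x = partial_deriv i f x * g x + f x * partial_deriv i g x"
proof -
  from assms obtain f' g' where "(f has_derivative f') (at x)" "(g has_derivative g') (at x)"
    by (auto simp: differentiable_def)
  then show ?thesis
    using partial_deriv_eqI[OF has_derivative_mult[of f f' x UNIV g g']]
    by (simp add: partial_deriv_eqI)
qed

lemma partial_deriv_compose:
  assumes "(F has_real_derivative F') (at (q x))" "q differentiable (at x)"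
  shows "partial_deriv i (\<lambda>x. F (q x)) x = F' * partial_deriv i q x"
proof -
  from assms(2) obtain q' where q': "(q has_derivative q') (at x)"
    by (auto simp: differentiable_def)
  have "((\<lambda>x. F (q x)) has_derivative (\<lambda>y. F' * q' y)) (at x)"
    using has_derivative_compose[OF q'] assms(1) by (auto simp: has_field_derivative_def)
  then show ?thesis by (simp add: partial_deriv_eqI q' partial_deriv_eqI[OF q'])
qed

lemma Ck_const: "Ck k (\<lambda>_. c)"
  by (induction k arbitrary: c) auto

lemma Ck_component: "Ck k (\<lambda>x. x $ i)"
proof (cases k)
  case (Suc n)
  have "(\<lambda>x::real^3. x $ i) differentiable (at x)" for x
    by (metis bounded_linear_imp_differentiable bounded_linear_vec_nth)
  then show ?thesis using Suc by (simp add: Ck_const)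
qed (auto intro!: continuous_intros)

lemma Ck_add: "Ck k f \<Longrightarrow> Ck k g \<Longrightarrow> Ck k (\<lambda>x. f x + g x)"
proof (induction k arbitrary: f g)
  case (Suc k)
  then have "partial_deriv i (\<lambda>x. f x + g x) = (\<lambda>x. partial_deriv i f x + partial_deriv i g x)" for i
    by (auto intro!: partial_deriv_add)
  with Suc show ?case by auto
qed (auto intro!: continuous_intros)

lemma Ck_mult: "Ck k f \<Longrightarrow> Ck k g \<Longrightarrow> Ck k (\<lambda>x. f x * g x)"
proof (induction k arbitrary: f g)
  case (Suc k)
  then have "partial_deriv i (\<lambda>x. f x * g x) = (\<lambda>x. partial_deriv i f x * g x + f x * partial_deriv i g x)" for i
    by (auto intro!: partial_deriv_mult)
  moreover have "Ck k f" "Ck k g" using Suc.prems by (auto simp del: Ck.simps dest: Ck_Suc_D)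
  ultimately show ?case using Suc by (auto intro!: Ck_add)
qed (auto intro!: continuous_intros)

text \<open>The outer function is given as a whole chain \<open>F 0, F 1, ...\<close> of successive
  derivatives, and the induction runs over all \<open>n\<close> at once: differentiating
  \<open>F n (q x)\<close> produces the factor \<open>F (Suc n) (q x)\<close>.\<close>

lemma Ck_compose:
  fixes F :: "nat \<Rightarrow> real \<Rightarrow> real"
  assumes F: "\<And>n t. (F n has_real_derivative F (Suc n) t) (at t)" and "Ck k q"
  shows "Ck k (\<lambda>x. F n (q x))"
  using \<open>Ck k q\<close>
proof (induction k arbitrary: n)
  case 0
  have "continuous_on UNIV (F n)"
    using F DERIV_isCont continuous_at_imp_continuous_on by blast
  with 0 show ?case by (auto intro: continuous_on_compose2)
next
  case (Suc k)
  then have "partial_deriv i (\<lambda>x. F n (q x)) = (\<lambda>x. F (Suc n) (q x) * partial_deriv i q x)" for i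
    by (auto intro!: partial_deriv_compose F)
  moreover have "Ck k (\<lambda>x. F (Suc n) (q x))"
    using Suc Ck_Suc_D by blast
  moreover have "(\<lambda>x. F n (q x)) differentiable (at x)" for x
  proof -
    have "F n differentiable (at (q x))"
      using F real_differentiable_def by blast
    then show ?thesis
      using Suc.prems by (auto intro!: differentiable_compose[of "F n"])
  qed
  ultimately show ?case using Suc.prems by (auto intro!: Ck_mult)
qed

definition smooth :: "(real^3 \<Rightarrow> real) \<Rightarrow> bool" where
  "smooth f \<longleftrightarrow> (\<forall>k. Ck k f)"

lemma smooth_differentiable: "smooth f \<Longrightarrow> f differentiable (at x)"
  unfolding smooth_def by (metis Ck.simps(2))

lemma smooth_continuous: "smooth f \<Longrightarrow> continuous_on S f"
  unfolding smooth_def using Ck_continuous continuous_on_subset by blast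

lemma smooth_partial_deriv: "smooth f \<Longrightarrow> smooth (partial_deriv i f)"
  unfolding smooth_def by (metis Ck.simps(2))

lemma smooth_const: "smooth (\<lambda>_. c)"
  and smooth_component: "smooth (\<lambda>x. x $ i)"
  and smooth_add: "smooth f \<Longrightarrow> smooth g \<Longrightarrow> smooth (\<lambda>x. f x + g x)"
  and smooth_mult: "smooth f \<Longrightarrow> smooth g \<Longrightarrow> smooth (\<lambda>x. f x * g x)"
  by (auto simp: smooth_def Ck_const Ck_component Ck_add Ck_mult)

lemma test_function_alt: "test_function f \<longleftrightarrow> smooth f \<and> bounded {x. f x \<noteq> 0}"
  by (simp add: test_function_def smooth_def)

lemma test_function_zero: "test_function (\<lambda>_. 0)"
  by (simp add: test_function_alt smooth_const)

lemma test_function_add: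
  assumes "test_function f" "test_function g"
  shows "test_function (\<lambda>x. f x + g x)"
proof -
  have "bounded {x. f x + g x \<noteq> 0}"
    by (rule bounded_subset[of "{x. f x \<noteq> 0} \<union> {x. g x \<noteq> 0}"])
      (use assms in \<open>auto simp: test_function_alt\<close>)
  then show ?thesis using assms by (simp add: test_function_alt smooth_add)
qed

lemma test_function_scale:
  assumes "test_function f"
  shows "test_function (\<lambda>x. c * f x)"
proof -
  have "bounded {x. c * f x \<noteq> 0}"
    by (rule bounded_subset[of "{x. f x \<noteq> 0}"])
      (use assms in \<open>auto simp: test_function_alt\<close>)
  then show ?thesis using assms by (simp add: test_function_alt smooth_mult smooth_const)
qed

lemma partial_deriv_support: "{x. partial_deriv i f x \<noteq> 0} \<subseteq> closure {x. f x \<noteq> 0}"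
proof
  fix x assume x: "x \<in> {x. partial_deriv i f x \<noteq> 0}"
  show "x \<in> closure {x. f x \<noteq> 0}"
  proof (rule ccontr)
    assume nx: "x \<notin> closure {x. f x \<noteq> 0}"
    have "((\<lambda>_. 0) has_derivative (\<lambda>_. 0)) (at x)" by simp
    then have "(f has_derivative (\<lambda>_. 0)) (at x)"
      by (rule has_derivative_transform_within_open[OF _ open_Compl[OF closed_closure]])
        (use nx closure_subset[of "{x. f x \<noteq> 0}"] in auto)
    then show False using x by (simp add: partial_deriv_eqI)
  qed
qed

lemma test_function_partial_deriv: "test_function f \<Longrightarrow> test_function (partial_deriv i f)"
  unfolding test_function_alt
  using bounded_subset[OF bounded_closure partial_deriv_support] smooth_partial_deriv by blast

lemma test_function_smooth: "test_function f \<Longrightarrow> smooth f"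
  by (simp add: test_function_alt)

lemma test_function_vanish:
  assumes "test_function f" obtains r where "\<And>x. norm x > r \<Longrightarrow> f x = 0"
proof -
  obtain r where "\<And>x. x \<in> {x. f x \<noteq> 0} \<Longrightarrow> norm x \<le> r"
    using assms bounded_iff[of "{x. f x \<noteq> 0}"] unfolding test_function_alt by auto
  then show ?thesis using that[of r] by force
qed

text \<open>Both orders of applying the mean value theorem to the second difference of \<open>f\<close>
  over a small rectangle give the two mixed derivatives near \<open>x\<close>.\<close>

lemma second_difference:
  assumes f: "Ck 2 f" and h: "h > 0"
  obtains a b where "0 < a" "a < h" "0 < b" "b < h"
    "f (x + h *\<^sub>R axis i 1 + h *\<^sub>R axis j 1) - f (x + h *\<^sub>R axis i 1) - f (x + h *\<^sub>R axis j 1) + f x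
      = h\<^sup>2 * partial_deriv j (partial_deriv i f) (x + a *\<^sub>R axis i 1 + b *\<^sub>R axis j 1)"
proof -
  have f1: "f differentiable (at y)" and f2: "partial_deriv i f differentiable (at y)" for y
    using f by (auto simp: numeral_2_eq_2)
  define u where "u t = f (x + h *\<^sub>R axis j 1 + t *\<^sub>R axis i 1) - f (x + t *\<^sub>R axis i 1)" for t
  define u' where "u' t = partial_deriv i f (x + h *\<^sub>R axis j 1 + t *\<^sub>R axis i 1)
    - partial_deriv i f (x + t *\<^sub>R axis i 1)" for t
  have "(u has_real_derivative u' t) (at t)" for t
    unfolding u_def u'_def by (intro DERIV_diff partial_deriv_line_at f1)
  from MVT2[OF h this] obtain a where a: "0 < a" "a < h" "u h - u 0 = h * u' a"
    by auto
  let ?v = "\<lambda>t. partial_deriv i f (x + a *\<^sub>R axis i 1 + t *\<^sub>R axis j 1)"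
  have "(?v has_real_derivative partial_deriv j (partial_deriv i f) (x + a *\<^sub>R axis i 1 + t *\<^sub>R axis j 1)) (at t)" for t
    by (intro partial_deriv_line_at f2)
  from MVT2[OF h this] obtain b where b: "0 < b" "b < h"
    "?v h - ?v 0 = h * partial_deriv j (partial_deriv i f) (x + a *\<^sub>R axis i 1 + b *\<^sub>R axis j 1)"
    by auto
  have "u' a = ?v h - ?v 0" by (simp add: u'_def algebra_simps)
  then have "u h - u 0 = h\<^sup>2 * partial_deriv j (partial_deriv i f) (x + a *\<^sub>R axis i 1 + b *\<^sub>R axis j 1)"
    using a(3) b(3) by (simp add: power2_eq_square)
  moreover have "u h - u 0 = f (x + h *\<^sub>R axis i 1 + h *\<^sub>R axis j 1) - f (x + h *\<^sub>R axis i 1)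
      - f (x + h *\<^sub>R axis j 1) + f x"
    by (simp add: u_def algebra_simps)
  ultimately show ?thesis using that[OF a(1,2) b(1,2)] by simp
qed

text \<open>One difference quotient, symmetric in \<open>i\<close> and \<open>j\<close>, has both
  mixed derivatives as its limit, by continuity of the second derivatives.\<close>

lemma partial_deriv_commute:
  assumes f: "Ck 2 f"
  shows "partial_deriv i (partial_deriv j f) x = partial_deriv j (partial_deriv i f) x"
proof -
  define h where "h n = 1 / real (Suc n)" for n
  have hpos: "h n > 0" for n by (simp add: h_def)
  have h0: "h \<longlonglongrightarrow> 0" unfolding h_def by (rule LIMSEQ_Suc[OF lim_1_over_n])
  let ?D = "\<lambda>n. (f (x + h n *\<^sub>R axis i 1 + h n *\<^sub>R axis j 1) - f (x + h n *\<^sub>R axis i 1)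
      - f (x + h n *\<^sub>R axis j 1) + f x) / (h n)\<^sup>2"
  have lim: "(\<lambda>n. G (x + a n *\<^sub>R axis k 1 + b n *\<^sub>R axis l 1)) \<longlonglongrightarrow> G x"
    if G: "continuous_on UNIV G" and ab: "\<And>n. 0 < a n \<and> a n < h n \<and> 0 < b n \<and> b n < h n"
    for G :: "real^3 \<Rightarrow> real" and a b k l
  proof -
    have "a \<longlonglongrightarrow> 0" "b \<longlonglongrightarrow> 0"
      by (rule tendsto_sandwich[OF _ _ tendsto_const h0]; use ab in \<open>simp add: less_imp_le\<close>)+
    then have "(\<lambda>n. x + a n *\<^sub>R axis k 1 + b n *\<^sub>R axis l 1) \<longlonglongrightarrow> x + 0 *\<^sub>R axis k 1 + 0 *\<^sub>R axis l 1"
      by (intro tendsto_intros)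
    then show ?thesis
      using continuous_on_tendsto_compose[OF G] by simp
  qed
  have c: "continuous_on UNIV (partial_deriv k (partial_deriv l f))" for k l
    using f by (auto simp: numeral_2_eq_2)
  have "\<exists>a b. 0 < a \<and> a < h n \<and> 0 < b \<and> b < h n \<and>
      ?D n = partial_deriv j (partial_deriv i f) (x + a *\<^sub>R axis i 1 + b *\<^sub>R axis j 1)" for n
    by (rule second_difference[OF f hpos[of n], of x i j]) (use hpos[of n] in fastforce)
  then obtain a b where ab: "\<And>n. 0 < a n \<and> a n < h n \<and> 0 < b n \<and> b n < h n"
    and D: "\<And>n. ?D n = partial_deriv j (partial_deriv i f) (x + a n *\<^sub>R axis i 1 + b n *\<^sub>R axis j 1)"
    by metis
  have 1: "?D \<longlonglongrightarrow> partial_deriv j (partial_deriv i f) x"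
    unfolding D by (rule lim[OF c ab])
  have "\<exists>a b. 0 < a \<and> a < h n \<and> 0 < b \<and> b < h n \<and>
      ?D n = partial_deriv i (partial_deriv j f) (x + a *\<^sub>R axis j 1 + b *\<^sub>R axis i 1)" for n
  proof -
    from second_difference[OF f hpos[of n], of x j i]
    obtain a b where "0 < a" "a < h n" "0 < b" "b < h n" 
      "f (x + h n *\<^sub>R axis j 1 + h n *\<^sub>R axis i 1) - f (x + h n *\<^sub>R axis j 1) - f (x + h n *\<^sub>R axis i 1) + f x
      = (h n)\<^sup>2 * partial_deriv i (partial_deriv j f) (x + a *\<^sub>R axis j 1 + b *\<^sub>R axis i 1)" .
    moreover have "x + h n *\<^sub>R axis j 1 + h n *\<^sub>R axis i 1 = x + h n *\<^sub>R axis i 1 + h n *\<^sub>R axis j 1"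
      by simp
    ultimately have "?D n = partial_deriv i (partial_deriv j f) (x + a *\<^sub>R axis j 1 + b *\<^sub>R axis i 1)"
      using hpos[of n] by (simp add: field_simps)
    with \<open>0 < a\<close> \<open>a < h n\<close> \<open>0 < b\<close> \<open>b < h n\<close> show ?thesis by blast
  qed
  then obtain a b where ab: "\<And>n. 0 < a n \<and> a n < h n \<and> 0 < b n \<and> b n < h n"
    and D: "\<And>n. ?D n = partial_deriv i (partial_deriv j f) (x + a n *\<^sub>R axis j 1 + b n *\<^sub>R axis i 1)"
    by metis
  have "?D \<longlonglongrightarrow> partial_deriv i (partial_deriv j f) x"
    unfolding D by (rule lim[OF c ab])
  from LIMSEQ_unique[OF this 1] show ?thesis .
qed

section \<open>Integration by parts and radial test functions\<close>

lemma lborel_eq_distr_translation: "lborel = distr lborel borel (\<lambda>x. x + c :: 'a::euclidean_space)"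
proof -
  have "(+) c = (\<lambda>x. x + c)" by (auto simp: add.commute)
  then show ?thesis using lborel_distr_plus[of c] by simp
qed

lemma integral_lborel_translation:
  fixes f :: "'a::euclidean_space \<Rightarrow> 'b::{banach, second_countable_topology}"
  assumes [measurable]: "f \<in> borel_measurable borel"
  shows "(\<integral>x. f (x + c) \<partial>lborel) = (\<integral>x. f x \<partial>lborel)"
  by (subst (2) lborel_eq_distr_translation[of c]) (simp add: integral_distr)

lemma integrable_lborel_translation:
  fixes f :: "'a::euclidean_space \<Rightarrow> 'b::{banach, second_countable_topology}"
  assumes f: "integrable lborel f"
  shows "integrable lborel (\<lambda>x. f (x + c))"
proof -
  have [measurable]: "f \<in> borel_measurable borel"
    using borel_measurable_integrable[OF f] by simp
  show ?thesis
    using f by (subst (asm) lborel_eq_distr_translation[of c]) (simp add: integrable_distr_eq)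
qed

text \<open>Averaging over the translations along \<open>v\<close> reduces the claim to the fundamental theorem of
  calculus on lines, so no splitting of the space into coordinates is needed.\<close>

theorem integral_directional_derivative_eq_0:
  fixes f g :: "'a::euclidean_space \<Rightarrow> real"
  assumes f: "integrable lborel f" and g: "integrable lborel g" and cont: "continuous_on UNIV f"
    and fin: "\<And>x. finite {t. x + t *\<^sub>R v \<in> S}"
    and der: "\<And>x. x \<notin> S \<Longrightarrow> ((\<lambda>t. f (x + t *\<^sub>R v)) has_real_derivative g x) (at 0)"
  shows "(\<integral>x. g x \<partial>lborel) = 0"
proof -
  have gm [measurable]: "g \<in> borel_measurable borel" and fm [measurable]: "f \<in> borel_measurable borel"
    using borel_measurable_integrable[OF g] borel_measurable_integrable[OF f] by simp_all
  define G where "G t x = indicator {0..1} t * g (x + t *\<^sub>R v)" for t :: real and x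
  have [measurable]: "case_prod G \<in> borel_measurable (lborel \<Otimes>\<^sub>M lborel)"
    unfolding G_def by measurable
  have int: "integrable (lborel \<Otimes>\<^sub>M lborel) (case_prod G)"
  proof (rule lborel_pair.Fubini_integrable)
    have "(\<integral>x. norm (G t x) \<partial>lborel) = indicator {0..1} t * (\<integral>x. norm (g x) \<partial>lborel)" for t
      using integral_lborel_translation[of "\<lambda>x. norm (g x)" "t *\<^sub>R v"] by (simp add: G_def abs_mult)
    moreover have "integrable lborel (\<lambda>t::real. indicator {0..1} t * (\<integral>x. norm (g x) \<partial>lborel))"
      by (intro integrable_mult_left) simp
    ultimately show "integrable lborel (\<lambda>t. \<integral>x. norm (case (t, x) of (t, x) \<Rightarrow> G t x) \<partial>lborel)"
      by simp
    show "AE t in lborel. integrable lborel (\<lambda>x. case (t, x) of (t, x) \<Rightarrow> G t x)"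
      unfolding G_def using integrable_lborel_translation[OF g] by simp
  qed measurable
  have "(\<integral>t. (\<integral>x. G t x \<partial>lborel) \<partial>lborel) = (\<integral>x. g x \<partial>lborel)"
    using integral_lborel_translation[OF gm] by (simp add: G_def)
  then have "(\<integral>x. g x \<partial>lborel) = (\<integral>x. (\<integral>t. G t x \<partial>lborel) \<partial>lborel)"
    using lborel_pair.Fubini_integral[OF int] by simp
  also have "\<dots> = (\<integral>x. f (x + v) - f x \<partial>lborel)"
  proof (rule integral_cong_AE)
    have "AE x in lborel. integrable lborel (\<lambda>t. G t x)"
      using lborel_pair.AE_integrable_snd[OF int] by simp
    then show "AE x in lborel. (\<integral>t. G t x \<partial>lborel) = f (x + v) - f x"
    proof eventually_elim
      case (elim x)
      have si: "set_integrable lborel {0..1} (\<lambda>t. g (x + t *\<^sub>R v))"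
        using elim by (simp add: set_integrable_def G_def)
      have d: "((\<lambda>t. f (x + t *\<^sub>R v)) has_real_derivative g (x + t *\<^sub>R v)) (at t)"
        if "x + t *\<^sub>R v \<notin> S" for t
        using der[OF that] DERIV_shift[of "\<lambda>t. f (x + t *\<^sub>R v)" _ 0 t]
        by (simp add: algebra_simps)
      \<comment> \<open>The finitely many parameters at which the line meets \<open>S\<close> are
        admissible exceptions here. Integrability in \<open>t\<close>, available for almost every
        \<open>x\<close>, then identifies this gauge integral with the Lebesgue integral.\<close>
      have "((\<lambda>t. g (x + t *\<^sub>R v)) has_integral f (x + 1 *\<^sub>R v) - f (x + 0 *\<^sub>R v)) {0..1}"
      proof (rule fundamental_theorem_of_calculus_strong[OF fin[of x]])
        show "continuous_on {0..1} (\<lambda>t. f (x + t *\<^sub>R v))"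
          by (intro continuous_on_compose2[OF cont] continuous_intros) auto
      qed (use d in \<open>auto simp: has_real_derivative_iff_has_vector_derivative\<close>)
      then have "integral {0..1} (\<lambda>t. g (x + t *\<^sub>R v)) = f (x + v) - f x"
        by (simp add: integral_unique)
      then show ?case
        using set_borel_integral_eq_integral(2)[OF si]
        by (simp add: set_lebesgue_integral_def G_def)
    qed
  qed measurable
  also have "\<dots> = 0"
    using integral_lborel_translation[OF fm, of v] f integrable_lborel_translation[OF f, of v] by simp
  finally show ?thesis .
qed

lemma integrable_continuous_vanishing:
  fixes f :: "'a::euclidean_space \<Rightarrow> real"
  assumes "continuous_on UNIV f" and z: "\<And>x. norm x > r \<Longrightarrow> f x = 0"
  shows "integrable lborel f"
proof -
  have "integrable lborel (\<lambda>x. indicator (cball 0 r) x *\<^sub>R f x)"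
    by (rule borel_integrable_compact) (auto intro: continuous_on_subset assms)
  moreover have "(\<lambda>x. indicator (cball 0 r) x *\<^sub>R f x) = f"
    using z by (auto simp: indicator_def fun_eq_iff not_le)
  ultimately show ?thesis by simp
qed

lemma integrable_continuous_test_function:
  assumes "continuous_on UNIV u" "test_function \<phi>"
  shows "integrable lborel (\<lambda>x. u x * \<phi> x)"
proof -
  obtain r where "\<And>x. norm x > r \<Longrightarrow> \<phi> x = 0"
    using test_function_vanish[OF assms(2)] by blast
  then show ?thesis
    using assms by (intro integrable_continuous_vanishing[of _ r] continuous_intros)
      (auto intro: smooth_continuous test_function_smooth)
qed

text \<open>Here \<open>w\<close> is a classical derivative of \<open>u\<close> except on a set that
  every coordinate line meets in finitely many points. Continuity of \<open>u\<close> rules out a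
  jump contribution from that set, so kinks are allowed, as the potential of the ball has one on the
  sphere.\<close>

lemma integral_by_parts_test_function:
  assumes u: "continuous_on UNIV u" and \<phi>: "test_function \<phi>"
    and w: "integrable lborel (\<lambda>x. w x * \<phi> x)"
    and fin: "\<And>x. finite {t. x + t *\<^sub>R axis i 1 \<in> S}"
    and der: "\<And>x. x \<notin> S \<Longrightarrow> ((\<lambda>t. u (x + t *\<^sub>R axis i 1)) has_real_derivative w x) (at 0)"
  shows "(\<integral>x. w x * \<phi> x \<partial>lborel) = - (\<integral>x. u x * partial_deriv i \<phi> x \<partial>lborel)"
proof -
  have 1: "integrable lborel (\<lambda>x. u x * partial_deriv i \<phi> x)"
    by (intro integrable_continuous_test_function u test_function_partial_deriv \<phi>)
  have "(\<integral>x. w x * \<phi> x + u x * partial_deriv i \<phi> x \<partial>lborel) = 0"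
  proof (rule integral_directional_derivative_eq_0[where f = "\<lambda>x. u x * \<phi> x", OF _ _ _ fin])
    show "continuous_on UNIV (\<lambda>x. u x * \<phi> x)"
      by (intro continuous_intros u smooth_continuous test_function_smooth \<phi>)
    show "((\<lambda>t. u (x + t *\<^sub>R axis i 1) * \<phi> (x + t *\<^sub>R axis i 1)) has_real_derivative
        w x * \<phi> x + u x * partial_deriv i \<phi> x) (at 0)" if "x \<notin> S" for x
      using DERIV_mult[OF der[OF that] partial_deriv_line[OF smooth_differentiable[OF test_function_smooth[OF \<phi>]], of x i]]
      by (simp add: mult.commute add.commute)
  qed (use integrable_continuous_test_function[OF u \<phi>] 1 w in auto)
  then show ?thesis using 1 w by simp
qed

text \<open>The usual smooth cutoff \<open>exp (- 1 / (1 - t))\<close>, with a polynomial factor in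
  \<open>1 / (1 - t)\<close> so that the family is closed under differentiation. It is later
  evaluated at squared norms, which avoids the singularity of the norm at the centre.\<close>

definition bump :: "real poly \<Rightarrow> real \<Rightarrow> real" where
  "bump p t = (if t < 1 then poly p (1 / (1 - t)) * exp (- (1 / (1 - t))) else 0)"

text \<open>With \<open>s = 1 / (1 - t)\<close> one has \<open>d/dt (p(s) exp (- s)) = s\<^sup>2 (p' - p)(s) exp (- s)\<close>.\<close>

definition bump_step :: "real poly \<Rightarrow> real poly" where
  "bump_step p = [:0, 0, 1:] * (pderiv p - p)"

lemma poly_times_exp_minus_tendsto_0: "((\<lambda>s. poly p s * exp (- s)) \<longlongrightarrow> (0::real)) at_top"
proof -
  have "((\<lambda>s. coeff p i * (s ^ i / exp s)) \<longlongrightarrow> coeff p i * 0) at_top" for i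
    by (intro tendsto_intros tendsto_power_div_exp_0)
  then have "((\<lambda>s. \<Sum>i\<le>degree p. coeff p i * (s ^ i / exp s)) \<longlongrightarrow> (\<Sum>i\<le>degree p. coeff p i * 0)) at_top"
    by (rule tendsto_sum)
  then show ?thesis
    by (simp add: poly_altdef sum_distrib_right exp_minus divide_inverse mult.assoc)
qed

lemma bump_has_derivative: "(bump p has_real_derivative bump (bump_step p) t) (at t)"
proof -
  consider "t < 1" | "t > 1" | "t = 1" by linarith
  then show ?thesis
  proof cases
    case 1
    have "((\<lambda>t. poly p (1 / (1 - t)) * exp (- (1 / (1 - t)))) has_real_derivative bump (bump_step p) t) (at t)"
      using 1 by (auto intro!: derivative_eq_intros DERIV_chain2[OF poly_DERIV]
          simp: bump_def bump_step_def divide_simps power2_eq_square) (simp add: algebra_simps)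
    then show ?thesis
      by (rule has_field_derivative_transform_within_open[of _ _ _ "{..<1}"])
        (use 1 in \<open>auto simp: bump_def\<close>)
  next
    case 2
    have "((\<lambda>_. 0) has_real_derivative bump (bump_step p) t) (at t)"
      using 2 by (auto simp: bump_def)
    then show ?thesis
      by (rule has_field_derivative_transform_within_open[of _ _ _ "{1<..}"])
        (use 2 in \<open>auto simp: bump_def\<close>)
  next
    case 3
    have "((\<lambda>h. (bump p (1 + h) - bump p 1) / h) \<longlongrightarrow> 0) (at_left 0)"
    proof -
      have "filterlim (\<lambda>h::real. - inverse h) at_top (at_left 0)"
        using filterlim_inverse_at_bot_neg by (simp add: filterlim_uminus_at_bot)
      \<comment> \<open>For \<open>h < 0\<close> put \<open>s = - 1 / h\<close>. Since
        \<open>bump p 1 = 0\<close>, the difference quotient at \<open>1\<close> is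
        \<open>- s p(s) exp (- s)\<close>, and the factor \<open>- s\<close> is the polynomial
        \<open>[:0, -1:]\<close>.\<close>
      from filterlim_compose[OF poly_times_exp_minus_tendsto_0[of "[:0, -1:] * p"] this]
      have *: "((\<lambda>h. inverse h * poly p (- inverse h) * exp (- (- inverse h))) \<longlongrightarrow> 0) (at_left 0)"
        by simp
      have "\<forall>\<^sub>F h in at_left 0. inverse h * poly p (- inverse h) * exp (- (- inverse h))
          = (bump p (1 + h) - bump p 1) / h"
        unfolding eventually_at_left_field
        by (rule exI[of _ "-1"]) (auto simp: bump_def inverse_eq_divide)
      with * show ?thesis by (rule Lim_transform_eventually)
    qed
    moreover have "((\<lambda>h. (bump p (1 + h) - bump p 1) / h) \<longlongrightarrow> 0) (at_right 0)"
      by (rule tendsto_eventually, unfold eventually_at_right_field, rule exI[of _ 1])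
        (auto simp: bump_def)
    ultimately have "((\<lambda>h. (bump p (1 + h) - bump p 1) / h) \<longlongrightarrow> 0) (at 0)"
      by (simp add: filterlim_split_at)
    then show ?thesis using 3 by (simp add: DERIV_def bump_def)
  qed
qed

lemma continuous_bump: "continuous_on S (bump p)"
  using bump_has_derivative DERIV_isCont continuous_at_imp_continuous_on by blast

section \<open>Radial test functions and their Laplacians\<close>

lemma norm_sq_3: "(norm (x :: real^3))\<^sup>2 = x$1 * x$1 + x$2 * x$2 + x$3 * x$3"
  unfolding power2_norm_eq_inner by (simp add: inner_vec_def sum_3)

lemma smooth_component_diff: "smooth (\<lambda>y. y$i - c)"
  using smooth_add[OF smooth_component smooth_const, of i "- c"] by simp

lemma smooth_norm_sq: "smooth (\<lambda>y. l * (norm (y - a))\<^sup>2)"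
proof -
  have "smooth (\<lambda>y. l * ((y$1 - a$1) * (y$1 - a$1) + (y$2 - a$2) * (y$2 - a$2)
      + (y$3 - a$3) * (y$3 - a$3)))"
    by (intro smooth_mult smooth_add smooth_component_diff smooth_const)
  then show ?thesis by (simp add: norm_sq_3)
qed

lemma partial_deriv_norm_sq: "partial_deriv i (\<lambda>y. l * (norm (y - a))\<^sup>2) y = 2 * l * (y$i - a$i)"
proof -
  have "((\<lambda>y. l * ((y - a) \<bullet> (y - a))) has_derivative (\<lambda>h. l * (2 * (h \<bullet> (y - a))))) (at y)"
    by (auto intro!: derivative_eq_intros simp: inner_commute)
  from partial_deriv_eqI[OF this, of i] show ?thesis
    by (simp add: power2_norm_eq_inner inner_axis' )
qed

text \<open>The iterates of \<open>bump_step\<close> supply the chain of successive derivatives that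
  \<open>Ck_compose\<close> asks for.\<close>

lemma smooth_bump_norm_sq: "smooth (\<lambda>y. bump p (l * (norm (y - a))\<^sup>2))"
  using Ck_compose[of "\<lambda>n. bump ((bump_step ^^ n) p)" _ _ 0] smooth_norm_sq[of l a]
  by (simp add: smooth_def bump_has_derivative)

lemma partial_deriv_bump_norm_sq:
  "partial_deriv i (\<lambda>y. bump p (l * (norm (y - a))\<^sup>2))
    = (\<lambda>y. bump (bump_step p) (l * (norm (y - a))\<^sup>2) * (2 * l * (y$i - a$i)))"
  using partial_deriv_compose[OF bump_has_derivative smooth_differentiable[OF smooth_norm_sq]]
  by (simp add: partial_deriv_norm_sq fun_eq_iff)

lemma bump_norm_sq_vanish:
  assumes "l > 0" "norm (y - a) \<ge> 1 / sqrt l" shows "bump p (l * (norm (y - a))\<^sup>2) = 0"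
proof -
  have "(1 / sqrt l)\<^sup>2 \<le> (norm (y - a))\<^sup>2"
    using assms by (intro power_mono) auto
  then have "1 \<le> l * (norm (y - a))\<^sup>2"
    using assms(1) by (simp add: power_divide field_simps)
  then show ?thesis by (simp add: bump_def)
qed

lemma test_function_bump_norm_sq:
  assumes "l > 0" shows "test_function (\<lambda>y. bump p (l * (norm (y - a))\<^sup>2))"
  unfolding test_function_alt
proof
  show "bounded {y. bump p (l * (norm (y - a))\<^sup>2) \<noteq> 0}"
    by (rule bounded_subset[OF bounded_ball[of a "1 / sqrt l"]])
      (use bump_norm_sq_vanish[OF assms] in \<open>force simp: dist_norm norm_minus_commute\<close>)
qed (rule smooth_bump_norm_sq)

lemma laplacian_bump_norm_sq:
  "(\<Sum>i\<in>UNIV. partial_deriv i (partial_deriv i (\<lambda>y. bump p (l * (norm (y - a))\<^sup>2))) y)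
    = 6 * l * bump (bump_step p) (l * (norm (y - a))\<^sup>2)
      + 4 * l\<^sup>2 * (norm (y - a))\<^sup>2 * bump (bump_step (bump_step p)) (l * (norm (y - a))\<^sup>2)"
proof -
  let ?b = "\<lambda>p y. bump p (l * (norm (y - a))\<^sup>2)"
  have pd: "partial_deriv i (\<lambda>y. 2 * l * (y$i - a$i)) y = 2 * l"
    and df: "(\<lambda>y. 2 * l * (y$i - a$i)) differentiable (at y)" for i :: 3
  proof -
    have "((\<lambda>y. 2 * l * (y$i - a$i)) has_derivative (\<lambda>h. 2 * l * (h$i))) (at y)"
      by (auto intro!: derivative_eq_intros bounded_linear.has_derivative[OF bounded_linear_vec_nth])
    then show "partial_deriv i (\<lambda>y. 2 * l * (y$i - a$i)) y = 2 * l"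
      "(\<lambda>y. 2 * l * (y$i - a$i)) differentiable (at y)"
      by (auto simp: partial_deriv_eqI differentiable_def)
  qed
  have D: "partial_deriv i (partial_deriv i (?b p)) y
    = ?b (bump_step (bump_step p)) y * (2 * l * (y$i - a$i)) * (2 * l * (y$i - a$i)) + ?b (bump_step p) y * (2 * l)" for i
    unfolding partial_deriv_bump_norm_sq
    by (subst partial_deriv_mult)
      (auto simp: pd partial_deriv_bump_norm_sq intro!: df smooth_differentiable smooth_bump_norm_sq smooth_mult smooth_const smooth_component_diff)
  have alg: "(b2 * (2 * l * d1) * (2 * l * d1) + b1 * (2 * l)) + (b2 * (2 * l * d2) * (2 * l * d2) + b1 * (2 * l))
      + (b2 * (2 * l * d3) * (2 * l * d3) + b1 * (2 * l))
    = 6 * l * b1 + 4 * l\<^sup>2 * (d1 * d1 + d2 * d2 + d3 * d3) * b2" for b1 b2 d1 d2 d3 :: real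
    by (simp add: power2_eq_square algebra_simps)
  show ?thesis
    unfolding sum_3 D unfolding alg unfolding norm_sq_3 by simp
qed

section \<open>Weakly harmonic functions\<close>

lemma integrable_pair_product:
  fixes f :: "'a::euclidean_space \<Rightarrow> real" and g :: "'b::euclidean_space \<Rightarrow> real"
  assumes f: "integrable lborel f" and g: "integrable lborel g"
  shows "integrable (lborel \<Otimes>\<^sub>M lborel) (\<lambda>(x, y). f x * g y)"
proof (rule lborel_pair.Fubini_integrable)
  have [measurable]: "f \<in> borel_measurable borel" "g \<in> borel_measurable borel"
    using borel_measurable_integrable[OF f] borel_measurable_integrable[OF g] by simp_all
  show "(\<lambda>(x, y). f x * g y) \<in> borel_measurable (lborel \<Otimes>\<^sub>M lborel)"
    by measurable
  show "integrable lborel (\<lambda>x. \<integral>y. norm (case (x, y) of (x, y) \<Rightarrow> f x * g y) \<partial>lborel)"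
    using f by (simp add: abs_mult)
  show "AE x in lborel. integrable lborel (\<lambda>y. case (x, y) of (x, y) \<Rightarrow> f x * g y)"
    using g by simp
qed

lemma integrable_indicator_cball_sq:
  fixes u :: "'a::euclidean_space \<Rightarrow> real"
  assumes u: "u \<in> borel_measurable borel" and u2: "integrable lborel (\<lambda>x. (u x)\<^sup>2)"
  shows "integrable lborel (\<lambda>y. indicator (cball a r) y * u y)"
proof (rule Bochner_Integration.integrable_bound)
  show "integrable lborel (\<lambda>y. indicator (cball a r) y + (u y)\<^sup>2)"
    using u2 emeasure_lborel_cball_finite[of a r] by (intro Bochner_Integration.integrable_add) auto
  have "\<bar>t\<bar> \<le> 1 + t\<^sup>2" for t :: real
    using zero_le_power2[of "\<bar>t\<bar> - 1"] abs_ge_zero[of t] by (simp add: power2_diff)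
  then show "AE y in lborel. norm (indicator (cball a r) y * u y) \<le> norm (indicator (cball a r) y + (u y)\<^sup>2)"
    by (auto simp: indicator_def)
qed (use u in \<open>auto intro!: borel_measurable_times borel_measurable_indicator\<close>)

lemma bump_bounded:
  obtains M where "M > 0" "\<And>t. t \<ge> 0 \<Longrightarrow> \<bar>bump p t\<bar> \<le> M"
proof -
  have "bounded (bump p ` {0..1})"
    by (intro compact_imp_bounded compact_continuous_image continuous_bump) auto
  then obtain M where M: "\<forall>t\<in>{0..1}. \<bar>bump p t\<bar> \<le> M"
    unfolding bounded_iff by auto
  have "\<bar>bump p t\<bar> \<le> \<bar>M\<bar> + 1" if "t \<ge> 0" for t
  proof (cases "t \<le> 1")
    case True
    then have "\<bar>bump p t\<bar> \<le> M" using M that by simp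
    then show ?thesis by simp
  qed (simp add: bump_def)
  then show ?thesis by (intro that[of "\<bar>M\<bar> + 1"]) auto
qed

lemma bump_measurable [measurable]: "bump p \<in> borel_measurable borel"
  by (intro borel_measurable_continuous_onI continuous_bump)

text \<open>Radial kernel of width \<open>1 / l\<close>, with the dimension as exponent so that its
  mass does not depend on \<open>l\<close>. The profile is the derivative of the cutoff
  \<open>bump 1\<close>, not the cutoff itself, so that a change of scale becomes a Laplacian. It is
  nonpositive and not normalised.\<close>

definition kern :: "real^3 \<Rightarrow> real \<Rightarrow> real^3 \<Rightarrow> real" where
  "kern a l y = l ^ 3 * bump (bump_step 1) (l\<^sup>2 * (norm (y - a))\<^sup>2)"

lemma kern_measurable [measurable (raw)]:
  assumes [measurable]: "a \<in> borel_measurable M" "l \<in> borel_measurable M" "y \<in> borel_measurable M"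
  shows "(\<lambda>x. kern (a x) (l x) (y x)) \<in> borel_measurable M"
  unfolding kern_def by measurable

lemma kern_bound:
  obtains M where "M > 0" "\<And>a l y. l > 0 \<Longrightarrow> \<bar>kern a l y\<bar> \<le> l ^ 3 * M * indicator (cball a (1 / l)) y"
proof -
  obtain M where M: "M > 0" "\<And>t. t \<ge> 0 \<Longrightarrow> \<bar>bump (bump_step 1) t\<bar> \<le> M"
    using bump_bounded by blast
  show ?thesis
  proof (rule that[OF M(1)])
    fix a y :: "real^3" and l :: real assume l: "l > 0"
    show "\<bar>kern a l y\<bar> \<le> l ^ 3 * M * indicator (cball a (1 / l)) y"
    proof (cases "y \<in> cball a (1 / l)")
      case False
      then have "norm (y - a) \<ge> 1 / sqrt (l\<^sup>2)"
        using l by (simp add: dist_norm norm_minus_commute)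
      then show ?thesis
        using bump_norm_sq_vanish[of "l\<^sup>2" y a "bump_step 1"] l False by (simp add: kern_def)
    next
      case True
      then show ?thesis using l M(2)[of "l\<^sup>2 * (norm (y - a))\<^sup>2"] by (simp add: kern_def abs_mult)
    qed
  qed
qed

definition weakly_harmonic :: "(real^3 \<Rightarrow> real) \<Rightarrow> bool" where
  "weakly_harmonic u \<longleftrightarrow> (\<forall>\<phi>. test_function \<phi> \<longrightarrow>
     (\<integral>x. u x * (\<Sum>i\<in>UNIV. partial_deriv i (partial_deriv i \<phi>) x) \<partial>lborel) = 0)"

text \<open>Put \<open>B = bump 1\<close> and \<open>r = |y - a|\<close>. The Laplacian of
  \<open>B(l^2 r^2)\<close> in dimension three is \<open>6 l^2 B' + 4 l^4 r^2 B''\<close>, and the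
  derivative in \<open>l\<close> of \<open>l^3 B'(l^2 r^2)\<close> is
  \<open>3 l^2 B' + 2 l^4 r^2 B''\<close>; hence the factor \<open>1/2\<close>.\<close>

definition kern' :: "real^3 \<Rightarrow> real \<Rightarrow> real^3 \<Rightarrow> real" where
  "kern' a l y = (1/2) * (\<Sum>i\<in>UNIV. partial_deriv i (partial_deriv i (\<lambda>y. bump 1 (l\<^sup>2 * (norm (y - a))\<^sup>2))) y)"

lemma kern'_eq: "kern' a l y = 3 * l\<^sup>2 * bump (bump_step 1) (l\<^sup>2 * (norm (y - a))\<^sup>2)
      + 2 * l^4 * (norm (y - a))\<^sup>2 * bump (bump_step (bump_step 1)) (l\<^sup>2 * (norm (y - a))\<^sup>2)"
  unfolding kern'_def laplacian_bump_norm_sq by simp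

text \<open>In the scaling parameter, the mollifiers form a curve whose velocity is the Laplacian of a
  test function; hence a weakly harmonic function has the same average against all of them.\<close>

lemma kern_has_derivative: "((\<lambda>l. kern a l y) has_real_derivative kern' a l y) (at l)"
  unfolding kern_def kern'_eq
  by (auto intro!: derivative_eq_intros DERIV_chain2[OF bump_has_derivative]
      simp: field_simps power2_eq_square power3_eq_cube power4_eq_xxxx)

text \<open>Supplies the majorant for Fubini on a compact range of scales away from
  \<open>0\<close>: as the width is \<open>1 / l\<close>, all supports lie in the ball of radius
  \<open>1 / \<alpha>\<close>.\<close>

lemma kern'_bound:
  assumes "\<alpha> > 0"
  obtains M where "\<And>l y. \<alpha> \<le> l \<Longrightarrow> l \<le> \<beta> \<Longrightarrow> \<bar>kern' a l y\<bar> \<le> M * indicator (cball a (1 / \<alpha>)) y"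
proof -
  obtain M1 where M1: "M1 > 0" "\<And>t. t \<ge> 0 \<Longrightarrow> \<bar>bump (bump_step 1) t\<bar> \<le> M1"
    using bump_bounded by blast
  obtain M2 where M2: "M2 > 0" "\<And>t. t \<ge> 0 \<Longrightarrow> \<bar>bump (bump_step (bump_step 1)) t\<bar> \<le> M2"
    using bump_bounded by blast
  show ?thesis
  proof (rule that)
    fix l y assume l: "\<alpha> \<le> l" "l \<le> \<beta>"
    let ?n = "(norm (y - a))\<^sup>2"
    show "\<bar>kern' a l y\<bar> \<le> (3 * \<beta>\<^sup>2 * M1 + 2 * \<beta>^4 * (1/\<alpha>)\<^sup>2 * M2) * indicator (cball a (1 / \<alpha>)) y"
    proof (cases "y \<in> cball a (1 / \<alpha>)")
      case False
      have "1 / l \<le> 1 / \<alpha>" using l assms by (simp add: frac_le)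
      then have "norm (y - a) \<ge> 1 / sqrt (l\<^sup>2)"
        using False l assms by (simp add: dist_norm norm_minus_commute)
      then show ?thesis
        using bump_norm_sq_vanish[of "l\<^sup>2" y a] l assms False by (simp add: kern'_eq)
    next
      case True
      have n: "?n \<le> (1/\<alpha>)\<^sup>2"
        using True assms by (intro power_mono) (auto simp: dist_norm norm_minus_commute)
      have "\<bar>3 * l\<^sup>2 * bump (bump_step 1) (l\<^sup>2 * ?n)\<bar> \<le> 3 * \<beta>\<^sup>2 * M1"
        unfolding abs_mult using l assms by (intro mult_mono M1) auto
      moreover have "\<bar>2 * l^4 * ?n * bump (bump_step (bump_step 1)) (l\<^sup>2 * ?n)\<bar> \<le> 2 * \<beta>^4 * (1/\<alpha>)\<^sup>2 * M2"
        unfolding abs_mult using l assms n by (intro mult_mono M2 power_mono) auto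
      ultimately show ?thesis using True unfolding kern'_eq by simp
    qed
  qed
qed

lemma kern'_measurable [measurable (raw)]:
  assumes [measurable]: "l \<in> borel_measurable M" "y \<in> borel_measurable M"
  shows "(\<lambda>x. kern' a (l x) (y x)) \<in> borel_measurable M"
  unfolding kern'_eq by measurable

text \<open>The difference of the two kernels is the integral of \<open>kern'\<close> over the
  scale. Exchanging the integrals leaves, for each \<open>l\<close>, the pairing of \<open>u\<close>
  with half the Laplacian of a test function, which is zero.\<close>

lemma weakly_harmonic_kern_mono:
  assumes um [measurable]: "u \<in> borel_measurable borel" and u2: "integrable lborel (\<lambda>x. (u x)\<^sup>2)"
    and harm: "weakly_harmonic u" and ab: "0 < \<alpha>" "\<alpha> \<le> \<beta>"
  shows "(\<integral>y. u y * kern a \<alpha> y \<partial>lborel) = (\<integral>y. u y * kern a \<beta> y \<partial>lborel)"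
proof -
  define H where "H l y = indicator {\<alpha>..\<beta>} l * (u y * kern' a l y)" for l y
  obtain M where M: "\<And>l y. \<alpha> \<le> l \<Longrightarrow> l \<le> \<beta> \<Longrightarrow> \<bar>kern' a l y\<bar> \<le> M * indicator (cball a (1 / \<alpha>)) y"
    using kern'_bound[OF ab(1)] by metis
  have Hm [measurable]: "case_prod H \<in> borel_measurable (lborel \<Otimes>\<^sub>M lborel)"
    unfolding H_def by measurable
  have int: "integrable (lborel \<Otimes>\<^sub>M lborel) (case_prod H)"
  proof (rule Bochner_Integration.integrable_bound)
    show "integrable (lborel \<Otimes>\<^sub>M lborel)
      (\<lambda>(l::real, y). (M * indicator {\<alpha>..\<beta>} l) * (indicator (cball a (1/\<alpha>)) y * u y))"
      by (intro integrable_pair_product integrable_mult_right integrable_real_indicator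
          integrable_indicator_cball_sq u2 um) (use ab in auto)
    show "AE x in lborel \<Otimes>\<^sub>M lborel. norm (case_prod H x) \<le> norm (case x of (l, y) \<Rightarrow>
        (M * indicator {\<alpha>..\<beta>} l) * (indicator (cball a (1/\<alpha>)) y * u y))"
    proof (rule AE_I2, clarify)
      fix l y
      show "norm (H l y) \<le> norm ((M * indicator {\<alpha>..\<beta>} l) * (indicator (cball a (1/\<alpha>)) y * u y))"
      proof (cases "l \<in> {\<alpha>..\<beta>}")
        case True
        have "\<bar>u y\<bar> * \<bar>kern' a l y\<bar> \<le> \<bar>u y\<bar> * \<bar>M * indicator (cball a (1 / \<alpha>)) y\<bar>"
          using M[of l y] True by (intro mult_left_mono) auto
        then show ?thesis using True by (simp add: H_def abs_mult mult_ac)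
      qed (simp add: H_def)
    qed
  qed (rule Hm)
  have "(\<integral>l. (\<integral>y. H l y \<partial>lborel) \<partial>lborel) = 0"
  proof -
    have "(\<integral>y. H l y \<partial>lborel) = 0" for l
    proof (cases "l \<in> {\<alpha>..\<beta>}")
      case True
      then have "test_function (\<lambda>y. bump 1 (l\<^sup>2 * (norm (y - a))\<^sup>2))"
        using ab by (intro test_function_bump_norm_sq) auto
      then have "(\<integral>y. u y * kern' a l y \<partial>lborel) = 0"
        using harm unfolding weakly_harmonic_def kern'_def by (auto simp: mult.left_commute)
      then show ?thesis by (simp add: H_def)
    qed (simp add: H_def)
    then show ?thesis by simp
  qed
  then have "0 = (\<integral>y. (\<integral>l. H l y \<partial>lborel) \<partial>lborel)"
    using lborel_pair.Fubini_integral[OF int] by simp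
  also have "\<dots> = (\<integral>y. u y * kern a \<beta> y - u y * kern a \<alpha> y \<partial>lborel)"
  proof (rule integral_cong_AE)
    have "AE y in lborel. integrable lborel (\<lambda>l. H l y)"
      using lborel_pair.AE_integrable_snd[OF int] by simp
    then show "AE y in lborel. (\<integral>l. H l y \<partial>lborel) = u y * kern a \<beta> y - u y * kern a \<alpha> y"
    proof eventually_elim
      case (elim y)
      have si: "set_integrable lborel {\<alpha>..\<beta>} (\<lambda>l. u y * kern' a l y)"
        using elim by (simp add: set_integrable_def H_def)
      have "((\<lambda>l. u y * kern' a l y) has_integral u y * kern a \<beta> y - u y * kern a \<alpha> y) {\<alpha>..\<beta>}"
        by (rule fundamental_theorem_of_calculus)
          (use ab in \<open>auto intro!: has_field_derivative_at_within[OF DERIV_cmult[OF kern_has_derivative]]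
            simp flip: has_real_derivative_iff_has_vector_derivative\<close>)
      then have "integral {\<alpha>..\<beta>} (\<lambda>l. u y * kern' a l y) = u y * kern a \<beta> y - u y * kern a \<alpha> y"
        by (rule integral_unique)
      with set_borel_integral_eq_integral(2)[OF si] show ?case
        by (simp only: set_lebesgue_integral_def H_def real_scaleR_def)
    qed
  qed measurable
  also have "\<dots> = (\<integral>y. u y * kern a \<beta> y \<partial>lborel) - (\<integral>y. u y * kern a \<alpha> y \<partial>lborel)"
  proof (rule Bochner_Integration.integral_diff)
    have "integrable lborel (\<lambda>y. u y * kern a l y)" if l: "l > 0" for l
    proof -
      obtain M where M: "\<And>y. \<bar>kern a l y\<bar> \<le> l ^ 3 * M * indicator (cball a (1 / l)) y"
        using kern_bound l by metis
      show ?thesis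
      proof (rule Bochner_Integration.integrable_bound)
        show "integrable lborel (\<lambda>y. (l^3 * M) * (indicator (cball a (1/l)) y * u y))"
          by (intro integrable_mult_right integrable_indicator_cball_sq u2 um)
        have "\<bar>u y\<bar> * \<bar>kern a l y\<bar> \<le> \<bar>u y\<bar> * \<bar>l ^ 3 * M * indicator (cball a (1 / l)) y\<bar>" for y
          using M[of y] by (intro mult_left_mono) auto
        then show "AE y in lborel. norm (u y * kern a l y) \<le> norm ((l^3 * M) * (indicator (cball a (1/l)) y * u y))"
          by (auto simp: abs_mult mult_ac)
      qed measurable
    qed
    then show "integrable lborel (\<lambda>y. u y * kern a \<beta> y)" "integrable lborel (\<lambda>y. u y * kern a \<alpha> y)"
      using ab by auto
  qed
  finally show ?thesis by simp
qed

text \<open>The scale may be changed freely, so let \<open>l\<close> tend to \<open>0\<close>: the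
  kernel spreads out, and its square has integral of order \<open>l^6 * l^-3 = l^3\<close>. By
  Cauchy-Schwarz the common value of all pairings is zero.\<close>

lemma weakly_harmonic_kern_eq_0:
  assumes um [measurable]: "u \<in> borel_measurable borel" and u2: "integrable lborel (\<lambda>x. (u x)\<^sup>2)"
    and harm: "weakly_harmonic u" and L: "0 < L"
  shows "(\<integral>y. u y * kern a L y \<partial>lborel) = 0"
proof -
  obtain M where M: "M > 0" "\<And>l y. l > 0 \<Longrightarrow> \<bar>kern a l y\<bar> \<le> l ^ 3 * M * indicator (cball a (1 / l)) y"
    using kern_bound by metis
  define I where "I = (\<integral>y. u y * kern a L y \<partial>lborel)"
  define K where "K = (\<integral>y. (u y)\<^sup>2 \<partial>lborel) * (M\<^sup>2 * unit_ball_vol 3)"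
  have le: "I\<^sup>2 \<le> K * l ^ 3" if l: "0 < l" "l \<le> L" for l
  proof -
    have kb: "(kern a l y)\<^sup>2 \<le> (l ^ 3 * M)\<^sup>2 * indicator (cball a (1 / l)) y" for y
    proof (cases "y \<in> cball a (1 / l)")
      case True
      then have "\<bar>kern a l y\<bar> \<le> l ^ 3 * M" using M(2)[OF l(1), of y] by simp
      then have "\<bar>kern a l y\<bar>\<^sup>2 \<le> (l ^ 3 * M)\<^sup>2" by (intro power_mono) auto
      then show ?thesis using True by simp
    next
      case False
      then have "\<bar>kern a l y\<bar> \<le> 0" using M(2)[OF l(1), of y] by simp
      then show ?thesis by simp
    qed
    have ib: "integrable lborel (\<lambda>y. (l ^ 3 * M)\<^sup>2 * indicator (cball a (1 / l)) y)"
      using emeasure_lborel_cball_finite[of a "1/l"] by (intro integrable_mult_right integrable_real_indicator) auto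
    have ik: "integrable lborel (\<lambda>y. (kern a l y)\<^sup>2)"
      by (rule Bochner_Integration.integrable_bound[OF ib]) (use kb in auto)
    have "(\<integral>y. (kern a l y)\<^sup>2 \<partial>lborel) \<le> (\<integral>y. (l ^ 3 * M)\<^sup>2 * indicator (cball a (1 / l)) y \<partial>lborel)"
      by (rule integral_mono[OF ik ib kb])
    also have "\<dots> = (l ^ 3 * M)\<^sup>2 * measure lborel (cball a (1 / l))"
      by simp
    also have "\<dots> = M\<^sup>2 * unit_ball_vol 3 * l ^ 3"
      using l by (simp add: content_cball field_simps power_mult_distrib power_divide eval_nat_numeral)
    finally have k: "(\<integral>y. (kern a l y)\<^sup>2 \<partial>lborel) \<le> M\<^sup>2 * unit_ball_vol 3 * l ^ 3" .
    have "(\<integral>y. u y \<bullet> kern a l y \<partial>lborel)\<^sup>2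
        \<le> (\<integral>y. (norm (u y))\<^sup>2 \<partial>lborel) * (\<integral>y. (norm (kern a l y))\<^sup>2 \<partial>lborel)"
      by (rule integral_inner_Cauchy_Schwarz) (use ik u2 in \<open>auto simp: sq_integrable_def\<close>)
    then have "(\<integral>y. u y * kern a l y \<partial>lborel)\<^sup>2 \<le> (\<integral>y. (u y)\<^sup>2 \<partial>lborel) * (\<integral>y. (kern a l y)\<^sup>2 \<partial>lborel)"
      by simp
    also have "\<dots> \<le> (\<integral>y. (u y)\<^sup>2 \<partial>lborel) * (M\<^sup>2 * unit_ball_vol 3 * l ^ 3)"
      by (intro mult_left_mono k) simp
    finally show ?thesis
      using weakly_harmonic_kern_mono[OF um u2 harm l, of a] by (simp add: I_def K_def mult.assoc)
  qed
  have "((\<lambda>l. K * l ^ 3) \<longlongrightarrow> K * 0 ^ 3) (at_right 0)"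
    by (intro tendsto_intros)
  then have "I\<^sup>2 \<le> K * 0 ^ 3"
  proof (rule tendsto_lowerbound)
    show "\<forall>\<^sub>F l in at_right 0. I\<^sup>2 \<le> K * l ^ 3"
      unfolding eventually_at_right_field using L le by (intro exI[of _ L]) auto
  qed simp
  then show ?thesis by (simp add: I_def)
qed

section \<open>From vanishing averages to a vanishing function\<close>

lemma integral_lborel_affine:
  fixes f :: "'a::euclidean_space \<Rightarrow> real"
  assumes [measurable]: "f \<in> borel_measurable borel" and c: "c \<noteq> 0"
  shows "(\<integral>x. f x \<partial>lborel) = \<bar>c\<bar> ^ DIM('a) * (\<integral>x. f (t + c *\<^sub>R x) \<partial>lborel)"
proof -
  have "(\<integral>x. f x \<partial>lborel) = (\<integral>x. f x \<partial>density (distr lborel borel (\<lambda>x. t + c *\<^sub>R x)) (\<lambda>_. \<bar>c\<bar>^DIM('a)))"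
    using lborel_affine[OF c, of t] by simp
  also have "\<dots> = (\<integral>x. \<bar>c\<bar>^DIM('a) *\<^sub>R f x \<partial>distr lborel borel (\<lambda>x. t + c *\<^sub>R x))"
    by (rule integral_density) auto
  also have "\<dots> = (\<integral>x. \<bar>c\<bar>^DIM('a) *\<^sub>R f (t + c *\<^sub>R x) \<partial>lborel)"
    by (rule integral_distr) auto
  finally show ?thesis by simp
qed

lemma AE_not_frontier_cbox: "AE y in lborel. y \<notin> frontier (cbox p (q :: 'a::euclidean_space))"
proof -
  have "frontier (cbox p q) \<in> null_sets lebesgue"
    using negligible_convex_frontier[of "cbox p q"] by (simp add: negligible_iff_null_sets)
  then have "AE y in lebesgue. y \<notin> frontier (cbox p q)"
    by (rule AE_not_in)
  then show ?thesis by (simp add: AE_completion_iff)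
qed

text \<open>The polynomial \<open>bump_step 1\<close> is \<open>- s^2\<close>, so the profile is
  strictly negative in the open unit ball and no cancellation can occur in its integral.\<close>

lemma bump_profile:
  defines "b \<equiv> \<lambda>z :: real^3. bump (bump_step 1) ((norm z)\<^sup>2)"
  shows "integrable lborel b" "(\<integral>z. b z \<partial>lborel) \<noteq> 0"
proof -
  have v: "b z = 0" if "norm z > 1" for z
    using bump_norm_sq_vanish[of 1 z 0 "bump_step 1"] that by (simp add: b_def)
  have neg: "b z < 0" if "norm z < 1" for z
  proof -
    have "(norm z)\<^sup>2 < 1" using that by (simp add: power_less_one_iff)
    then show ?thesis by (simp add: b_def bump_def bump_step_def zero_less_mult_iff)
  qed
  have cont: "continuous_on UNIV b"
    unfolding b_def by (rule continuous_on_compose2[OF continuous_bump]) (auto intro!: continuous_intros)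
  show i: "integrable lborel b"
    by (rule integrable_continuous_vanishing[OF cont v])
  have nonpos: "b z \<le> 0" for z
  proof -
    consider "norm z < 1" | "norm z = 1" | "norm z > 1" by linarith
    then show ?thesis
      by cases (use neg[of z] v[of z] in \<open>auto simp: b_def bump_def\<close>)
  qed
  show "(\<integral>z. b z \<partial>lborel) \<noteq> 0"
  proof
    assume "(\<integral>z. b z \<partial>lborel) = 0"
    then have "(\<integral>z. - b z \<partial>lborel) = 0" by simp
    then have "AE z in lborel. - b z = 0"
      using i nonpos by (subst (asm) integral_nonneg_eq_0_iff_AE) auto
    then have "AE z in lborel. z \<notin> ball (0 :: real^3) 1"
    proof eventually_elim
      case (elim z)
      then show ?case using neg[of z] by auto
    qed
    then have "emeasure lborel (ball (0::real^3) 1) = 0"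
      by (subst (asm) AE_iff_measurable[of "ball 0 1"]) auto
    then have "measure lborel (ball (0::real^3) 1) = 0" by (simp add: measure_def)
    then show False by simp
  qed
qed

text \<open>Integrating the vanishing pairings over all centres in the box shows that
  \<open>u\<close> pairs to zero with a mollified indicator of the box. The smoothing falls on the
  indicator, whose convergence off the frontier is elementary, and not on \<open>u\<close>, which is
  merely square integrable.\<close>

lemma weakly_harmonic_integral_cbox:
  assumes um [measurable]: "u \<in> borel_measurable borel" and u2: "integrable lborel (\<lambda>x. (u x)\<^sup>2)"
    and harm: "weakly_harmonic u"
  shows "(\<integral>y. u y * indicator (cbox p q) y \<partial>lborel) = 0"
proof -
  define A where "A = cbox p q"
  have [measurable]: "A \<in> sets borel" by (simp add: A_def)
  define b where "b z = bump (bump_step 1) ((norm z)\<^sup>2)" for z :: "real^3"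
  have bm [measurable]: "b \<in> borel_measurable borel" unfolding b_def by measurable
  have bi: "integrable lborel b" and b0: "(\<integral>z. b z \<partial>lborel) \<noteq> 0"
    unfolding b_def using bump_profile by auto
  define l where "l n = real (Suc n)" for n
  have l: "l n > 0" "l n \<ge> 1" for n by (auto simp: l_def)
  define J where "J n y = (\<integral>a. indicator A a * kern a (l n) y \<partial>lborel)" for n y
  obtain r where r: "r > 0" "A \<subseteq> cball 0 r"
    using bounded_cbox[of p q] bounded_pos unfolding A_def by (metis mem_cball_0 subsetI)
  obtain M where M: "M > 0" "\<And>a l y. l > 0 \<Longrightarrow> \<bar>kern a l y\<bar> \<le> l ^ 3 * M * indicator (cball a (1 / l)) y"
    using kern_bound by metis
  have near: "y \<in> cball 0 (r + 1)" if "a \<in> A" "kern a (l n) y \<noteq> 0" for a n y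
  proof -
    have "y \<in> cball a (1 / l n)"
      using M(2)[OF l(1)[of n], of a y] that(2) by (cases "y \<in> cball a (1 / l n)") auto
    moreover have "1 / l n \<le> 1" using l(2)[of n] by simp
    moreover have "norm a \<le> r" using r that by auto
    ultimately show ?thesis
      using norm_triangle_sub[of y a] by (simp add: dist_norm norm_minus_commute)
  qed
  \<comment> \<open>Substitution \<open>a = y - z / l n\<close>: the kernel becomes the fixed
    profile \<open>b\<close>, and only the indicator still depends on \<open>n\<close>.\<close>
  have J_eq: "J n y = (\<integral>z. indicator A (y - (1 / l n) *\<^sub>R z) * b z \<partial>lborel)" for n y
  proof -
    have "J n y = \<bar>- 1 / l n\<bar> ^ DIM(real^3) *
        (\<integral>z. indicator A (y + (- 1 / l n) *\<^sub>R z) * kern (y + (- 1 / l n) *\<^sub>R z) (l n) y \<partial>lborel)"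
      unfolding J_def using l[of n] by (intro integral_lborel_affine) auto
    also have "\<dots> = (\<integral>z. \<bar>- 1 / l n\<bar> ^ 3 * (indicator A (y + (- 1 / l n) *\<^sub>R z) * kern (y + (- 1 / l n) *\<^sub>R z) (l n) y) \<partial>lborel)"
      by simp
    also have "\<dots> = (\<integral>z. indicator A (y - (1 / l n) *\<^sub>R z) * b z \<partial>lborel)"
    proof (rule Bochner_Integration.integral_cong[OF refl])
      fix z
      have "(l n)\<^sup>2 * (norm (y - (y + (- 1 / l n) *\<^sub>R z)))\<^sup>2 = (norm z)\<^sup>2"
        using l[of n] by (simp add: power_divide)
      then have "kern (y + (- 1 / l n) *\<^sub>R z) (l n) y = l n ^ 3 * b z"
        by (simp add: kern_def b_def)
      then show "\<bar>- 1 / l n\<bar> ^ 3 * (indicator A (y + (- 1 / l n) *\<^sub>R z) * kern (y + (- 1 / l n) *\<^sub>R z) (l n) y)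
          = indicator A (y - (1 / l n) *\<^sub>R z) * b z"
        using l[of n] by (simp add: power_divide)
    qed
    finally show ?thesis .
  qed
  have J_bound: "\<bar>J n y\<bar> \<le> (\<integral>z. \<bar>b z\<bar> \<partial>lborel) * indicator (cball 0 (r + 1)) y" for n y
  proof (cases "y \<in> cball 0 (r + 1)")
    case True
    have "\<bar>J n y\<bar> \<le> (\<integral>z. \<bar>b z\<bar> \<partial>lborel)"
      unfolding J_eq
      by (rule order.trans[OF integral_abs_bound integral_mono'])
        (use bi in \<open>auto simp: indicator_def\<close>)
    then show ?thesis using True by simp
  next
    case False
    then have "(\<lambda>a. indicator A a * kern a (l n) y) = (\<lambda>_. 0)"
      using near[of _ n y] by (auto simp: indicator_def fun_eq_iff)
    then have "J n y = 0" unfolding J_def by simp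
    then show ?thesis by simp
  qed
  have J_lim: "(\<lambda>n. J n y) \<longlonglongrightarrow> indicator A y * (\<integral>z. b z \<partial>lborel)" if y: "y \<notin> frontier A" for y
  proof -
    have "(\<lambda>n. \<integral>z. indicator A (y - (1 / l n) *\<^sub>R z) * b z \<partial>lborel) \<longlonglongrightarrow> (\<integral>z. indicator A y * b z \<partial>lborel)"
    proof (rule integral_dominated_convergence[where w = "\<lambda>z. \<bar>b z\<bar>"])
      show "AE z in lborel. (\<lambda>n. indicator A (y - (1 / l n) *\<^sub>R z) * b z) \<longlonglongrightarrow> indicator A y * b z"
      proof (rule AE_I2)
        fix z
        have "(\<lambda>n. 1 / l n) \<longlonglongrightarrow> 0"
          unfolding l_def by (rule LIMSEQ_Suc[OF lim_1_over_n])
        then have "(\<lambda>n. y - (1 / l n) *\<^sub>R z) \<longlonglongrightarrow> y - 0 *\<^sub>R z"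
          by (intro tendsto_intros)
        then have lim: "(\<lambda>n. y - (1 / l n) *\<^sub>R z) \<longlonglongrightarrow> y" by simp
        have "y \<in> interior A \<or> y \<in> - closure A" using y by (auto simp: frontier_def)
        then have "\<forall>\<^sub>F n in sequentially. indicator A (y - (1 / l n) *\<^sub>R z) = (indicator A y :: real)"
        proof
          assume y: "y \<in> interior A"
          have "\<forall>\<^sub>F n in sequentially. y - (1 / l n) *\<^sub>R z \<in> interior A"
            by (rule topological_tendstoD[OF lim]) (use y in auto)
          then show ?thesis
            by eventually_elim (use y interior_subset in \<open>auto simp: indicator_def\<close>)
        next
          assume y: "y \<in> - closure A"
          have "\<forall>\<^sub>F n in sequentially. y - (1 / l n) *\<^sub>R z \<in> - closure A"
            by (rule topological_tendstoD[OF lim]) (use y in auto)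
          then show ?thesis
            by eventually_elim (use y closure_subset in \<open>auto simp: indicator_def\<close>)
        qed
        then show "(\<lambda>n. indicator A (y - (1 / l n) *\<^sub>R z) * b z) \<longlonglongrightarrow> indicator A y * b z"
          by (intro tendsto_mult_right tendsto_eventually)
      qed
    qed (use bi in \<open>auto simp: indicator_def\<close>)
    then show ?thesis by (simp add: J_eq)
  qed
  have int0: "(\<integral>y. u y * J n y \<partial>lborel) = 0" for n
  proof -
    let ?H = "\<lambda>a y. indicator A a * (u y * kern a (l n) y)"
    have int: "integrable (lborel \<Otimes>\<^sub>M lborel) (case_prod ?H)"
    proof (rule Bochner_Integration.integrable_bound)
      show "integrable (lborel \<Otimes>\<^sub>M lborel)
        (\<lambda>(a, y). (l n ^ 3 * M * indicator A a) * (indicator (cball 0 (r + 1)) y * u y))"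
        by (intro integrable_pair_product integrable_mult_right integrable_real_indicator
            integrable_indicator_cball_sq u2 um) (auto simp: A_def emeasure_lborel_cbox_finite[unfolded infinity_ennreal_def])
      show "AE x in lborel \<Otimes>\<^sub>M lborel. norm (case_prod ?H x) \<le> norm (case x of (a, y) \<Rightarrow>
          (l n ^ 3 * M * indicator A a) * (indicator (cball 0 (r + 1)) y * u y))"
      proof (rule AE_I2, clarify)
        fix a y
        have "\<bar>kern a (l n) y\<bar> \<le> l n ^ 3 * M"
          by (rule order.trans[OF M(2)[OF l(1)] mult_left_le])
            (use M(1) l[of n] in \<open>auto simp: indicator_def\<close>)
        then have "\<bar>u y\<bar> * \<bar>kern a (l n) y\<bar> \<le> \<bar>u y\<bar> * (l n ^ 3 * M)"
          by (intro mult_left_mono) auto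
        then show "norm (indicator A a * (u y * kern a (l n) y))
          \<le> norm ((l n ^ 3 * M * indicator A a) * (indicator (cball 0 (r + 1)) y * u y))"
          using near[of a n y] M(1) l[of n]
          by (cases "a \<in> A \<and> kern a (l n) y \<noteq> 0") (auto simp: abs_mult mult_ac)
      qed
    qed measurable
    have "(\<integral>y. u y * J n y \<partial>lborel) = (\<integral>y. (\<integral>a. ?H a y \<partial>lborel) \<partial>lborel)"
      by (simp add: J_def mult.left_commute flip: integral_mult_right_zero)
    also have "\<dots> = (\<integral>a. (\<integral>y. ?H a y \<partial>lborel) \<partial>lborel)"
      by (rule lborel_pair.Fubini_integral[OF int])
    also have "\<dots> = 0"
      using weakly_harmonic_kern_eq_0[OF um u2 harm l(1)] by simp
    finally show ?thesis .
  qed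
  have "(\<lambda>n. \<integral>y. u y * J n y \<partial>lborel) \<longlonglongrightarrow> (\<integral>y. u y * (indicator A y * (\<integral>z. b z \<partial>lborel)) \<partial>lborel)"
  proof (rule integral_dominated_convergence)
    show "integrable lborel (\<lambda>y. (\<integral>z. \<bar>b z\<bar> \<partial>lborel) * \<bar>indicator (cball 0 (r + 1)) y * u y\<bar>)"
      by (intro integrable_mult_right integrable_abs integrable_indicator_cball_sq u2 um)
    show "AE y in lborel. (\<lambda>n. u y * J n y) \<longlonglongrightarrow> u y * (indicator A y * (\<integral>z. b z \<partial>lborel))"
      using AE_not_frontier_cbox[of p q]
      by eventually_elim (intro tendsto_mult_left J_lim, simp add: A_def)
    show "AE y in lborel. norm (u y * J n y) \<le> (\<integral>z. \<bar>b z\<bar> \<partial>lborel) * \<bar>indicator (cball 0 (r + 1)) y * u y\<bar>" for n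
    proof (rule AE_I2)
      fix y
      have "\<bar>u y\<bar> * \<bar>J n y\<bar> \<le> \<bar>u y\<bar> * ((\<integral>z. \<bar>b z\<bar> \<partial>lborel) * indicator (cball 0 (r + 1)) y)"
        using J_bound by (intro mult_left_mono) auto
      then show "norm (u y * J n y) \<le> (\<integral>z. \<bar>b z\<bar> \<partial>lborel) * \<bar>indicator (cball 0 (r + 1)) y * u y\<bar>"
        by (simp add: abs_mult mult_ac)
    qed
    show "(\<lambda>y. u y * J n y) \<in> borel_measurable lborel" for n
      unfolding J_def by measurable
  qed measurable
  then have "(\<integral>y. u y * (indicator A y * (\<integral>z. b z \<partial>lborel)) \<partial>lborel) = 0"
    unfolding int0 by (simp add: LIMSEQ_const_iff)
  then have "(\<integral>y. u y * indicator A y \<partial>lborel) * (\<integral>z. b z \<partial>lborel) = 0"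
    by (simp add: mult.assoc flip: integral_mult_left_zero)
  then show ?thesis using b0 by (simp add: A_def)
qed

text \<open>All box integrals of \<open>u\<close> vanish, so by Lebesgue differentiation over the
  cubes with corner \<open>x\<close> the value \<open>u x\<close> is zero off a negligible
  set.\<close>

theorem weakly_harmonic_square_integrable_eq_0:
  assumes um: "u \<in> borel_measurable borel" and u2: "integrable lborel (\<lambda>x. (u x)\<^sup>2)"
    and harm: "weakly_harmonic u"
  shows "AE x in lborel. u x = 0"
proof -
  have si: "set_integrable lborel (cbox p q) u" for p q
  proof -
    obtain r where "\<forall>x\<in>cbox p q. norm x \<le> r"
      using bounded_cbox[of p q] unfolding bounded_iff by blast
    then have sub: "cbox p q \<subseteq> cball 0 r" by auto
    have "set_integrable lborel (cball 0 r) u"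
      using integrable_indicator_cball_sq[OF um u2] by (simp add: set_integrable_def)
    then show ?thesis by (rule set_integrable_subset) (use sub in auto)
  qed
  have 0: "integral (cbox p q) u = 0" for p q
    using set_borel_integral_eq_integral(2)[OF si[of p q]] weakly_harmonic_integral_cbox[OF um u2 harm, of p q]
    by (simp add: set_lebesgue_integral_def mult.commute)
  have "u integrable_on cbox p q" for p q
    using set_borel_integral_eq_integral(1)[OF si[of p q]] .
  then obtain N where N: "negligible N" and lim: "\<And>x e. \<lbrakk>x \<notin> N; 0 < e\<rbrakk> \<Longrightarrow>
     \<exists>d>0. \<forall>h. 0 < h \<and> h < d \<longrightarrow> norm (integral (cbox x (x + h *\<^sub>R One)) u /\<^sub>R h ^ DIM(real^3) - u x) < e"
    using integrable_ccontinuous_explicit by blast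
  have z: "u x = 0" if x: "x \<notin> N" for x
  proof (rule ccontr)
    assume "u x \<noteq> 0"
    then obtain d where d: "d > 0" "\<And>h. 0 < h \<Longrightarrow> h < d \<Longrightarrow> norm (0 /\<^sub>R h ^ DIM(real^3) - u x) < \<bar>u x\<bar>"
      using lim[OF x, of "\<bar>u x\<bar>"] unfolding 0 by auto
    from d(2)[of "d/2"] d(1) show False by simp
  qed
  have "AE x in lebesgue. x \<notin> N"
    using N by (intro AE_not_in) (simp add: negligible_iff_null_sets)
  then have "AE x in lebesgue. u x = 0"
    by eventually_elim (rule z)
  then show ?thesis by (simp add: AE_completion_iff)
qed

section \<open>The Helmholtz decomposition\<close>

lemma L2_eq_sq_integrable: "L2 \<Omega> = {m. sq_integrable (lebesgue_on \<Omega>) m}"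
  by (simp add: L2_def sq_integrable_def)

lemma L2_UNIV_iff: "h \<in> L2 UNIV \<longleftrightarrow> sq_integrable lebesgue h"
  by (simp add: L2_eq_sq_integrable lebesgue_on_UNIV_eq)

lemma sq_integrable_extend_by_zero:
  fixes m :: "real^3 \<Rightarrow> real^3"
  assumes "\<Omega> \<in> sets lebesgue" "m \<in> L2 \<Omega>"
  shows "sq_integrable lebesgue (\<lambda>x. indicator \<Omega> x *\<^sub>R m x)"
proof -
  have "(norm (indicator \<Omega> x *\<^sub>R m x))\<^sup>2 = indicator \<Omega> x *\<^sub>R (norm (m x))\<^sup>2" for x
    by (simp add: indicator_def)
  then show ?thesis
    using assms
    by (simp add: L2_def sq_integrable_def borel_measurable_restrict_space_iff integrable_restrict_space
        del: norm_scaleR)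
qed

lemma grad_nth [simp]: "grad \<phi> x $ i = partial_deriv i \<phi> x"
  by (simp add: grad_def)

lemma inner_vec_real: "(x :: real^'n) \<bullet> y = (\<Sum>i\<in>UNIV. x$i * y$i)"
  by (simp add: inner_vec_def)

lemma sq_integrable_continuous_vanishing:
  fixes f :: "'a::euclidean_space \<Rightarrow> 'b::euclidean_space"
  assumes f: "continuous_on UNIV f" "\<And>x. norm x > r \<Longrightarrow> f x = 0"
  shows "sq_integrable lebesgue f"
  unfolding sq_integrable_def
proof
  show "f \<in> borel_measurable lebesgue"
    using f(1) by (intro measurable_completion) (simp add: borel_measurable_continuous_onI)
  have i: "integrable lborel (\<lambda>x. (norm (f x))\<^sup>2)"
    by (rule integrable_continuous_vanishing[of _ r]) (auto intro!: continuous_intros f)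
  then show "integrable lebesgue (\<lambda>x. (norm (f x))\<^sup>2)"
    using borel_measurable_integrable[OF i] by (simp add: integrable_completion)
qed

lemma sq_integrable_test_function:
  assumes "test_function \<phi>" shows "sq_integrable lebesgue (\<lambda>x. \<phi> x *\<^sub>R (v :: real^3))"
proof -
  obtain r where "\<And>x. norm x > r \<Longrightarrow> \<phi> x = 0"
    using test_function_vanish[OF assms] by blast
  then show ?thesis
    by (intro sq_integrable_continuous_vanishing[of _ r] continuous_intros smooth_continuous
        test_function_smooth assms) auto
qed

lemma grad_eq_sum: "grad \<phi> x = (\<Sum>i\<in>UNIV. partial_deriv i \<phi> x *\<^sub>R axis i 1)"
  by (simp add: vec_eq_iff axis_def sum.delta if_distrib[of "\<lambda>t. _ * t"] cong: if_cong)

lemma sq_integrable_sum: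
  assumes "\<And>i. i \<in> I \<Longrightarrow> sq_integrable M (f i)" "finite I"
  shows "sq_integrable M (\<lambda>x. \<Sum>i\<in>I. f i x)"
  using assms(2,1)
proof (induction I rule: finite_induct)
  case empty
  then show ?case by (simp add: sq_integrable_def)
next
  case (insert i I)
  then show ?case by (simp add: sq_integrable_add)
qed

lemma sq_integrable_grad:
  assumes "test_function \<phi>" shows "sq_integrable lebesgue (grad \<phi>)"
proof -
  have "grad \<phi> = (\<lambda>x. \<Sum>i\<in>UNIV. partial_deriv i \<phi> x *\<^sub>R axis i 1)"
    by (intro ext grad_eq_sum)
  then show ?thesis
    by (simp only:) (intro sq_integrable_sum sq_integrable_test_function test_function_partial_deriv assms finite)
qed

section \<open>The weak curl in components\<close>

lemma integrable_nth_test_function: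
  fixes h :: "real^3 \<Rightarrow> real^3"
  assumes "sq_integrable lebesgue h" "test_function \<phi>"
  shows "integrable lebesgue (\<lambda>x. h x $ i * \<phi> x)"
  using sq_integrable_inner[OF assms(1) sq_integrable_test_function[OF assms(2), of "axis i 1"]]
  by (simp add: inner_axis mult.commute)

lemma integrable_vecI:
  fixes f :: "'a \<Rightarrow> real^'n"
  assumes "\<And>i. integrable M (\<lambda>x. f x $ i)"
  shows "integrable M f"
proof -
  have "f = (\<lambda>x. \<Sum>i\<in>UNIV. (f x $ i) *\<^sub>R axis i 1)"
    by (simp add: fun_eq_iff vec_eq_iff axis_def sum.delta if_distrib[of "\<lambda>t. _ * t"] cong: if_cong)
  moreover have "integrable M (\<lambda>x. \<Sum>i\<in>UNIV. (f x $ i) *\<^sub>R axis i (1::real))"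
    by (intro Bochner_Integration.integrable_sum integrable_scaleR_left assms)
  ultimately show ?thesis by simp
qed

lemma integral_vec_nth:
  fixes f :: "'a \<Rightarrow> real^'n"
  assumes "integrable M f"
  shows "(\<integral>x. f x \<partial>M) $ i = (\<integral>x. f x $ i \<partial>M)"
  using integral_bounded_linear[OF bounded_linear_vec_nth assms] by simp

context includes cross3_syntax
begin

text \<open>Turns the cross product into symmetry of pairings in \<open>i\<close> and
  \<open>j\<close>. Square integrability makes the vector integrand integrable; a Bochner integral
  that is \<open>0\<close> by default could not be read off componentwise.\<close>

lemma curl_zero_iff:
  assumes h: "sq_integrable lebesgue h"
  shows "curl_zero h \<longleftrightarrow> (\<forall>\<phi> i j. test_function \<phi> \<longrightarrow>
    (\<integral>x. h x $ i * partial_deriv j \<phi> x \<partial>lebesgue) = (\<integral>x. h x $ j * partial_deriv i \<phi> x \<partial>lebesgue))"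
    (is "_ \<longleftrightarrow> ?R")
proof -
  have comp: "(\<integral>x. grad \<phi> x \<times> h x \<partial>lebesgue) = 0 \<longleftrightarrow>
     (\<forall>i j. (\<integral>x. h x $ i * partial_deriv j \<phi> x \<partial>lebesgue) = (\<integral>x. h x $ j * partial_deriv i \<phi> x \<partial>lebesgue))"
    if \<phi>: "test_function \<phi>" for \<phi>
  proof -
    have i: "integrable lebesgue (\<lambda>x. h x $ i * partial_deriv j \<phi> x)" for i j
      by (intro integrable_nth_test_function h test_function_partial_deriv \<phi>)
    have c: "(grad \<phi> x \<times> h x) $ 1 = h x $ 3 * partial_deriv 2 \<phi> x - h x $ 2 * partial_deriv 3 \<phi> x"
      "(grad \<phi> x \<times> h x) $ 2 = h x $ 1 * partial_deriv 3 \<phi> x - h x $ 3 * partial_deriv 1 \<phi> x"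
      "(grad \<phi> x \<times> h x) $ 3 = h x $ 2 * partial_deriv 1 \<phi> x - h x $ 1 * partial_deriv 2 \<phi> x" for x
      by (simp_all add: cross3_def mult.commute)
    have "integrable lebesgue (\<lambda>x. (grad \<phi> x \<times> h x) $ k)" for k
      using exhaust_3[of k] by (auto simp: c intro!: Bochner_Integration.integrable_diff i)
    then have "integrable lebesgue (\<lambda>x. grad \<phi> x \<times> h x)" by (rule integrable_vecI)
    then show ?thesis
      by (auto simp: vec_eq_iff forall_3 integral_vec_nth c i)
  qed
  then show ?thesis unfolding curl_zero_def by blast
qed

end

text \<open>The derivative of \<open>u\<close> is moved onto the test function, where the two
  derivatives commute.\<close>

lemma integral_grad_commute:
  assumes \<phi>: "test_function \<phi>" and u: "smooth u"
  shows "(\<integral>x. partial_deriv i u x * partial_deriv j \<phi> x \<partial>lborel)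
    = (\<integral>x. partial_deriv j u x * partial_deriv i \<phi> x \<partial>lborel)"
proof -
  have *: "(\<integral>x. partial_deriv i u x * partial_deriv j \<phi> x \<partial>lborel)
      = - (\<integral>x. u x * partial_deriv i (partial_deriv j \<phi>) x \<partial>lborel)" for i j
    by (rule integral_by_parts_test_function[where S = "{}"])
      (auto intro!: smooth_continuous u test_function_partial_deriv \<phi> integrable_continuous_test_function
        smooth_partial_deriv partial_deriv_line smooth_differentiable)
  have "partial_deriv i (partial_deriv j \<phi>) = partial_deriv j (partial_deriv i \<phi>)"
    using test_function_smooth[OF \<phi>] by (auto simp: smooth_def intro!: partial_deriv_commute)
  then show ?thesis unfolding * by simp
qed

lemma integral_lebesgue_continuous:
  fixes f :: "'a::euclidean_space \<Rightarrow> real"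
  assumes "continuous_on UNIV f"
  shows "(\<integral>x. f x \<partial>lebesgue) = (\<integral>x. f x \<partial>lborel)"
  using assms by (intro integral_completion) (simp add: borel_measurable_continuous_onI)

lemma curl_zero_grad:
  assumes "test_function u" shows "curl_zero (grad u)"
  unfolding curl_zero_iff[OF sq_integrable_grad[OF assms]] grad_nth
proof (intro allI impI)
  fix \<phi> i j assume \<phi>: "test_function \<phi>"
  have c: "continuous_on UNIV (\<lambda>x. partial_deriv i u x * partial_deriv j \<phi> x)" for i j
    using assms \<phi> by (intro continuous_intros smooth_continuous smooth_partial_deriv test_function_smooth)
  show "(\<integral>x. partial_deriv i u x * partial_deriv j \<phi> x \<partial>lebesgue)
      = (\<integral>x. partial_deriv j u x * partial_deriv i \<phi> x \<partial>lebesgue)"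
    unfolding integral_lebesgue_continuous[OF c]
    by (intro integral_grad_commute \<phi> test_function_smooth assms)
qed

lemma curl_zero_diff:
  assumes V: "sq_integrable lebesgue V" "curl_zero V" and W: "sq_integrable lebesgue W" "curl_zero W"
  shows "curl_zero (\<lambda>x. V x - W x)"
  using V(2) W(2) unfolding curl_zero_iff[OF V(1)] curl_zero_iff[OF W(1)]
    curl_zero_iff[OF sq_integrable_diff[OF V(1) W(1)]]
  by (simp add: left_diff_distrib integrable_nth_test_function[OF V(1)] integrable_nth_test_function[OF W(1)]
      test_function_partial_deriv)

text \<open>For a fixed test function the curl condition is an equation between two linear pairings
  that are continuous in \<open>L2\<close>.\<close>

lemma curl_zero_limit:
  assumes s: "\<And>n. sq_integrable lebesgue (s n)" "\<And>n. curl_zero (s n)" and p: "sq_integrable lebesgue p"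
    and lim: "(\<lambda>n. \<integral>x. (norm (s n x - p x))\<^sup>2 \<partial>lebesgue) \<longlonglongrightarrow> 0"
  shows "curl_zero p"
  unfolding curl_zero_iff[OF p]
proof (intro allI impI)
  fix \<phi> i j assume \<phi>: "test_function \<phi>"
  have l: "(\<lambda>n. \<integral>x. s n x $ i * partial_deriv j \<phi> x \<partial>lebesgue)
      \<longlonglongrightarrow> (\<integral>x. p x $ i * partial_deriv j \<phi> x \<partial>lebesgue)" for i j
    using tendsto_integral_inner[OF s(1) p sq_integrable_test_function[OF test_function_partial_deriv[OF \<phi>, of j], of "axis i 1"] lim]
    by (simp add: inner_axis mult.commute)
  have "(\<integral>x. s n x $ i * partial_deriv j \<phi> x \<partial>lebesgue) = (\<integral>x. s n x $ j * partial_deriv i \<phi> x \<partial>lebesgue)" for n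
    using s(2)[of n] \<phi> unfolding curl_zero_iff[OF s(1)] by blast
  then show "(\<integral>x. p x $ i * partial_deriv j \<phi> x \<partial>lebesgue) = (\<integral>x. p x $ j * partial_deriv i \<phi> x \<partial>lebesgue)"
    using l[of i j] l[of j i] LIMSEQ_unique by simp
qed

text \<open>Each component of such a field is weakly harmonic, by commuting the mixed derivatives of the
  test function through the two first-order equations.\<close>

theorem div_curl_zero_imp_zero:
  assumes h: "sq_integrable lebesgue h" and dv: "div_zero h" and cv: "curl_zero h"
  shows "AE x in lebesgue. h x = 0"
proof -
  have "AE x in lborel. h x $ i = 0" for i
  proof -
    have hm: "(\<lambda>x. h x $ i) \<in> borel_measurable lebesgue"
      using borel_measurable_inner[OF sq_integrable_measurable[OF h] measurable_const[of "axis i 1" borel]]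
      by (simp add: inner_axis)
    \<comment> \<open>The kernels of the Liouville argument are paired over \<open>lborel\<close>,
      so the Lebesgue measurable component is replaced by a Borel version.\<close>
    then obtain u where um: "u \<in> borel_measurable lborel" and hu: "AE x in lborel. h x $ i = u x"
      using completion_ex_borel_measurable_real by blast
    have um' [measurable]: "u \<in> borel_measurable borel" using um by simp
    have hu': "AE x in lebesgue. h x $ i = u x" using hu by (rule AE_completion)
    have "integrable lebesgue (\<lambda>x. (u x)\<^sup>2)"
    proof (rule Bochner_Integration.integrable_bound[OF sq_integrable_norm[OF h]])
      show "AE x in lebesgue. norm ((u x)\<^sup>2) \<le> norm ((norm (h x))\<^sup>2)"
        using hu'
      proof eventually_elim
        case (elim x)
        have "\<bar>h x $ i\<bar> \<le> norm (h x)" by (rule component_le_norm_cart)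
        then have "\<bar>h x $ i\<bar>\<^sup>2 \<le> (norm (h x))\<^sup>2" by (intro power_mono) auto
        then show ?case using elim by simp
      qed
    qed (intro measurable_completion, measurable)
    then have u2: "integrable lborel (\<lambda>x. (u x)\<^sup>2)"
      by (subst (asm) integrable_completion) measurable
    have "weakly_harmonic u"
      unfolding weakly_harmonic_def
    proof (intro allI impI)
      fix \<phi> assume \<phi>: "test_function \<phi>"
      let ?L = "\<lambda>x. \<Sum>j\<in>UNIV. partial_deriv j (partial_deriv j \<phi>) x"
      have pd: "test_function (partial_deriv j \<phi>)" "test_function (partial_deriv k (partial_deriv j \<phi>))" for j k
        using \<phi> by (auto intro: test_function_partial_deriv)
      have ii: "integrable lebesgue (\<lambda>x. h x $ k * partial_deriv l (partial_deriv j \<phi>) x)" for k l j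
        by (intro integrable_nth_test_function h pd)
      have Lm: "?L \<in> borel_measurable borel"
        by (intro borel_measurable_continuous_onI continuous_intros smooth_continuous test_function_smooth pd)
      have "(\<integral>x. u x * ?L x \<partial>lborel) = (\<integral>x. u x * ?L x \<partial>lebesgue)"
        using Lm um' by (intro integral_completion[symmetric]) simp
      also have "\<dots> = (\<integral>x. h x $ i * ?L x \<partial>lebesgue)"
      proof (rule integral_cong_AE)
        show "(\<lambda>x. u x * ?L x) \<in> borel_measurable lebesgue"
          using Lm um' by (intro measurable_completion) simp
        show "(\<lambda>x. h x $ i * ?L x) \<in> borel_measurable lebesgue"
          using Lm by (intro borel_measurable_times hm measurable_completion) simp
        show "AE x in lebesgue. u x * ?L x = h x $ i * ?L x"
          using hu' by eventually_elim simp
      qed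
      also have "\<dots> = (\<Sum>j\<in>UNIV. \<integral>x. h x $ i * partial_deriv j (partial_deriv j \<phi>) x \<partial>lebesgue)"
        unfolding sum_distrib_left by (rule Bochner_Integration.integral_sum) (rule ii)
      also have "\<dots> = (\<Sum>j\<in>UNIV. \<integral>x. h x $ j * partial_deriv i (partial_deriv j \<phi>) x \<partial>lebesgue)"
        by (intro sum.cong refl cv[unfolded curl_zero_iff[OF h], rule_format] pd)
      also have "\<dots> = (\<Sum>j\<in>UNIV. \<integral>x. h x $ j * partial_deriv j (partial_deriv i \<phi>) x \<partial>lebesgue)"
      proof -
        have "partial_deriv i (partial_deriv j \<phi>) = partial_deriv j (partial_deriv i \<phi>)" for j
          using test_function_smooth[OF \<phi>] by (auto simp: smooth_def intro!: partial_deriv_commute)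
        then show ?thesis by simp
      qed
      also have "\<dots> = (\<integral>x. h x \<bullet> grad (partial_deriv i \<phi>) x \<partial>lebesgue)"
        unfolding inner_vec_real grad_nth by (rule Bochner_Integration.integral_sum[symmetric]) (rule ii)
      also have "\<dots> = 0"
        by (rule dv[unfolded div_zero_def, rule_format, OF pd(1)])
      finally show "(\<integral>x. u x * ?L x \<partial>lborel) = 0" .
    qed
    then have "AE x in lborel. u x = 0"
      by (rule weakly_harmonic_square_integrable_eq_0[OF um' u2])
    with hu show ?thesis by eventually_elim simp
  qed
  then have "AE x in lborel. \<forall>i. h x $ i = 0"
    by (simp add: AE_all_countable)
  then have "AE x in lborel. h x = 0"
    by (simp add: vec_eq_iff)
  then show ?thesis by (rule AE_completion)
qed

text \<open>Orthogonality of the remainder to all gradients of test functions is literally the weak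
  equation \<open>div_zero\<close>. The potentials \<open>s\<close> are returned because they
  exhibit \<open>p\<close> as a limit of gradients.\<close>

lemma gradient_projection:
  assumes "sq_integrable lebesgue G"
  obtains p s where "sq_integrable lebesgue p" "\<And>n. test_function (s n)"
    "(\<lambda>n. \<integral>x. (norm (grad (s n) x - p x))\<^sup>2 \<partial>lebesgue) \<longlonglongrightarrow> 0"
    "curl_zero p" "div_zero (\<lambda>x. G x - p x)"
proof -
  let ?S = "{grad \<phi> | \<phi>. test_function \<phi>}"
  have add: "grad \<phi> x + grad \<psi> x = grad (\<lambda>x. \<phi> x + \<psi> x) x"
    if "test_function \<phi>" "test_function \<psi>" for \<phi> \<psi> x
    using that by (simp add: vec_eq_iff partial_deriv_add smooth_differentiable test_function_smooth)
  have scale: "c *\<^sub>R grad \<phi> x = grad (\<lambda>x. c * \<phi> x) x" if "test_function \<phi>" for \<phi> c x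
    using that by (simp add: vec_eq_iff partial_deriv_mult smooth_differentiable test_function_smooth smooth_const)
  obtain p g where p: "sq_integrable lebesgue p" and g: "\<And>n. g n \<in> ?S"
    and lim: "(\<lambda>n. \<integral>x. (norm (g n x - p x))\<^sup>2 \<partial>lebesgue) \<longlonglongrightarrow> 0"
    and orth: "\<And>f. f \<in> ?S \<Longrightarrow> (\<integral>x. (G x - p x) \<bullet> f x \<partial>lebesgue) = 0"
  proof (rule sq_integrable_projection[of ?S lebesgue G])
    show "(\<lambda>_. 0) \<in> ?S"
      using test_function_zero by (auto intro!: exI[of _ "\<lambda>_. 0"] simp: vec_eq_iff fun_eq_iff)
    show "(\<lambda>x. f x + k x) \<in> ?S" if "f \<in> ?S" "k \<in> ?S" for f k
      using that add test_function_add by fastforce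
    show "(\<lambda>x. c *\<^sub>R f x) \<in> ?S" if "f \<in> ?S" for f c
      using that scale test_function_scale by fastforce
  qed (use assms sq_integrable_grad in auto)
  obtain s where s: "\<And>n. test_function (s n)" and gs: "\<And>n. g n = grad (s n)"
    using g by (simp, metis)
  have "curl_zero p"
    by (rule curl_zero_limit[OF _ _ p lim]) (auto simp: gs intro!: sq_integrable_grad curl_zero_grad s)
  moreover have "div_zero (\<lambda>x. G x - p x)"
    unfolding div_zero_def using orth by blast
  moreover have "(\<lambda>n. \<integral>x. (norm (grad (s n) x - p x))\<^sup>2 \<partial>lebesgue) \<longlonglongrightarrow> 0"
    using lim unfolding gs .
  ultimately show ?thesis
    using p s by (intro that[of p s])
qed

text \<open>By definition \<open>D\<close> is orthogonal only to gradients of test functions.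
  Projecting \<open>G\<close> onto their closure leaves a remainder that is both divergence and curl
  free, hence zero, so \<open>G\<close> itself is a limit of such gradients.\<close>

theorem div_curl_zero_orthogonal:
  assumes D: "sq_integrable lebesgue D" "div_zero D" and G: "sq_integrable lebesgue G" "curl_zero G"
  shows "(\<integral>x. D x \<bullet> G x \<partial>lebesgue) = 0"
proof -
  obtain p s where p: "sq_integrable lebesgue p" and s: "\<And>n. test_function (s n)"
    and lim: "(\<lambda>n. \<integral>x. (norm (grad (s n) x - p x))\<^sup>2 \<partial>lebesgue) \<longlonglongrightarrow> 0"
    and cp: "curl_zero p" and dp: "div_zero (\<lambda>x. G x - p x)"
    by (rule gradient_projection[OF G(1)]) blast
  have "AE x in lebesgue. G x - p x = 0"
    by (intro div_curl_zero_imp_zero dp curl_zero_diff sq_integrable_diff G cp p)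
  then have "(\<integral>x. D x \<bullet> G x \<partial>lebesgue) = (\<integral>x. p x \<bullet> D x \<partial>lebesgue)"
    using borel_measurable_integrable[OF sq_integrable_inner[OF D(1) G(1)]]
      borel_measurable_integrable[OF sq_integrable_inner[OF p D(1)]]
    by (intro integral_cong_AE) (auto simp: inner_commute)
  moreover have "(\<lambda>n. \<integral>x. grad (s n) x \<bullet> D x \<partial>lebesgue) \<longlonglongrightarrow> (\<integral>x. p x \<bullet> D x \<partial>lebesgue)"
    by (intro tendsto_integral_inner sq_integrable_grad s p D lim)
  moreover have "(\<integral>x. grad (s n) x \<bullet> D x \<partial>lebesgue) = 0" for n
    using D(2) s unfolding div_zero_def by (simp add: inner_commute)
  ultimately show ?thesis by (simp add: LIMSEQ_const_iff)
qed

text \<open>Existence, so that \<open>SOME\<close> in \<open>demag_field\<close> selects an actual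
  solution. The witness is minus the projection, as the remainder after projecting is divergence
  free.\<close>

lemma is_demag_field_demag_field:
  assumes "\<Omega> \<in> sets lebesgue" "m \<in> L2 \<Omega>"
  shows "is_demag_field \<Omega> m (demag_field \<Omega> m)"
proof -
  let ?u = "\<lambda>x. indicator \<Omega> x *\<^sub>R m x"
  obtain p where p: "sq_integrable lebesgue p" "curl_zero p" "div_zero (\<lambda>x. ?u x - p x)"
    by (rule gradient_projection[OF sq_integrable_extend_by_zero[OF assms]]) blast
  have m: "sq_integrable lebesgue (\<lambda>x. - p x)" using p(1) by (rule sq_integrable_uminus)
  have "curl_zero (\<lambda>x. - p x)"
    using p(2) unfolding curl_zero_iff[OF p(1)] curl_zero_iff[OF m] by simp
  then have "is_demag_field \<Omega> m (\<lambda>x. - p x)"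
    using m p(3) by (simp add: is_demag_field_def L2_UNIV_iff)
  then show ?thesis unfolding demag_field_def by (rule someI[of "is_demag_field \<Omega> m"])
qed

section \<open>The field of a uniformly magnetised ball\<close>

text \<open>The gradient of the Newtonian potential of the ball, which is Lipschitz, and its derivative off
  the sphere.\<close>

definition ball_pot :: "real \<Rightarrow> 3 \<Rightarrow> real^3 \<Rightarrow> real" where
  "ball_pot R i x = R ^ 3 / (3 * (max R (norm x)) ^ 3) * x $ i"

definition ball_hess :: "real \<Rightarrow> 3 \<Rightarrow> 3 \<Rightarrow> real^3 \<Rightarrow> real" where
  "ball_hess R i k x = (if norm x < R then of_bool (i = k) / 3
     else R ^ 3 / 3 * (of_bool (i = k) / norm x ^ 3 - 3 * x $ i * x $ k / norm x ^ 5))"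

text \<open>If \<open>w\<close> is the potential whose Laplacian is the indicator of the ball, this
  is minus the gradient of the derivative of \<open>w\<close> along \<open>c\<close>. Formally its
  divergence is minus the derivative of the indicator along \<open>c\<close>, which cancels that of
  the magnetisation.\<close>

definition dipole_field :: "real \<Rightarrow> real^3 \<Rightarrow> real^3 \<Rightarrow> real^3" where
  "dipole_field R c x = (\<chi> i. - (\<Sum>k\<in>UNIV. c $ k * ball_hess R i k x))"

lemma ball_hess_commute: "ball_hess R i k x = ball_hess R k i x"
  by (auto simp: ball_hess_def)

lemma norm_axis_line_sq:
  "(norm (x + t *\<^sub>R axis k 1 :: real^3))\<^sup>2 = (norm x)\<^sup>2 + 2 * t * x $ k + t\<^sup>2"
  unfolding power2_norm_eq_inner
  by (simp add: inner_add inner_axis inner_axis_axis inner_axis' power2_eq_square algebra_simps)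

text \<open>A line meets the sphere where a quadratic in the parameter vanishes. This makes the
  sphere an admissible exceptional set for integration by parts.\<close>

lemma finite_line_sphere: "finite {t. x + t *\<^sub>R axis k 1 \<in> {x :: real^3. norm x = R}}"
proof (rule finite_subset)
  define D where "D = R\<^sup>2 - (norm x)\<^sup>2 + (x $ k)\<^sup>2"
  show "{t. x + t *\<^sub>R axis k 1 \<in> {x :: real^3. norm x = R}} \<subseteq> {sqrt D - x $ k, - sqrt D - x $ k}"
  proof
    fix t assume "t \<in> {t. x + t *\<^sub>R axis k 1 \<in> {x :: real^3. norm x = R}}"
    then have "(norm (x + t *\<^sub>R axis k 1))\<^sup>2 = R\<^sup>2" by simp
    then have "(t + x $ k)\<^sup>2 = D"
      unfolding norm_axis_line_sq by (simp add: D_def power2_sum algebra_simps)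
    then have "\<bar>t + x $ k\<bar> = sqrt D" using real_sqrt_abs by metis
    then show "t \<in> {sqrt D - x $ k, - sqrt D - x $ k}" by auto
  qed
qed simp

lemma continuous_ball_pot:
  assumes "R > 0" shows "continuous_on UNIV (ball_pot R i)"
proof -
  have "max R (norm x) \<noteq> 0" for x :: "real^3" using assms by (auto simp: max_def)
  then show ?thesis unfolding ball_pot_def by (intro continuous_intros) auto
qed

lemma ball_pot_has_derivative:
  assumes R: "R > 0" and x: "norm x \<noteq> R"
  shows "((\<lambda>t. ball_pot R i (x + t *\<^sub>R axis k 1)) has_real_derivative ball_hess R i k x) (at 0)"
proof -
  have lim: "((\<lambda>t. norm (x + t *\<^sub>R axis k 1)) \<longlongrightarrow> norm (x + 0 *\<^sub>R axis k 1)) (at (0::real))"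
    by (intro tendsto_intros)
  have comp: "(x + t *\<^sub>R axis k 1) $ i = x $ i + t * of_bool (i = k)" for t
    by (simp add: axis_def)
  consider "norm x < R" | "norm x > R" using x by linarith
  then show ?thesis
  proof cases
    case 1
    have ev: "\<forall>\<^sub>F t in at 0. ball_pot R i (x + t *\<^sub>R axis k 1) = (x $ i + t * of_bool (i = k)) / 3"
    proof -
      have "\<forall>\<^sub>F t in at 0. norm (x + t *\<^sub>R axis k 1) < R"
        using order_tendstoD(2)[OF lim, of R] 1 by simp
      then show ?thesis
      proof eventually_elim
        case (elim t)
        then have "max R (norm (x + t *\<^sub>R axis k 1)) = R" by simp
        then show ?case unfolding ball_pot_def comp using R by simp
      qed
    qed
    have d: "((\<lambda>t. (x $ i + t * of_bool (i = k)) / 3) has_real_derivative ball_hess R i k x) (at 0)"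
      using 1 by (auto intro!: derivative_eq_intros simp: ball_hess_def)
    show ?thesis
      by (rule DERIV_cong_ev[THEN iffD2, OF refl _ refl d])
        (use ev 1 R in \<open>auto simp: eventually_nhds_conv_at ball_pot_def max_def\<close>)
  next
    case 2
    \<comment> \<open>The squared norm along the line is a quadratic polynomial, so the exterior
      formula is differentiated as a function of \<open>sqrt (N t)\<close>, where
      \<open>N 0 > 0\<close>.\<close>
    define N where "N t = (norm x)\<^sup>2 + 2 * t * x $ k + t\<^sup>2" for t
    have nN: "norm (x + t *\<^sub>R axis k 1) = sqrt (N t)" for t
      unfolding N_def norm_axis_line_sq[symmetric] by simp
    have ev: "\<forall>\<^sub>F t in at 0. ball_pot R i (x + t *\<^sub>R axis k 1) = R ^ 3 / (3 * sqrt (N t) ^ 3) * (x $ i + t * of_bool (i = k))"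
    proof -
      have "\<forall>\<^sub>F t in at 0. R < norm (x + t *\<^sub>R axis k 1)"
        using order_tendstoD(1)[OF lim, of R] 2 by simp
      then show ?thesis
      proof eventually_elim
        case (elim t)
        then have "max R (norm (x + t *\<^sub>R axis k 1)) = sqrt (N t)" by (simp add: nN)
        then show ?case unfolding ball_pot_def comp by simp
      qed
    qed
    have n: "norm x > 0" using 2 R by linarith
    have N0: "N 0 > 0" "sqrt (N 0) = norm x" using n by (auto simp: N_def)
    have dN: "(N has_real_derivative 2 * x $ k) (at 0)"
      unfolding N_def by (auto intro!: derivative_eq_intros)
    have d: "((\<lambda>t. R ^ 3 / (3 * sqrt (N t) ^ 3) * (x $ i + t * of_bool (i = k))) has_real_derivative ball_hess R i k x) (at 0)"
      using 2 n N0
      by (auto intro!: derivative_eq_intros dN simp: ball_hess_def)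
        (simp_all add: field_simps eval_nat_numeral)
    show ?thesis
      by (rule DERIV_cong_ev[THEN iffD2, OF refl _ refl d])
        (use ev 2 R N0 in \<open>auto simp: eventually_nhds_conv_at ball_pot_def max_def\<close>)
  qed
qed

lemma ball_hess_measurable [measurable]: "ball_hess R i k \<in> borel_measurable borel"
proof -
  have [measurable]: "(\<lambda>x::real^3. x $ i) \<in> borel_measurable borel" for i
    by (intro borel_measurable_continuous_onI continuous_intros)
  show ?thesis unfolding ball_hess_def by measurable
qed

text \<open>The cubic decay is what makes the dipole field square integrable in three dimensions.
  The constant \<open>4\<close> is \<open>1 + 3\<close> from the two terms of the exterior formula;
  the maximum covers the interior as well.\<close>

lemma ball_hess_bound:
  assumes R: "R > 0"
  shows "\<bar>ball_hess R i k x\<bar> \<le> 4 * R ^ 3 / (3 * (max R (norm x)) ^ 3)"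
proof (cases "norm x < R")
  case True
  then show ?thesis using R by (simp add: ball_hess_def max_def)
next
  case False
  then have n: "norm x > 0" "norm x \<ge> R" using R by auto
  let ?n = "norm x"
  have "\<bar>x $ i * x $ k\<bar> \<le> ?n * ?n"
    unfolding abs_mult by (intro mult_mono component_le_norm_cart) auto
  then have "\<bar>3 * x $ i * x $ k / ?n ^ 5\<bar> \<le> 3 * (?n * ?n) / ?n ^ 5"
    using n by (simp add: abs_mult divide_right_mono)
  also have "\<dots> = 3 / ?n ^ 3" using n by (simp add: eval_nat_numeral)
  finally have 1: "\<bar>3 * x $ i * x $ k / ?n ^ 5\<bar> \<le> 3 / ?n ^ 3" .
  have 2: "\<bar>of_bool (i = k) / ?n ^ 3\<bar> \<le> 1 / ?n ^ 3" using n by simp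
  have "\<bar>of_bool (i = k) / ?n ^ 3 - 3 * x $ i * x $ k / ?n ^ 5\<bar> \<le> 4 / ?n ^ 3"
    using abs_triangle_ineq4[of "of_bool (i = k) / ?n ^ 3" "3 * x $ i * x $ k / ?n ^ 5"] 1 2 by simp
  then have "R ^ 3 / 3 * \<bar>of_bool (i = k) / ?n ^ 3 - 3 * x $ i * x $ k / ?n ^ 5\<bar> \<le> R ^ 3 / 3 * (4 / ?n ^ 3)"
    using R by (intro mult_left_mono) auto
  then show ?thesis using False n R by (simp add: ball_hess_def abs_mult max_absorb2)
qed

section \<open>Square integrability of the dipole field at infinity\<close>

lemma nn_integral_inverse_1_plus_sq: "(\<integral>\<^sup>+ t. ennreal (1 / (1 + t\<^sup>2)) \<partial>lborel) < \<infinity>"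
proof -
  let ?f = "\<lambda>t::real. 1 / (1 + t\<^sup>2)"
  have pos: "(\<integral>\<^sup>+ t. ennreal (?f t) * indicator {0..} t \<partial>lborel) = ennreal (pi / 2 - arctan 0)"
    by (rule nn_integral_FTC_atLeast)
      (auto intro!: derivative_eq_intros tendsto_arctan_at_top simp: inverse_eq_divide)
  have neg: "(\<integral>\<^sup>+ t. ennreal (?f t) * indicator {..0} t \<partial>lborel) = (\<integral>\<^sup>+ t. ennreal (?f t) * indicator {0..} t \<partial>lborel)"
    by (subst nn_integral_real_affine[where c = "-1" and t = 0]) (auto simp: indicator_def intro!: nn_integral_cong)
  have "(\<integral>\<^sup>+ t. ennreal (?f t) \<partial>lborel)
      \<le> (\<integral>\<^sup>+ t. ennreal (?f t) * indicator {0..} t + ennreal (?f t) * indicator {..0} t \<partial>lborel)"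
    by (intro nn_integral_mono) (auto simp: indicator_def)
  also have "\<dots> = (\<integral>\<^sup>+ t. ennreal (?f t) * indicator {0..} t \<partial>lborel) + (\<integral>\<^sup>+ t. ennreal (?f t) * indicator {..0} t \<partial>lborel)"
    by (rule nn_integral_add) auto
  also have "\<dots> < \<infinity>" unfolding neg pos by (simp add: ennreal_add_less_top)
  finally show ?thesis .
qed

text \<open>Each \<open>1 + (x \<bullet> b)^2\<close> is at most \<open>1 + |x|^2\<close>, so the
  function lies below a product of one-dimensional derivatives of the arctangent, which integrates
  factor by factor without polar coordinates.\<close>

lemma integrable_inverse_1_plus_norm_sq_cubed: "integrable lborel (\<lambda>x :: real^3. 1 / (1 + (norm x)\<^sup>2) ^ 3)"
proof -
  let ?g = "\<lambda>x :: real^3. \<Prod>b\<in>Basis. 1 / (1 + (x \<bullet> b)\<^sup>2)"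
  have "(\<integral>\<^sup>+ x. ennreal (?g x) \<partial>lborel) = (\<integral>\<^sup>+ x. (\<Prod>b\<in>Basis. ennreal (1 / (1 + (x \<bullet> b)\<^sup>2))) \<partial>(lborel :: (real^3) measure))"
    by (simp add: prod_ennreal)
  also have "\<dots> = (\<Prod>b\<in>(Basis :: (real^3) set). \<integral>\<^sup>+ t. ennreal (1 / (1 + t\<^sup>2)) \<partial>lborel)"
    by (rule nn_integral_lborel_prod[where f = "\<lambda>_ t. ennreal (1 / (1 + t\<^sup>2))"]) auto
  also have "\<dots> < \<infinity>"
    using nn_integral_inverse_1_plus_sq by (simp add: power_less_top_ennreal)
  finally have i: "integrable lborel ?g"
    by (intro integrableI_bounded) (auto simp: prod_nonneg)
  show ?thesis
  proof (rule Bochner_Integration.integrable_bound[OF i])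
    have "norm (1 / (1 + (norm x)\<^sup>2) ^ 3) \<le> norm (?g x)" for x :: "real^3"
    proof -
      have "(\<Prod>b\<in>Basis. 1 + (x \<bullet> b)\<^sup>2) \<le> (\<Prod>b\<in>(Basis :: (real^3) set). 1 + (norm x)\<^sup>2)"
      proof (rule prod_mono)
        fix b :: "real^3" assume "b \<in> Basis"
        then have "\<bar>x \<bullet> b\<bar> \<le> norm x" by (rule Basis_le_norm)
        then have "\<bar>x \<bullet> b\<bar>\<^sup>2 \<le> (norm x)\<^sup>2" by (intro power_mono) auto
        then show "0 \<le> 1 + (x \<bullet> b)\<^sup>2 \<and> 1 + (x \<bullet> b)\<^sup>2 \<le> 1 + (norm x)\<^sup>2" by simp
      qed
      then have "(\<Prod>b\<in>Basis. 1 + (x \<bullet> b)\<^sup>2) \<le> (1 + (norm x)\<^sup>2) ^ 3" by simp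
      moreover have "0 < (\<Prod>b\<in>Basis. 1 + (x \<bullet> b)\<^sup>2)"
        by (intro prod_pos) (auto simp: add_pos_nonneg)
      ultimately have "1 / (1 + (norm x)\<^sup>2) ^ 3 \<le> 1 / (\<Prod>b\<in>Basis. 1 + (x \<bullet> b)\<^sup>2)"
        by (intro divide_left_mono mult_pos_pos) (auto simp: add_pos_nonneg)
      then show ?thesis by (simp add: prod_dividef prod_nonneg abs_of_nonneg)
    qed
    then show "AE x :: real^3 in lborel. norm (1 / (1 + (norm x)\<^sup>2) ^ 3) \<le> norm (?g x)" by simp
  qed measurable
qed

lemma sq_integrable_ball_hess:
  assumes R: "R > 0"
  shows "sq_integrable lborel (ball_hess R i k)"
proof (rule sq_integrable_bound)
  \<comment> \<open>With \<open>m = max R |x|\<close>, the first factor is the square of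
    \<open>4 R^3 / 3\<close> from \<open>ball_hess_bound\<close>. The second comes from cubing
    \<open>(R / m)^2 (1 + |x|^2) \<le> 1 + R^2\<close>, which trades \<open>1 / m^6\<close> for the
    integrable majorant.\<close>
  define K where "K = (4 * R ^ 3 / 3)\<^sup>2 * ((1 + R\<^sup>2) / R\<^sup>2) ^ 3"
  show "integrable lborel (\<lambda>x :: real^3. K * (1 / (1 + (norm x)\<^sup>2) ^ 3))"
    by (intro integrable_mult_right integrable_inverse_1_plus_norm_sq_cubed)
  have "(norm (ball_hess R i k x))\<^sup>2 \<le> K * (1 / (1 + (norm x)\<^sup>2) ^ 3)" for x
  proof -
    let ?m = "max R (norm x)"
    have m: "?m > 0" using R by (simp add: less_max_iff_disj)
    have "(R / ?m)\<^sup>2 * (1 + (norm x)\<^sup>2) \<le> 1 + R\<^sup>2"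
    proof (cases "norm x \<le> R")
      case True
      then have "(norm x)\<^sup>2 \<le> R\<^sup>2" by (intro power_mono) auto
      then show ?thesis using True R by (simp add: max_absorb1)
    next
      case False
      then have "R\<^sup>2 \<le> (norm x)\<^sup>2" using R by (intro power_mono) auto
      moreover have "norm x > 0" using False R by linarith
      ultimately show ?thesis using False by (simp add: max_absorb2 power_divide field_simps)
    qed
    then have "((R / ?m)\<^sup>2 * (1 + (norm x)\<^sup>2)) ^ 3 \<le> (1 + R\<^sup>2) ^ 3"
      using R by (intro power_mono) auto
    moreover have "((R / ?m)\<^sup>2 * (1 + (norm x)\<^sup>2)) ^ 3 = R ^ 6 / ?m ^ 6 * (1 + (norm x)\<^sup>2) ^ 3"
      unfolding power_mult_distrib power_divide power_mult[symmetric] by simp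
    moreover have P: "(1 + (norm x)\<^sup>2) ^ 3 > 0" by (simp add: add_pos_nonneg)
    ultimately have "R ^ 6 / ?m ^ 6 * (1 + (norm x)\<^sup>2) ^ 3 / (R ^ 6 * (1 + (norm x)\<^sup>2) ^ 3)
        \<le> (1 + R\<^sup>2) ^ 3 / (R ^ 6 * (1 + (norm x)\<^sup>2) ^ 3)"
      using R by (intro divide_right_mono) auto
    also have "\<dots> = ((1 + R\<^sup>2) / R\<^sup>2) ^ 3 * (1 / (1 + (norm x)\<^sup>2) ^ 3)"
      unfolding power_divide power_mult[symmetric] by simp
    finally have le: "1 / ?m ^ 6 \<le> ((1 + R\<^sup>2) / R\<^sup>2) ^ 3 * (1 / (1 + (norm x)\<^sup>2) ^ 3)"
      using R P by simp
    have "\<bar>ball_hess R i k x\<bar>\<^sup>2 \<le> (4 * R ^ 3 / (3 * ?m ^ 3))\<^sup>2"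
      using ball_hess_bound[OF R] by (intro power_mono) auto
    also have "\<dots> = (4 * R ^ 3 / 3)\<^sup>2 * (1 / ?m ^ 6)"
      by (simp add: power_divide power_mult_distrib)
    also have "\<dots> \<le> (4 * R ^ 3 / 3)\<^sup>2 * (((1 + R\<^sup>2) / R\<^sup>2) ^ 3 * (1 / (1 + (norm x)\<^sup>2) ^ 3))"
      by (intro mult_left_mono le) simp
    finally show ?thesis by (simp add: K_def)
  qed
  then show "AE x in lborel. (norm (ball_hess R i k x))\<^sup>2 \<le> K * (1 / (1 + (norm x)\<^sup>2) ^ 3)" by simp
qed simp

lemma integrable_ball_hess_test:
  assumes R: "R > 0" and \<phi>: "test_function \<phi>"
  shows "integrable lborel (\<lambda>x. ball_hess R i k x * \<phi> x)"
proof -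
  have "integrable lborel (\<lambda>x. (\<phi> x)\<^sup>2)"
    using integrable_continuous_test_function[OF _ \<phi>, of \<phi>] smooth_continuous[OF test_function_smooth[OF \<phi>]]
    by (simp add: power2_eq_square)
  moreover have "\<phi> \<in> borel_measurable borel"
    by (intro borel_measurable_continuous_onI smooth_continuous test_function_smooth \<phi>)
  ultimately have "sq_integrable lborel \<phi>" by (simp add: sq_integrable_def)
  from sq_integrable_inner[OF sq_integrable_ball_hess[OF R] this] show ?thesis by simp
qed

lemma integral_ball_hess_by_parts:
  assumes R: "R > 0" and \<phi>: "test_function \<phi>"
  shows "(\<integral>x. ball_hess R i k x * \<phi> x \<partial>lborel) = - (\<integral>x. ball_pot R i x * partial_deriv k \<phi> x \<partial>lborel)"
  by (rule integral_by_parts_test_function[OF continuous_ball_pot[OF R] \<phi> integrable_ball_hess_test[OF R \<phi>]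
        finite_line_sphere[of _ k R]]) (use ball_pot_has_derivative[OF R] in auto)

text \<open>Through the potential both sides become the same pairing with a mixed second derivative
  of \<open>\<phi>\<close>: in weak form, the rows of the Hessian are curl free.\<close>

lemma integral_ball_hess_commute:
  assumes R: "R > 0" and \<phi>: "test_function \<phi>"
  shows "(\<integral>x. ball_hess R i k x * partial_deriv j \<phi> x \<partial>lborel)
    = (\<integral>x. ball_hess R i j x * partial_deriv k \<phi> x \<partial>lborel)"
proof -
  have "partial_deriv k (partial_deriv j \<phi>) = partial_deriv j (partial_deriv k \<phi>)"
    using test_function_smooth[OF \<phi>] by (auto simp: smooth_def intro!: partial_deriv_commute)
  then show ?thesis
    using integral_ball_hess_by_parts[OF R test_function_partial_deriv[OF \<phi>]] by simp
qed

text \<open>Outside the ball the potential is harmonic: \<open>3 / r^3 - 3 r^2 / r^5 = 0\<close>. On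
  the sphere itself \<open>ball_hess\<close> takes the exterior formula, in agreement with the
  indicator of the open ball, so the identity holds at every point.\<close>

lemma ball_hess_trace:
  assumes "R > 0" shows "(\<Sum>i\<in>UNIV. ball_hess R i i x) = indicator (ball 0 R) x"
proof (cases "norm x < R")
  case True
  then show ?thesis by (simp add: ball_hess_def)
next
  case False
  then have n: "norm x > 0" using assms by linarith
  have "(\<Sum>i\<in>UNIV. ball_hess R i i x) = R ^ 3 / 3 * (3 / norm x ^ 3 - 3 * (norm x)\<^sup>2 / norm x ^ 5)"
    using False by (simp add: ball_hess_def sum_3 norm_sq_3 algebra_simps add_divide_distrib diff_divide_distrib)
  also have "\<dots> = 0" using n by (simp add: eval_nat_numeral)
  finally show ?thesis using False by simp
qed

lemma sq_integrable_dipole_field: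
  assumes R: "R > 0" shows "sq_integrable lebesgue (dipole_field R c)"
proof -
  have "sq_integrable lborel (\<lambda>x. ball_hess R i k x *\<^sub>R v)" for i k and v :: "real^3"
    using sq_integrable_ball_hess[OF R, of i k]
    by (auto simp: sq_integrable_def power_mult_distrib)
  then have 1: "sq_integrable lborel (\<lambda>x. \<Sum>i\<in>UNIV. \<Sum>k\<in>UNIV. (- c $ k) *\<^sub>R (ball_hess R i k x *\<^sub>R axis i (1::real)))"
    by (intro sq_integrable_sum sq_integrable_scaleR) auto
  have "dipole_field R c = (\<lambda>x. \<Sum>i\<in>UNIV. \<Sum>k\<in>UNIV. (- c $ k) *\<^sub>R (ball_hess R i k x *\<^sub>R axis i (1::real)))"
    by (auto simp: fun_eq_iff vec_eq_iff dipole_field_def forall_3 sum_3 axis_def)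
  with 1 have "sq_integrable lborel (dipole_field R c)" by simp
  then show ?thesis
    by (auto simp: sq_integrable_def integrable_completion intro: measurable_completion)
qed

lemma dipole_field_inside: "norm x < R \<Longrightarrow> dipole_field R c x = - (1 / 3) *\<^sub>R c"
  by (auto simp: dipole_field_def ball_hess_def vec_eq_iff forall_3 sum_3)

text \<open>Both weak equations reduce to \<open>integral_ball_hess_commute\<close>: together with
  symmetry of the Hessian it gives the vanishing curl, and it turns the divergence of the Hessian
  into the derivative of its trace, the indicator of the ball.\<close>

lemma is_demag_field_dipole_field:
  assumes R: "R > 0" shows "is_demag_field (ball 0 R) (\<lambda>_. c) (dipole_field R c)"
  unfolding is_demag_field_def L2_UNIV_iff
proof (intro conjI)
  show sq: "sq_integrable lebesgue (dipole_field R c)"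
    by (rule sq_integrable_dipole_field[OF R])
  have leb: "(\<integral>x. ball_hess R i k x * partial_deriv j \<phi> x \<partial>lebesgue) = (\<integral>x. ball_hess R i k x * partial_deriv j \<phi> x \<partial>lborel)"
    and ileb: "integrable lebesgue (\<lambda>x. ball_hess R i k x * partial_deriv j \<phi> x)"
    if \<phi>: "test_function \<phi>" for i j k \<phi>
  proof -
    note i = integrable_ball_hess_test[OF R test_function_partial_deriv[OF \<phi>], of i k j]
    show "(\<integral>x. ball_hess R i k x * partial_deriv j \<phi> x \<partial>lebesgue) = (\<integral>x. ball_hess R i k x * partial_deriv j \<phi> x \<partial>lborel)"
      using borel_measurable_integrable[OF i] by (rule integral_completion)
    show "integrable lebesgue (\<lambda>x. ball_hess R i k x * partial_deriv j \<phi> x)"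
      using i borel_measurable_integrable[OF i] by (simp add: integrable_completion)
  qed
  have comp: "dipole_field R c x $ i * t = (\<Sum>k\<in>UNIV. (- c $ k) * (ball_hess R i k x * t))" for x i t
    by (simp add: dipole_field_def sum_distrib_right sum_negf mult.assoc)
  have split: "(\<integral>x. dipole_field R c x $ i * partial_deriv j \<phi> x \<partial>lebesgue)
      = (\<Sum>k\<in>UNIV. (- c $ k) * (\<integral>x. ball_hess R i k x * partial_deriv j \<phi> x \<partial>lborel))"
    if \<phi>: "test_function \<phi>" for i j \<phi>
    unfolding comp leb[OF \<phi>, symmetric]
    by (subst Bochner_Integration.integral_sum) (intro integrable_mult_right ileb \<phi>, simp)
  show "curl_zero (dipole_field R c)"
    unfolding curl_zero_iff[OF sq]
  proof (intro allI impI)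
    fix \<phi> i j assume \<phi>: "test_function \<phi>"
    show "(\<integral>x. dipole_field R c x $ i * partial_deriv j \<phi> x \<partial>lebesgue)
        = (\<integral>x. dipole_field R c x $ j * partial_deriv i \<phi> x \<partial>lebesgue)"
      unfolding split[OF \<phi>] ball_hess_commute[of R i] ball_hess_commute[of R j]
      by (simp add: integral_ball_hess_commute[OF R \<phi>, of _ i j])
  qed
  show "div_zero (\<lambda>x. indicator (ball 0 R) x *\<^sub>R c + dipole_field R c x)"
    unfolding div_zero_def
  proof (intro allI impI)
    fix \<phi> assume \<phi>: "test_function \<phi>"
    let ?I = "\<lambda>k. \<integral>x. indicator (ball 0 R) x * partial_deriv k \<phi> x \<partial>lborel"
    have tr: "(\<Sum>i\<in>UNIV. \<integral>x. ball_hess R i k x * partial_deriv i \<phi> x \<partial>lborel) = ?I k" for k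
    proof -
      have "(\<Sum>i\<in>UNIV. \<integral>x. ball_hess R i k x * partial_deriv i \<phi> x \<partial>lborel)
          = (\<Sum>i\<in>UNIV. \<integral>x. ball_hess R i i x * partial_deriv k \<phi> x \<partial>lborel)"
        by (intro sum.cong refl integral_ball_hess_commute[OF R \<phi>])
      also have "\<dots> = (\<integral>x. (\<Sum>i\<in>UNIV. ball_hess R i i x * partial_deriv k \<phi> x) \<partial>lborel)"
        by (rule Bochner_Integration.integral_sum[symmetric])
          (intro integrable_ball_hess_test R test_function_partial_deriv \<phi>)
      finally show ?thesis
        unfolding sum_distrib_right[symmetric] ball_hess_trace[OF R] .
    qed
    have ii: "integrable lebesgue (\<lambda>x. indicator (ball 0 R) x * partial_deriv k \<phi> x)"
      and il: "(\<integral>x. indicator (ball 0 R) x * partial_deriv k \<phi> x \<partial>lebesgue) = ?I k" for k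
    proof -
      have "integrable lborel (\<lambda>x. \<Sum>i\<in>UNIV. ball_hess R i i x * partial_deriv k \<phi> x)"
        by (intro Bochner_Integration.integrable_sum integrable_ball_hess_test R test_function_partial_deriv \<phi>)
      then have i: "integrable lborel (\<lambda>x. indicator (ball 0 R) x * partial_deriv k \<phi> x)"
        unfolding sum_distrib_right[symmetric] ball_hess_trace[OF R] .
      then show "integrable lebesgue (\<lambda>x. indicator (ball 0 R) x * partial_deriv k \<phi> x)"
        using borel_measurable_integrable[OF i] by (simp add: integrable_completion)
      show "(\<integral>x. indicator (ball 0 R) x * partial_deriv k \<phi> x \<partial>lebesgue) = ?I k"
        using borel_measurable_integrable[OF i] by (rule integral_completion)
    qed
    have "(\<integral>x. (indicator (ball 0 R) x *\<^sub>R c + dipole_field R c x) \<bullet> grad \<phi> x \<partial>lebesgue)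
      = (\<integral>x. (\<Sum>i\<in>UNIV. c $ i * (indicator (ball 0 R) x * partial_deriv i \<phi> x)
          + dipole_field R c x $ i * partial_deriv i \<phi> x) \<partial>lebesgue)"
      by (simp add: inner_vec_real algebra_simps)
    also have "\<dots> = (\<Sum>i\<in>UNIV. c $ i * ?I i + (\<integral>x. dipole_field R c x $ i * partial_deriv i \<phi> x \<partial>lebesgue))"
    proof -
      have 1: "integrable lebesgue (\<lambda>x. c $ i * (indicator (ball 0 R) x * partial_deriv i \<phi> x))" for i
        by (intro integrable_mult_right ii)
      have 2: "integrable lebesgue (\<lambda>x. dipole_field R c x $ i * partial_deriv i \<phi> x)" for i
        by (intro integrable_nth_test_function sq test_function_partial_deriv \<phi>)
      show ?thesis
        by (subst Bochner_Integration.integral_sum)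
          (intro Bochner_Integration.integrable_add 1 2, simp only: Bochner_Integration.integral_add[OF 1 2] integral_mult_right_zero il)
    qed
    also have "\<dots> = (\<Sum>i\<in>UNIV. c $ i * ?I i) + (\<Sum>i\<in>UNIV. \<Sum>k\<in>UNIV. (- c $ k) * (\<integral>x. ball_hess R i k x * partial_deriv i \<phi> x \<partial>lborel))"
      by (simp add: sum.distrib split[OF \<phi>])
    also have "(\<Sum>i\<in>UNIV. \<Sum>k\<in>UNIV. (- c $ k) * (\<integral>x. ball_hess R i k x * partial_deriv i \<phi> x \<partial>lborel))
      = (\<Sum>k\<in>UNIV. (- c $ k) * ?I k)"
      by (subst sum.swap) (simp only: sum_distrib_left[symmetric] tr)
    finally show "(\<integral>x. (indicator (ball 0 R) x *\<^sub>R c + dipole_field R c x) \<bullet> grad \<phi> x \<partial>lebesgue) = 0"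
      by (simp add: sum_negf)
  qed
qed

section \<open>Energy estimates\<close>

lemma integral_lebesgue_on_inner:
  fixes f g :: "real^3 \<Rightarrow> real^3"
  assumes "\<Omega> \<in> sets lebesgue"
  shows "(\<integral>x. f x \<bullet> g x \<partial>lebesgue_on \<Omega>) = (\<integral>x. (indicator \<Omega> x *\<^sub>R f x) \<bullet> g x \<partial>lebesgue)"
  using assms by (simp add: integral_restrict_space)

text \<open>The weak equation for \<open>h\<close> admits only gradients of test functions;
  orthogonality of divergence free and curl free fields extends it to every square integrable curl
  free \<open>g\<close>, in particular to \<open>h\<close> itself and to dipole fields. The
  magnetostatic identities below are instances.\<close>

lemma demag_field_reciprocity:
  assumes \<Omega>: "\<Omega> \<in> sets lebesgue" and m: "m \<in> L2 \<Omega>"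
    and h: "is_demag_field \<Omega> m h" and g: "sq_integrable lebesgue g" "curl_zero g"
  shows "(\<integral>x. m x \<bullet> g x \<partial>lebesgue_on \<Omega>) = - (\<integral>x. h x \<bullet> g x \<partial>lebesgue)"
proof -
  note u = sq_integrable_extend_by_zero[OF \<Omega> m]
  have hs: "sq_integrable lebesgue h" and dv: "div_zero (\<lambda>x. indicator \<Omega> x *\<^sub>R m x + h x)"
    using h by (simp_all add: is_demag_field_def L2_UNIV_iff)
  have "(\<integral>x. (indicator \<Omega> x *\<^sub>R m x + h x) \<bullet> g x \<partial>lebesgue) = 0"
    by (rule div_curl_zero_orthogonal[OF sq_integrable_add[OF u hs] dv g])
  then show ?thesis
    unfolding integral_lebesgue_on_inner[OF \<Omega>] inner_add_left
    by (subst (asm) Bochner_Integration.integral_add[OF sq_integrable_inner[OF u g(1)] sq_integrable_inner[OF hs g(1)]])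
      linarith
qed

lemma is_demag_field_sq_integrable: "is_demag_field \<Omega> m h \<Longrightarrow> sq_integrable lebesgue h"
  and is_demag_field_curl_zero: "is_demag_field \<Omega> m h \<Longrightarrow> curl_zero h"
  by (simp_all add: is_demag_field_def L2_UNIV_iff)

lemma ball_in_sets_lebesgue: "ball a r \<in> sets lebesgue"
  by simp

lemma const_in_L2_ball: "(\<lambda>_. c) \<in> L2 (ball 0 R)"
proof -
  interpret finite_measure "lebesgue_on (ball (0 :: real^3) R)"
    by (rule finite_measure_lebesgue_on) simp
  show ?thesis by (simp add: L2_def)
qed

lemma measure_lebesgue_on_ball:
  "measure (lebesgue_on (ball (0 :: real^3) R)) (space (lebesgue_on (ball 0 R))) = measure lebesgue (ball (0 :: real^3) R)"
  by (simp add: measure_restrict_space space_restrict_space)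

text \<open>Inside the ball the dipole field is the constant \<open>- c / 3\<close>, so the pairing
  sees \<open>m\<close> only through its integral.\<close>

lemma integral_dipole_field:
  assumes R: "R > 0" and m: "m \<in> L2 (ball 0 R)"
  shows "(\<integral>x. m x \<bullet> dipole_field R c x \<partial>lebesgue_on (ball 0 R))
    = - (1 / 3) * ((\<integral>x. m x \<partial>lebesgue_on (ball 0 R)) \<bullet> c)"
proof -
  let ?L = "lebesgue_on (ball (0 :: real^3) R)"
  have "sq_integrable ?L m" "sq_integrable ?L (\<lambda>_. c)" for c :: "real^3"
    using m const_in_L2_ball by (simp_all add: L2_eq_sq_integrable)
  from sq_integrable_inner[OF this] have "integrable ?L (\<lambda>x. m x \<bullet> c)" for c .
  from this[of "axis _ 1"] have "integrable ?L (\<lambda>x. m x $ i)" for i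
    by (simp add: inner_axis)
  then have im: "integrable ?L m" by (rule integrable_vecI)
  have "(\<integral>x. m x \<bullet> dipole_field R c x \<partial>?L) = (\<integral>x. - (1 / 3) * (m x \<bullet> c) \<partial>?L)"
    by (rule Bochner_Integration.integral_cong) (auto simp: dipole_field_inside)
  also have "\<dots> = - (1 / 3) * ((\<integral>x. m x \<partial>?L) \<bullet> c)"
    using im by simp
  finally show ?thesis .
qed

text \<open>The chosen field and the explicit dipole field are not compared pointwise. Applying
  reciprocity twice, once with each of them as the solution, exchanges the two in the pairing with
  \<open>c\<close>.\<close>

lemma magnetostatic_energy_const:
  assumes R: "R > 0"
  shows "- (\<integral>x. demag_field (ball 0 R) (\<lambda>_. c) x \<bullet> c \<partial>lebesgue_on (ball 0 R))
    = measure lebesgue (ball (0 :: real^3) R) * (norm c)\<^sup>2 / 3"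
proof -
  let ?B = "ball (0 :: real^3) R"
  let ?h = "demag_field ?B (\<lambda>_. c)" and ?g = "dipole_field R c"
  have h: "is_demag_field ?B (\<lambda>_. c) ?h"
    by (rule is_demag_field_demag_field[OF ball_in_sets_lebesgue const_in_L2_ball])
  have g: "is_demag_field ?B (\<lambda>_. c) ?g"
    by (rule is_demag_field_dipole_field[OF R])
  note rec = demag_field_reciprocity[OF ball_in_sets_lebesgue const_in_L2_ball]
  have "(\<integral>x. ?h x \<bullet> c \<partial>lebesgue_on ?B) = (\<integral>x. c \<bullet> ?h x \<partial>lebesgue_on ?B)"
    by (simp add: inner_commute)
  also have "\<dots> = - (\<integral>x. ?g x \<bullet> ?h x \<partial>lebesgue)"
    by (rule rec[OF g is_demag_field_sq_integrable[OF h] is_demag_field_curl_zero[OF h]])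
  also have "\<dots> = - (\<integral>x. ?h x \<bullet> ?g x \<partial>lebesgue)"
    by (simp add: inner_commute)
  also have "\<dots> = (\<integral>x. c \<bullet> ?g x \<partial>lebesgue_on ?B)"
    by (rule rec[OF h is_demag_field_sq_integrable[OF g] is_demag_field_curl_zero[OF g], symmetric])
  also have "\<dots> = - (1 / 3) * ((\<integral>x. c \<partial>lebesgue_on ?B) \<bullet> c)"
    by (rule integral_dipole_field[OF R const_in_L2_ball])
  also have "\<dots> = - (1 / 3) * (measure lebesgue ?B * (norm c)\<^sup>2)"
    by (simp only: lebesgue_integral_const measure_lebesgue_on_ball inner_scaleR_left power2_norm_eq_inner)
  finally show ?thesis by simp
qed

text \<open>Expanding \<open>\<integral> |h - g|\<^sup>2 \<ge> 0\<close> for the field \<open>g\<close> of the mean of \<open>m\<close>: as \<open>g\<close> is constant in the ball,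
  the cross term sees only the mean.\<close>

lemma magnetostatic_energy_ge:
  assumes R: "R > 0" and m: "m \<in> L2 (ball 0 R)"
  defines "M \<equiv> \<integral>x. m x \<partial>lebesgue_on (ball 0 R)"
  shows "- (\<integral>x. demag_field (ball 0 R) m x \<bullet> m x \<partial>lebesgue_on (ball 0 R))
    \<ge> (norm M)\<^sup>2 / (3 * measure lebesgue (ball (0 :: real^3) R))"
proof -
  let ?B = "ball (0 :: real^3) R"
  define V where "V = measure lebesgue ?B"
  have V: "V > 0" using R by (simp add: V_def content_ball_pos)
  define c where "c = M /\<^sub>R V"
  let ?h = "demag_field ?B m" and ?g = "dipole_field R c"
  have h: "is_demag_field ?B m ?h"
    by (rule is_demag_field_demag_field[OF ball_in_sets_lebesgue m])
  have g: "is_demag_field ?B (\<lambda>_. c) ?g"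
    by (rule is_demag_field_dipole_field[OF R])
  note hs = is_demag_field_sq_integrable[OF h] is_demag_field_curl_zero[OF h]
  note gs = is_demag_field_sq_integrable[OF g] is_demag_field_curl_zero[OF g]
  have hh: "(\<integral>x. (norm (?h x))\<^sup>2 \<partial>lebesgue) = - (\<integral>x. ?h x \<bullet> m x \<partial>lebesgue_on ?B)"
    using demag_field_reciprocity[OF ball_in_sets_lebesgue m h hs]
    by (simp add: inner_commute power2_norm_eq_inner)
  have hg: "(\<integral>x. ?h x \<bullet> ?g x \<partial>lebesgue) = (norm M)\<^sup>2 / (3 * V)"
    using demag_field_reciprocity[OF ball_in_sets_lebesgue m h gs] integral_dipole_field[OF R m, of c] V
    by (simp add: c_def M_def[symmetric] power2_norm_eq_inner field_simps)
  have gg: "(\<integral>x. (norm (?g x))\<^sup>2 \<partial>lebesgue) = (norm M)\<^sup>2 / (3 * V)"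
    using demag_field_reciprocity[OF ball_in_sets_lebesgue const_in_L2_ball g gs]
      integral_dipole_field[OF R const_in_L2_ball, of c c] V
    unfolding lebesgue_integral_const measure_lebesgue_on_ball
    by (simp add: V_def[symmetric] c_def power2_norm_eq_inner field_simps)
  have "0 \<le> (\<integral>x. (norm (?h x + (-1) *\<^sub>R ?g x))\<^sup>2 \<partial>lebesgue)" by simp
  then show ?thesis
    unfolding integral_norm_add_sq[OF hs(1) gs(1)] hh hg gg V_def[symmetric] by simp
qed

text \<open>The reference vector \<open>c\<close> stays free: \<open>c = m x\<close> gives the inner
  integral of the double integral of squared differences, and the mean of \<open>m\<close> gives its
  variance.\<close>

lemma sphere_deviation_from_mean:
  fixes m :: "'a \<Rightarrow> real^3"
  assumes fin: "finite_measure L" and m: "sq_integrable L m" and unit: "AE x in L. norm (m x) = 1"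
  defines "V \<equiv> measure L (space L)" and "M \<equiv> \<integral>x. m x \<partial>L"
  shows "integrable L m" "(\<integral>x. (norm (m x))\<^sup>2 \<partial>L) = V"
    "(\<integral>x. (norm (m x - c))\<^sup>2 \<partial>L) = V - 2 * (M \<bullet> c) + V * (norm c)\<^sup>2"
proof -
  interpret finite_measure L by (rule fin)
  have mm: "m \<in> borel_measurable L" using m by (simp add: sq_integrable_def)
  show im: "integrable L m"
    by (rule integrable_const_bound[where B = 1]) (use unit mm in auto)
  have "(\<integral>x. (norm (m x))\<^sup>2 \<partial>L) = (\<integral>x. 1 \<partial>L)"
    by (rule integral_cong_AE) (use unit mm in auto)
  then show 1: "(\<integral>x. (norm (m x))\<^sup>2 \<partial>L) = V" by (simp add: V_def)
  have c: "sq_integrable L (\<lambda>_. c)" by (simp add: sq_integrable_def)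
  have "(\<integral>x. (norm (m x - c))\<^sup>2 \<partial>L) = (\<integral>x. (norm (m x + (-1) *\<^sub>R c))\<^sup>2 \<partial>L)" by simp
  also have "\<dots> = V - 2 * (M \<bullet> c) + V * (norm c)\<^sup>2"
    unfolding integral_norm_add_sq[OF m c] 1 using im by (simp add: M_def V_def)
  finally show "(\<integral>x. (norm (m x - c))\<^sup>2 \<partial>L) = V - 2 * (M \<bullet> c) + V * (norm c)\<^sup>2" .
qed

lemma nn_integral_sphere_differences:
  fixes m :: "'a \<Rightarrow> real^3"
  assumes fin: "finite_measure L" and m: "sq_integrable L m" and unit: "AE x in L. norm (m x) = 1"
    and \<kappa>: "\<kappa> \<ge> 0"
  defines "V \<equiv> measure L (space L)" and "M \<equiv> \<integral>x. m x \<partial>L"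
  shows "(\<integral>\<^sup>+ (x, y). ennreal (\<kappa> * (norm (m x - m y))\<^sup>2) \<partial>(L \<Otimes>\<^sub>M L)) = ennreal (\<kappa> * (2 * V\<^sup>2 - 2 * (norm M)\<^sup>2))"
proof -
  interpret finite_measure L by (rule fin)
  have mm [measurable]: "m \<in> borel_measurable L" using m by (simp add: sq_integrable_def)
  note dev = sphere_deviation_from_mean[OF fin m unit, folded V_def M_def]
  have cs: "sq_integrable L (\<lambda>_. c)" for c :: "real^3" by (simp add: sq_integrable_def)
  have "(\<integral>\<^sup>+ (x, y). ennreal (\<kappa> * (norm (m x - m y))\<^sup>2) \<partial>(L \<Otimes>\<^sub>M L))
      = (\<integral>\<^sup>+ x. \<integral>\<^sup>+ y. ennreal (\<kappa> * (norm (m x - m y))\<^sup>2) \<partial>L \<partial>L)"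
    by (subst nn_integral_fst[symmetric]) (auto simp: case_prod_unfold)
  \<comment> \<open>The term with \<open>norm (m x)\<close> is kept, since it is known to be
    \<open>1\<close> only for almost every \<open>x\<close>; the outer integral turns its square
    into \<open>V\<close>.\<close>
  also have "\<dots> = (\<integral>\<^sup>+ x. ennreal (\<kappa> * (V - 2 * (m x \<bullet> M) + V * (norm (m x))\<^sup>2)) \<partial>L)"
  proof (rule nn_integral_cong)
    fix x
    have "integrable L (\<lambda>y. \<kappa> * (norm (m x - m y))\<^sup>2)"
      using sq_integrable_norm[OF sq_integrable_diff[OF cs m]] by simp
    then have "(\<integral>\<^sup>+ y. ennreal (\<kappa> * (norm (m x - m y))\<^sup>2) \<partial>L) = ennreal (\<integral>y. \<kappa> * (norm (m x - m y))\<^sup>2 \<partial>L)"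
      using \<kappa> by (intro nn_integral_eq_integral) auto
    then show "(\<integral>\<^sup>+ y. ennreal (\<kappa> * (norm (m x - m y))\<^sup>2) \<partial>L)
        = ennreal (\<kappa> * (V - 2 * (m x \<bullet> M) + V * (norm (m x))\<^sup>2))"
      using dev(3)[of "m x"] by (simp add: norm_minus_commute[of "m x"] inner_commute)
  qed
  also have "\<dots> = ennreal (\<integral>x. \<kappa> * (V - 2 * (m x \<bullet> M) + V * (norm (m x))\<^sup>2) \<partial>L)"
  proof (rule nn_integral_eq_integral)
    show "integrable L (\<lambda>x. \<kappa> * (V - 2 * (m x \<bullet> M) + V * (norm (m x))\<^sup>2))"
      using dev(1) sq_integrable_norm[OF m]
      by (intro integrable_mult_right Bochner_Integration.integrable_add Bochner_Integration.integrable_diff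
          integrable_inner_left) auto
    have "0 \<le> V - 2 * (m x \<bullet> M) + V * (norm (m x))\<^sup>2" for x
      unfolding inner_commute[of "m x"] dev(3)[symmetric] by simp
    then show "AE x in L. 0 \<le> \<kappa> * (V - 2 * (m x \<bullet> M) + V * (norm (m x))\<^sup>2)"
      using \<kappa> by simp
  qed
  also have "(\<integral>x. \<kappa> * (V - 2 * (m x \<bullet> M) + V * (norm (m x))\<^sup>2) \<partial>L) = \<kappa> * (V * V - 2 * (M \<bullet> M) + V * V)"
    using dev(1) sq_integrable_norm[OF m] by (simp add: dev(2) V_def M_def)
  finally show ?thesis by (simp add: power2_eq_square power2_norm_eq_inner[symmetric] algebra_simps)
qed

lemma kernel_lower_bound_ge:
  assumes "C > 0" "s > 0" "norm z \<le> r" "r > 0"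
  shows "ennreal (C / r powr (3 + 2 * s)) \<le> kernel_lower_bound C s z"
proof (cases "z = 0")
  case True
  then show ?thesis using assms by (simp add: kernel_lower_bound_def)
next
  case False
  then have "norm z powr (3 + 2 * s) \<le> r powr (3 + 2 * s)" "0 < norm z powr (3 + 2 * s)"
    using assms by (auto intro!: powr_mono2)
  then show ?thesis
    using assms by (auto simp: kernel_lower_bound_def divide_ennreal intro!: ennreal_leI divide_left_mono)
qed

lemma nonlocal_energy_ge:
  assumes "C > 0" "s > 0" and lb: "\<And>z. z \<in> ball 0 R0 \<Longrightarrow> kernel_lower_bound C s z \<le> j z"
    and R: "R > 0" "2 * R \<le> R0" and m: "m \<in> L2_sphere (ball 0 R)"
  shows "ennreal (C / (2 * R) powr (3 + 2 * s) * (2 * (measure lebesgue (ball (0 :: real^3) R))\<^sup>2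
      - 2 * (norm (\<integral>x. m x \<partial>lebesgue_on (ball 0 R)))\<^sup>2)) \<le> nonlocal_energy j (ball 0 R) m"
proof -
  let ?L = "lebesgue_on (ball (0 :: real^3) R)"
  let ?\<kappa> = "C / (2 * R) powr (3 + 2 * s)"
  have fin: "finite_measure ?L" by (rule finite_measure_lebesgue_on) simp
  have ms: "sq_integrable ?L m" "AE x in ?L. norm (m x) = 1"
    using m by (auto simp: L2_sphere_def L2_eq_sq_integrable)
  have \<kappa>: "?\<kappa> \<ge> 0" using assms by simp
  have "ennreal (?\<kappa> * (2 * (measure lebesgue (ball (0 :: real^3) R))\<^sup>2 - 2 * (norm (\<integral>x. m x \<partial>?L))\<^sup>2))
      = (\<integral>\<^sup>+ (x, y). ennreal (?\<kappa> * (norm (m x - m y))\<^sup>2) \<partial>(?L \<Otimes>\<^sub>M ?L))"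
    unfolding nn_integral_sphere_differences[OF fin ms \<kappa>] measure_lebesgue_on_ball ..
  also have "\<dots> \<le> nonlocal_energy j (ball 0 R) m"
    unfolding nonlocal_energy_def
  proof (rule nn_integral_mono, clarify)
    fix x y assume "(x, y) \<in> space (?L \<Otimes>\<^sub>M ?L)"
    then have "norm x < R" "norm y < R" by (auto simp: space_pair_measure)
    \<comment> \<open>Strict, because the balls are open; hence the difference lies in the open ball
      of radius \<open>R0\<close> even if \<open>2 * R = R0\<close>.\<close>
    then have n: "norm (x - y) < 2 * R" using norm_triangle_ineq4[of x y] by linarith
    have "ennreal ?\<kappa> \<le> kernel_lower_bound C s (x - y)"
      using n R assms(1,2) by (intro kernel_lower_bound_ge) auto
    also have "\<dots> \<le> j (x - y)" using n R by (intro lb) simp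
    finally have "ennreal ?\<kappa> * ennreal ((norm (m x - m y))\<^sup>2) \<le> j (x - y) * ennreal ((norm (m x - m y))\<^sup>2)"
      by (rule mult_right_mono) simp
    then show "ennreal (?\<kappa> * (norm (m x - m y))\<^sup>2) \<le> j (x - y) * ennreal ((norm (m x - m y))\<^sup>2)"
      by (subst ennreal_mult[OF \<kappa>]) simp_all
  qed
  finally show ?thesis .
qed

section \<open>Comparison of a minimizer with a constant field\<close>

lemma const_in_X_space:
  assumes "norm c = 1" shows "(\<lambda>_. c) \<in> X_space j (ball 0 R)"
  using assms by (simp add: X_space_def L2_sphere_def const_in_L2_ball nonlocal_energy_def case_prod_unfold)

lemma energy_const:
  assumes "R > 0" "norm c = 1"
  shows "energy j (ball 0 R) (\<lambda>_. c) = measure lebesgue (ball (0 :: real^3) R) / 3"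
  using magnetostatic_energy_const[OF assms(1), of c] assms(2)
  by (simp add: energy_def nonlocal_energy_def case_prod_unfold)

text \<open>The comparison yields \<open>6 \<kappa> V D \<le> D\<close> for the deficit
  \<open>D = V^2 - |M|^2\<close>, nonnegative because \<open>D / V\<close> is the integrated squared
  deviation of \<open>m\<close> from its mean. Once the factor exceeds \<open>1\<close>, the deficit
  and with it that deviation vanish.\<close>

lemma minimizer_const:
  assumes C: "C > 0" and s: "s > 0" and lb: "\<And>z. z \<in> ball 0 R0 \<Longrightarrow> kernel_lower_bound C s z \<le> j z"
    and R: "R > 0" "2 * R \<le> R0" and small: "(2 * R) powr (2 * s) \<le> C"
    and min: "is_minimizer j (ball 0 R) m"
  shows "\<exists>c. AE x in lebesgue_on (ball 0 R). m x = c"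
proof -
  let ?L = "lebesgue_on (ball (0 :: real^3) R)"
  define V where "V = measure lebesgue (ball (0 :: real^3) R)"
  define M where "M = (\<integral>x. m x \<partial>?L)"
  define \<kappa> where "\<kappa> = C / (2 * R) powr (3 + 2 * s)"
  have V: "V > 0" using R by (simp add: V_def content_ball_pos)
  have mX: "m \<in> X_space j (ball 0 R)" using min by (simp add: is_minimizer_def)
  then have mS: "m \<in> L2_sphere (ball 0 R)" and N: "nonlocal_energy j (ball 0 R) m < \<infinity>"
    by (simp_all add: X_space_def)
  have mL: "m \<in> L2 (ball 0 R)" using mS by (simp add: L2_sphere_def)
  have fin: "finite_measure ?L" by (rule finite_measure_lebesgue_on) simp
  have ms: "sq_integrable ?L m" "AE x in ?L. norm (m x) = 1"
    using mS by (auto simp: L2_sphere_def L2_eq_sq_integrable)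
  note dev = sphere_deviation_from_mean[OF fin ms, unfolded measure_lebesgue_on_ball, folded V_def M_def]
  define c where "c = M /\<^sub>R V"
  have var: "(\<integral>x. (norm (m x - c))\<^sup>2 \<partial>?L) = (V\<^sup>2 - (norm M)\<^sup>2) / V"
    unfolding dev(3)[of c] using V by (simp add: c_def dot_square_norm power2_eq_square field_simps)
  have "0 \<le> (V\<^sup>2 - (norm M)\<^sup>2) / V" unfolding var[symmetric] by simp
  then have D0: "0 \<le> V\<^sup>2 - (norm M)\<^sup>2" using V by (simp add: zero_le_divide_iff)
  have "ennreal (\<kappa> * (2 * V\<^sup>2 - 2 * (norm M)\<^sup>2)) \<le> nonlocal_energy j (ball 0 R) m"
    unfolding \<kappa>_def V_def M_def by (rule nonlocal_energy_ge[OF C s lb R mS])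
  \<comment> \<open>Finiteness of the nonlocal energy enters here: \<open>enn2real\<close> sends
    infinity to \<open>0\<close>, so monotonicity fails for an infinite upper value.\<close>
  then have "enn2real (ennreal (\<kappa> * (2 * V\<^sup>2 - 2 * (norm M)\<^sup>2))) \<le> enn2real (nonlocal_energy j (ball 0 R) m)"
    using N by (intro enn2real_mono) auto
  moreover have "0 \<le> \<kappa> * (2 * V\<^sup>2 - 2 * (norm M)\<^sup>2)"
    using D0 C by (simp add: \<kappa>_def)
  ultimately have 1: "\<kappa> * (2 * V\<^sup>2 - 2 * (norm M)\<^sup>2) \<le> enn2real (nonlocal_energy j (ball 0 R) m)"
    by simp
  have 2: "(norm M)\<^sup>2 / (3 * V) \<le> - (\<integral>x. demag_field (ball 0 R) m x \<bullet> m x \<partial>?L)"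
    unfolding V_def M_def by (rule magnetostatic_energy_ge[OF R(1) mL])
  \<comment> \<open>Any unit vector would do as competitor, since all constant unit fields have the
    same energy.\<close>
  have "energy j (ball 0 R) m \<le> energy j (ball 0 R) (\<lambda>_. axis 1 1)"
    using min const_in_X_space[of "axis 1 1" j R] by (simp add: is_minimizer_def)
  also have "\<dots> = V / 3"
    unfolding V_def by (rule energy_const[OF R(1)]) simp
  finally have "\<kappa> * (2 * V\<^sup>2 - 2 * (norm M)\<^sup>2) + (norm M)\<^sup>2 / (3 * V) \<le> V / 3"
    using 1 2 by (simp add: energy_def)
  then have "(\<kappa> * (2 * V\<^sup>2 - 2 * (norm M)\<^sup>2) + (norm M)\<^sup>2 / (3 * V)) * (3 * V) \<le> V / 3 * (3 * V)"
    using V by (intro mult_right_mono) auto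
  then have le: "(6 * \<kappa> * V) * (V\<^sup>2 - (norm M)\<^sup>2) \<le> V\<^sup>2 - (norm M)\<^sup>2"
    using V by (simp add: power2_eq_square algebra_simps)
  \<comment> \<open>The factor \<open>6 * (4 / 3) = 2^3\<close> from the volume cancels against
    \<open>(2 * R) ^ 3\<close>. The surviving \<open>pi\<close> makes the next inequality strict
    although \<open>small\<close> is not.\<close>
  have "6 * \<kappa> * V = pi * C / (2 * R) powr (2 * s)"
  proof -
    have "(2 * R) powr (3 + 2 * s) = (2 * R) ^ 3 * (2 * R) powr (2 * s)"
      using R by (simp add: powr_add powr_numeral)
    moreover have "V = 4 / 3 * pi * R ^ 3"
      using R by (simp add: V_def content_ball unit_ball_vol_3)
    ultimately show ?thesis using R by (simp add: \<kappa>_def field_simps power_mult_distrib)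
  qed
  also have "\<dots> > 1"
  proof -
    have "1 * C < pi * C" using C pi_gt3 by (intro mult_strict_right_mono) auto
    then have "(2 * R) powr (2 * s) < pi * C" using small by linarith
    then show ?thesis using R by simp
  qed
  finally have "6 * \<kappa> * V > 1" .
  then have "\<not> 0 < V\<^sup>2 - (norm M)\<^sup>2"
    using le mult_strict_right_mono[of 1 "6 * \<kappa> * V" "V\<^sup>2 - (norm M)\<^sup>2"] by auto
  then have "V\<^sup>2 - (norm M)\<^sup>2 = 0" using D0 by linarith
  then have "(\<integral>x. (norm (m x - c))\<^sup>2 \<partial>?L) = 0" using var by simp
  moreover have "integrable ?L (\<lambda>x. (norm (m x - c))\<^sup>2)"
    using sq_integrable_diff[OF ms(1), of "\<lambda>_. c"] const_in_L2_ball[of c R]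
    by (simp add: L2_eq_sq_integrable sq_integrable_def)
  ultimately have "AE x in ?L. (norm (m x - c))\<^sup>2 = 0"
    by (subst (asm) integral_nonneg_eq_0_iff_AE) auto
  then have "AE x in ?L. m x = c" by simp
  then show ?thesis ..
qed

theorem theorem2p11:
  fixes j :: "real^3 \<Rightarrow> ennreal" and R0 C s :: real
  assumes "j \<in> borel_measurable borel"
    and "\<And>z. j (- z) = j z"
    and "(\<integral>\<^sup>+ z. ennreal (min 1 ((norm z)\<^sup>2)) * j z \<partial>lborel) < \<infinity>"
    and "0 < R0" and "0 < C" and "0 < s" and "s < 1"
    and "\<And>z. z \<in> ball 0 R0 \<Longrightarrow> kernel_lower_bound C s z \<le> j z"
  shows "\<exists>Rstar. 0 < Rstar \<and> Rstar < R0 / 2 \<and>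
           (\<forall>R m. 0 < R \<and> R \<le> Rstar \<and> is_minimizer j (ball 0 R) m \<longrightarrow>
              (\<exists>c. AE x in lebesgue_on (ball 0 R). m x = c))"
proof -
  \<comment> \<open>\<open>R0 / 4\<close> rather than \<open>R0 / 2\<close> gives the strict
    inequality demanded of the critical radius; the second entry solves
    \<open>(2 * R) powr (2 * s) = C\<close>.\<close>
  define Rstar where "Rstar = min (R0 / 4) (C powr (1 / (2 * s)) / 2)"
  have "\<exists>c. AE x in lebesgue_on (ball 0 R). m x = c"
    if R: "0 < R" "R \<le> Rstar" and m: "is_minimizer j (ball 0 R) m" for R m
  proof (rule minimizer_const[OF assms(5,6,8) R(1) _ _ m])
    show "2 * R \<le> R0" using R assms(4) by (simp add: Rstar_def)
    have "2 * R \<le> C powr (1 / (2 * s))" using R by (simp add: Rstar_def)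
    then have "(2 * R) powr (2 * s) \<le> (C powr (1 / (2 * s))) powr (2 * s)"
      using R assms(6) by (intro powr_mono2) auto
    also have "\<dots> = C" using assms(5,6) by (simp add: powr_powr)
    finally show "(2 * R) powr (2 * s) \<le> C" .
  qed
  moreover have "0 < Rstar" "Rstar < R0 / 2"
    using assms(4,5) by (auto simp: Rstar_def)
  ultimately show ?thesis by blast
qed

end
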